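(* Let $n\geq 4$ be an integer, let $(R,\Delta)$ be a Hermitian form ring with $R$ commutative, let $(I,\Omega)$ be an odd form ideal of $(R,\Delta)$ and let $H$ be a subgroup of $\mathrm{U}_{2n+1}(R,\Delta)$ normalised by $\mathrm{EU}_{2n+1}((R,\Delta),(I,\Omega))$. Then \[\mathrm{EU}_{2n+1}((R,\Delta),U(H)\ast I^{10})\leq H\leq \mathrm{CU}_{2n+1}((R,\Delta),U(H)).\]
   Context: Form rings. Rings are associative with $1\neq 0$; $R$ is a commutative ring. A Hermitian ring $(R,\bar{\ },\lambda,\mu)$ consists of $R$, a bijection $x\mapsto\bar x$ of $R$ with $\overline{x+y}=\bar x+\bar y$, $\overline{xy}=\bar y\bar x$, $\bar 1=1$, an element $\lambda\in R$ with $\bar{\bar x}=\lambda x\bar\lambda$ for all $x\in R$ (it follows that $\bar\lambda=\lambda^{-1}$), and an element $\mu\in R$ with $\mu=\bar\mu\lambda$. A subset $A\subseteq R$ is involution invariant if $\bar x\in A$ for all $x\in A$. The Heisenberg group $\mathfrak{H}$ is $R\times R$ with group operation $(x_1,y_1)\dotplus(x_2,y_2)=(x_1+x_2,\,y_1+y_2-\bar x_1\mu x_2)$; the inverse of $\alpha$ is written $\dot{-}\alpha$, and $\alpha\,\dot{-}\,\beta:=\alpha\dotplus(\dot{-}\beta)$. For $a\in R$ put $(x,y)\circ a=(xa,\bar a y a)$; $\circ$ has higher priority than $\dotplus$ and $\dot{-}$. An $R^{\bullet}$-submodule of $\mathfrak{H}$ is a subgroup stable under all maps $\alpha\mapsto\alpha\circ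 a$ ($a\in R$). For $A\subseteq\mathfrak{H}$, $B\subseteq R$, $A\circ B$ is the subgroup of $\mathfrak{H}$ generated by all $\alpha\circ b$ ($\alpha\in A$, $b\in B$); for $A,B\subseteq \mathfrak{H}$, $A\dotplus B=\{\alpha\dotplus\beta\mid\alpha\in A,\beta\in B\}$. For a subgroup $\Omega$ of $\mathfrak{H}$, $\alpha\equiv\beta\bmod\Omega$ means $\alpha\,\dot{-}\,\beta\in\Omega$. Let $\Delta_{\min}=\{(0,x-\bar x\lambda)\mid x\in R\}$ and $\Delta_{\max}=\{(x,y)\mid \bar x\mu x+y+\bar y\lambda=0\}$. An odd form parameter is an $R^\bullet$-submodule $\Delta$ of $\mathfrak{H}$ with $\Delta_{\min}\subseteq\Delta\subseteq\Delta_{\max}$; then $(R,\Delta)$ (short for $((R,\bar{\ },\lambda,\mu),\Delta)$) is called a Hermitian form ring. Put $J(\Delta)=\{y\in R\mid\exists z\in R:(y,z)\in\Delta\}$. For an involution invariant ideal $I$ of $R$ put $\tilde I=\{x\in R\mid\overline{J(\Delta)}\mu x\subseteq I\}$, $\Omega^I_{\min}=\{(0,x-\bar x\lambda)\mid x\in I\}\dotplus\Delta\circ I$ and $\Omega^I_{\max}=\Delta\cap(\tilde I\times I)$. An odd form ideal of $(R,\Delta)$ is a pair $(I,\Omega)$ where $I$ is an involution invariant ideal and $\Omega$ is an $R^\bullet$-submodule of $\mathfrak{H}$ with $\Omega^I_{\min}\subseteq\Omega\subseteq\Omega^I_{\max}$. Put $\Delta^{1}=\Delta$, $\Delta^{-1}=\{(x,y)\mid(x,\bar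 y)\in\Delta\}$, $\Omega^1=\Omega$, $\Omega^{-1}=\{(x,y)\mid(x,\bar y)\in\Omega\}$. Product. For an odd form ideal $(J,\Sigma)$ and an involution invariant ideal $K$, $(J,\Sigma)\ast K$ is the odd form ideal $(JK,\Omega^{JK}_{\min}\dotplus\Sigma\circ K)$. Groups. Let $\Theta_+=\{1,\dots,n\}$, $\Theta_-=\{-n,\dots,-1\}$, $\Theta=\Theta_+\cup\{0\}\cup\Theta_-$, $\Theta_{\mathrm{hb}}=\Theta\setminus\{0\}$, $\epsilon(i)=1$ for $i\in\Theta_+$ and $\epsilon(i)=-1$ for $i\in\Theta_-$. Coordinates of $M=R^{2n+1}$ (columns) and rows/columns of $(2n+1)\times(2n+1)$ matrices are indexed by $\Theta$ in the order $1,\dots,n,0,-n,\dots,-1$. $\sigma_{ij}$ is the $(i,j)$ entry and $\sigma_{*j}$ the $j$-th column of $\sigma$; $\sigma_{\mathrm{hb}}=(\sigma_{ij})_{i,j\in\Theta_{\mathrm{hb}}}$; $e$ is the identity matrix, $e^{ij}$ a matrix unit. For $u,v\in M$ let $B(u,v)=\sum_{i=1}^n\bar u_iv_{-i}+\bar u_0\mu v_0+\sum_{i=-n}^{-1}\bar u_i\lambda v_{-i}$ and $Q(u)=(u_0,\sum_{i=1}^n\bar u_iu_{-i})\in\mathfrak{H}$. $\mathrm{U}_{2n+1}(R,\Delta)$ is the group of $\sigma\in\mathrm{GL}_{2n+1}(R)$ with $B(\sigma u,\sigma v)=B(u,v)$ and $Q(\sigma u)\equiv Q(u)\bmod\Delta$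 for all $u,v\in M$. Elementary subgroups. For $i,j\in\Theta_{\mathrm{hb}}$, $i\neq\pm j$, $x\in R$: $T_{ij}(x)=e+xe^{ij}-\lambda^{(\epsilon(j)-1)/2}\bar x\lambda^{(1-\epsilon(i))/2}e^{-j,-i}$. For $i\in\Theta_{\mathrm{hb}}$, $(x,y)\in\Delta^{-\epsilon(i)}$: $T_i(x,y)=e+xe^{0,-i}-\lambda^{-(1+\epsilon(i))/2}\bar x\mu e^{i0}+ye^{i,-i}$. $\mathrm{EU}_{2n+1}(R,\Delta)$ is the subgroup of $\mathrm{U}_{2n+1}(R,\Delta)$ generated by all these elements. For an odd form ideal $(I,\Omega)$, $\mathrm{EU}_{2n+1}(I,\Omega)$ is the subgroup generated by all $T_{ij}(x)$ with $x\in I$ and all $T_i(x,y)$ with $(x,y)\in\Omega^{-\epsilon(i)}$, and $\mathrm{EU}_{2n+1}((R,\Delta),(I,\Omega))$ is the normal closure of $\mathrm{EU}_{2n+1}(I,\Omega)$ in $\mathrm{EU}_{2n+1}(R,\Delta)$. Congruence subgroups. Let $M(R,\Delta)=\{u\in M\mid u_0\in J(\Delta)\}$. $\mathrm{U}_{2n+1}((R,\Delta),(I,\Omega))$ is the group of $\sigma\in\mathrm{U}_{2n+1}(R,\Delta)$ with $\sigma_{\mathrm{hb}}\equiv e_{\mathrm{hb}}\bmod I$ and $Q(\sigma u)\equiv Q(u)\bmod\Omega$ for all $u\in M(R,\Delta)$. $\mathrm{NU}_{2n+1}((R,\Delta),(I,\Omega))$ is its normaliser in $\mathrm{U}_{2n+1}(R,\Delta)$,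 and $\mathrm{CU}_{2n+1}((R,\Delta),(I,\Omega))=\{\sigma\in\mathrm{NU}_{2n+1}((R,\Delta),(I,\Omega))\mid[\sigma,\mathrm{EU}_{2n+1}(R,\Delta)]\leq\mathrm{U}_{2n+1}((R,\Delta),(I,\Omega))\}$, where $[g,h]=ghg^{-1}h^{-1}$. Upper level. For a subgroup $H\leq\mathrm{U}_{2n+1}(R,\Delta)$, the upper level $U(H)$ is the odd form ideal $(J,\Sigma)$ where $J$ is the ideal generated by $Y\cup\bar Y$, $Y$ being the set of all elements $\sigma_{ij}$, $\sigma_{ii}-\sigma_{jj}$ and all elements of the sets $\sigma_{i0}J(\Delta)$, $\overline{J(\Delta)}\mu\sigma_{0j}$, $\overline{J(\Delta)}\mu(\sigma_{00}-\sigma_{jj})J(\Delta)$ with $\sigma\in H$, $i\neq j\in\Theta_{\mathrm{hb}}$; and $\Sigma=\Omega^J_{\min}\dotplus Z\circ R$, where $Z$ is the set of all $Q(\sigma_{*j})$ and $(Q(\sigma_{*0})\,\dot{-}\,(1,0))\circ y\dotplus(y,z)\,\dot{-}\,(y,z)\circ\sigma_{ii}$ with $\sigma\in H$, $i,j\in\Theta_{\mathrm{hb}}$, $(y,z)\in\Delta$. *)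

theory Defs
  imports
    "HOL-Analysis.Determinants"
    "HOL-Algebra.Generated_Groups"
    "HOL-Algebra.Group_Action"
begin

section \<open>Hermitian form rings\<close>

text \<open>The commutative ring \<open>R\<close> is the universe of a type of class \<^class>\<open>comm_ring_1\<close>; the records
  carry the remaining data \<open>bar\<close>, \<open>\<lambda>\<close>, \<open>\<mu>\<close>, \<open>\<Delta>\<close>.\<close>

record 'a hermitian_ring =
  bar :: "'a \<Rightarrow> 'a"
  lam :: 'a
  mu :: 'a

record 'a form_ring = "'a hermitian_ring" +
  Delta :: "('a \<times> 'a) set"

definition hermitian_ring :: "('a::comm_ring_1, 'z) hermitian_ring_scheme \<Rightarrow> bool" where
  "hermitian_ring F \<longleftrightarrow>
     bij (bar F) \<and>
     (\<forall>x y. bar F (x + y) = bar F x + bar F y) \<and>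
     (\<forall>x y. bar F (x * y) = bar F y * bar F x) \<and>
     bar F 1 = 1 \<and>
     (\<forall>x. bar F (bar F x) = lam F * x * bar F (lam F)) \<and>
     mu F = bar F (mu F) * lam F"

lemma hermitian_ring_lam_inverse:
  assumes "hermitian_ring F"
  shows "lam F * bar F (lam F) = 1"
proof -
  have "bar F (bar F 1) = lam F * 1 * bar F (lam F)" and "bar F 1 = 1"
    using assms unfolding hermitian_ring_def by blast+
  then show ?thesis by simp
qed

text \<open>Integral powers of the unit \<open>\<lambda>\<close>, whose inverse is \<open>bar \<lambda>\<close> by the preceding lemma.\<close>

definition lam_power :: "('a::comm_ring_1, 'z) hermitian_ring_scheme \<Rightarrow> int \<Rightarrow> 'a" where
  "lam_power F k = (if 0 \<le> k then lam F ^ nat k else bar F (lam F) ^ nat (- k))"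

definition heisenberg :: "('a::comm_ring_1, 'z) hermitian_ring_scheme \<Rightarrow> ('a \<times> 'a) monoid" where
  "heisenberg F =
     \<lparr> carrier = UNIV,
       mult = (\<lambda>(x1, y1) (x2, y2). (x1 + x2, y1 + y2 - bar F x1 * mu F * x2)),
       one = (0, 0) \<rparr>"

lemma heisenberg_group:
  assumes "hermitian_ring F"
  shows "group (heisenberg F)"
proof (rule groupI)
  have add: "bar F (x + y) = bar F x + bar F y" for x y
    using assms by (simp add: hermitian_ring_def)
  have zero: "bar F 0 = 0"
    using add[of 0 0] by simp
  show "\<exists>y\<in>carrier (heisenberg F). y \<otimes>\<^bsub>heisenberg F\<^esub> x = \<one>\<^bsub>heisenberg F\<^esub>" for x
    by (rule bexI[of _ "(- fst x, bar F (- fst x) * mu F * fst x - snd x)"])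
       (auto simp: heisenberg_def split: prod.splits)
  show "x \<otimes>\<^bsub>heisenberg F\<^esub> y \<otimes>\<^bsub>heisenberg F\<^esub> z
      = x \<otimes>\<^bsub>heisenberg F\<^esub> (y \<otimes>\<^bsub>heisenberg F\<^esub> z)" for x y z
    by (auto simp: heisenberg_def add algebra_simps split: prod.splits)
  show "\<one>\<^bsub>heisenberg F\<^esub> \<otimes>\<^bsub>heisenberg F\<^esub> x = x" for x
    by (auto simp: heisenberg_def zero split: prod.splits)
qed (auto simp: heisenberg_def)

definition heis_minus ::
  "('a::comm_ring_1, 'z) hermitian_ring_scheme \<Rightarrow> 'a \<times> 'a \<Rightarrow> 'a \<times> 'a \<Rightarrow> 'a \<times> 'a" where
  "heis_minus F \<alpha> \<beta> = \<alpha> \<otimes>\<^bsub>heisenberg F\<^esub> inv\<^bsub>heisenberg F\<^esub> \<beta>"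

definition heis_act ::
  "('a::comm_ring_1, 'z) hermitian_ring_scheme \<Rightarrow> 'a \<times> 'a \<Rightarrow> 'a \<Rightarrow> 'a \<times> 'a" where
  "heis_act F = (\<lambda>(x, y) a. (x * a, bar F a * y * a))"

definition R_submodule ::
  "('a::comm_ring_1, 'z) hermitian_ring_scheme \<Rightarrow> ('a \<times> 'a) set \<Rightarrow> bool" where
  "R_submodule F \<Omega> \<longleftrightarrow>
     subgroup \<Omega> (heisenberg F) \<and> (\<forall>\<alpha>\<in>\<Omega>. \<forall>a. heis_act F \<alpha> a \<in> \<Omega>)"

definition heis_span ::
  "('a::comm_ring_1, 'z) hermitian_ring_scheme \<Rightarrow> ('a \<times> 'a) set \<Rightarrow> 'a set \<Rightarrow> ('a \<times> 'a) set" where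
  "heis_span F A B = generate (heisenberg F) {heis_act F \<alpha> b | \<alpha> b. \<alpha> \<in> A \<and> b \<in> B}"

definition heis_cong ::
  "('a::comm_ring_1, 'z) hermitian_ring_scheme \<Rightarrow> ('a \<times> 'a) set \<Rightarrow> 'a \<times> 'a \<Rightarrow> 'a \<times> 'a \<Rightarrow> bool" where
  "heis_cong F \<Omega> \<alpha> \<beta> \<longleftrightarrow> heis_minus F \<alpha> \<beta> \<in> \<Omega>"

definition Delta_min :: "('a::comm_ring_1, 'z) hermitian_ring_scheme \<Rightarrow> ('a \<times> 'a) set" where
  "Delta_min F = {(0, x - bar F x * lam F) | x. True}"

definition Delta_max :: "('a::comm_ring_1, 'z) hermitian_ring_scheme \<Rightarrow> ('a \<times> 'a) set" where
  "Delta_max F = {(x, y). bar F x * mu F * x + y + bar F y * lam F = 0}"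

definition hermitian_form_ring :: "('a::comm_ring_1, 'z) form_ring_scheme \<Rightarrow> bool" where
  "hermitian_form_ring F \<longleftrightarrow>
     hermitian_ring F \<and> R_submodule F (Delta F) \<and>
     Delta_min F \<subseteq> Delta F \<and> Delta F \<subseteq> Delta_max F"

text \<open>For \<open>s \<in> {1, -1}\<close> this is \<open>\<Omega>\<^sup>s\<close>.\<close>

definition signed ::
  "('a::comm_ring_1, 'z) hermitian_ring_scheme \<Rightarrow> int \<Rightarrow> ('a \<times> 'a) set \<Rightarrow> ('a \<times> 'a) set" where
  "signed F s \<Omega> = (if s = 1 then \<Omega> else {(x, y). (x, bar F y) \<in> \<Omega>})"


section \<open>Ideals and odd form ideals\<close>

text \<open>Ideals are the submodules of the ring as a module over itself, so that \<open>ideal.span\<close> is the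
  generated ideal.\<close>

global_interpretation ideal: module "(*) :: 'a::comm_ring_1 \<Rightarrow> 'a \<Rightarrow> 'a"
  by standard (simp_all add: algebra_simps)

definition ideal_mult :: "'a::comm_ring_1 set \<Rightarrow> 'a set \<Rightarrow> 'a set" where
  "ideal_mult I J = ideal.span {x * y | x y. x \<in> I \<and> y \<in> J}"

primrec ideal_power :: "'a::comm_ring_1 set \<Rightarrow> nat \<Rightarrow> 'a set" where
  "ideal_power I 0 = UNIV"
| "ideal_power I (Suc k) = ideal_mult I (ideal_power I k)"

definition invariant_ideal :: "('a::comm_ring_1, 'z) hermitian_ring_scheme \<Rightarrow> 'a set \<Rightarrow> bool" where
  "invariant_ideal F I \<longleftrightarrow> ideal.subspace I \<and> (\<forall>x\<in>I. bar F x \<in> I)"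

definition J_Delta :: "('a::comm_ring_1, 'z) form_ring_scheme \<Rightarrow> 'a set" where
  "J_Delta F = {y. \<exists>z. (y, z) \<in> Delta F}"

definition ideal_tilde :: "('a::comm_ring_1, 'z) form_ring_scheme \<Rightarrow> 'a set \<Rightarrow> 'a set" where
  "ideal_tilde F I = {x. \<forall>y\<in>J_Delta F. bar F y * mu F * x \<in> I}"

definition Omega_min :: "('a::comm_ring_1, 'z) form_ring_scheme \<Rightarrow> 'a set \<Rightarrow> ('a \<times> 'a) set" where
  "Omega_min F I = {(0, x - bar F x * lam F) | x. x \<in> I} <#>\<^bsub>heisenberg F\<^esub> heis_span F (Delta F) I"

definition Omega_max :: "('a::comm_ring_1, 'z) form_ring_scheme \<Rightarrow> 'a set \<Rightarrow> ('a \<times> 'a) set" where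
  "Omega_max F I = Delta F \<inter> (ideal_tilde F I \<times> I)"

definition odd_form_ideal ::
  "('a::comm_ring_1, 'z) form_ring_scheme \<Rightarrow> 'a set \<times> ('a \<times> 'a) set \<Rightarrow> bool" where
  "odd_form_ideal F = (\<lambda>(I, \<Omega>).
     invariant_ideal F I \<and> R_submodule F \<Omega> \<and> Omega_min F I \<subseteq> \<Omega> \<and> \<Omega> \<subseteq> Omega_max F I)"

definition form_ideal_prod ::
  "('a::comm_ring_1, 'z) form_ring_scheme \<Rightarrow> 'a set \<times> ('a \<times> 'a) set \<Rightarrow> 'a set
     \<Rightarrow> 'a set \<times> ('a \<times> 'a) set" where
  "form_ideal_prod F = (\<lambda>(J, \<Sigma>) K.
     (ideal_mult J K, Omega_min F (ideal_mult J K) <#>\<^bsub>heisenberg F\<^esub> heis_span F \<Sigma> K))"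


section \<open>The index set and matrices\<close>

text \<open>The index set \<open>\<Theta> = {1, \<dots>, n, 0, -n, \<dots>, -1}\<close> with \<open>n = CARD('n)\<close>: \<open>Pos k\<close> and \<open>Neg k\<close> stand for
  \<open>k\<close> and \<open>-k\<close>.\<close>

datatype 'n idx = Pos 'n | Zero | Neg 'n

lemma UNIV_idx: "UNIV = insert Zero (range Pos \<union> range Neg)"
proof -
  have "i \<in> insert Zero (range Pos \<union> range Neg)" for i :: "'n idx"
    by (cases i) auto
  then show ?thesis by blast
qed

instance idx :: (finite) finite
  by standard (simp add: UNIV_idx)

instantiation idx :: (type) uminus
begin

definition uminus_idx :: "'a idx \<Rightarrow> 'a idx" where
  "uminus_idx i = (case i of Pos k \<Rightarrow> Neg k | Zero \<Rightarrow> Zero | Neg k \<Rightarrow> Pos k)"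

instance ..

end

definition idx_hb :: "'n idx set" where
  "idx_hb = UNIV - {Zero}"

text \<open>Only used on \<^const>\<open>idx_hb\<close>; the value at \<open>Zero\<close> is irrelevant.\<close>

definition eps :: "'n idx \<Rightarrow> int" where
  "eps i = (case i of Pos k \<Rightarrow> 1 | Zero \<Rightarrow> 0 | Neg k \<Rightarrow> -1)"

type_synonym ('a, 'n) column = "'a ^ 'n idx"
type_synonym ('a, 'n) matrix = "'a ^ 'n idx ^ 'n idx"

text \<open>\<open>ematrix i j x\<close> is \<open>x e\<^sup>i\<^sup>j\<close>.\<close>

definition ematrix :: "'n idx \<Rightarrow> 'n idx \<Rightarrow> 'a \<Rightarrow> ('a::comm_ring_1, 'n::finite) matrix" where
  "ematrix i j x = (\<chi> k l. if k = i \<and> l = j then x else 0)"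


section \<open>Odd-dimensional unitary groups\<close>

definition B_form ::
  "('a::comm_ring_1, 'z) hermitian_ring_scheme
     \<Rightarrow> ('a, 'n::finite) column \<Rightarrow> ('a, 'n) column \<Rightarrow> 'a" where
  "B_form F u v =
     (\<Sum>i\<in>range Pos. bar F (u $ i) * v $ (- i))
     + bar F (u $ Zero) * mu F * v $ Zero
     + (\<Sum>i\<in>range Neg. bar F (u $ i) * lam F * v $ (- i))"

definition Q_form ::
  "('a::comm_ring_1, 'z) hermitian_ring_scheme \<Rightarrow> ('a, 'n::finite) column \<Rightarrow> 'a \<times> 'a" where
  "Q_form F u = (u $ Zero, \<Sum>i\<in>range Pos. bar F (u $ i) * u $ (- i))"

definition unitary_group ::
  "('a::comm_ring_1, 'z) form_ring_scheme \<Rightarrow> ('a, 'n::finite) matrix monoid" where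
  "unitary_group F =
     \<lparr> carrier = {\<sigma>. invertible \<sigma> \<and>
         (\<forall>u v. B_form F (\<sigma> *v u) (\<sigma> *v v) = B_form F u v) \<and>
         (\<forall>u. heis_cong F (Delta F) (Q_form F (\<sigma> *v u)) (Q_form F u))},
       mult = (**),
       one = mat 1 \<rparr>"

definition T_short ::
  "('a::comm_ring_1, 'z) hermitian_ring_scheme
     \<Rightarrow> 'n::finite idx \<Rightarrow> 'n idx \<Rightarrow> 'a \<Rightarrow> ('a, 'n) matrix" where
  "T_short F i j x =
     mat 1 + ematrix i j x
     - ematrix (- j) (- i)
         (lam_power F ((eps j - 1) div 2) * bar F x * lam_power F ((1 - eps i) div 2))"

definition T_extra ::
  "('a::comm_ring_1, 'z) hermitian_ring_scheme
     \<Rightarrow> 'n::finite idx \<Rightarrow> 'a \<times> 'a \<Rightarrow> ('a, 'n) matrix" where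
  "T_extra F i = (\<lambda>(x, y).
     mat 1 + ematrix Zero (- i) x
     - ematrix i Zero (lam_power F (- ((1 + eps i) div 2)) * bar F x * mu F)
     + ematrix i (- i) y)"

text \<open>\<open>EU F (I, \<Omega>)\<close> is the group generated by the elementary matrices of level \<open>(I, \<Omega>)\<close>;
  level \<open>(R, \<Delta>)\<close> gives the full elementary subgroup.\<close>

definition EU ::
  "('a::comm_ring_1, 'z) form_ring_scheme \<Rightarrow> 'a set \<times> ('a \<times> 'a) set
     \<Rightarrow> ('a, 'n::finite) matrix set" where
  "EU F = (\<lambda>(I, \<Omega>). generate (unitary_group F)
     ({T_short F i j x | i j x. i \<in> idx_hb \<and> j \<in> idx_hb \<and> i \<noteq> j \<and> i \<noteq> - j \<and> x \<in> I} \<union>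
      {T_extra F i \<alpha> | i \<alpha>. i \<in> idx_hb \<and> \<alpha> \<in> signed F (- eps i) \<Omega>}))"

abbreviation EU_full ::
  "('a::comm_ring_1, 'z) form_ring_scheme \<Rightarrow> ('a, 'n::finite) matrix set" where
  "EU_full F \<equiv> EU F (UNIV, Delta F)"

text \<open>The normal closure of \<open>EU F (I, \<Omega>)\<close> in \<open>EU_full F\<close>: the smallest normal subgroup containing it.\<close>

definition EU_rel ::
  "('a::comm_ring_1, 'z) form_ring_scheme \<Rightarrow> 'a set \<times> ('a \<times> 'a) set
     \<Rightarrow> ('a, 'n::finite) matrix set" where
  "EU_rel F L =
     (\<lambda>N. N \<lhd> ((unitary_group F)\<lparr>carrier := EU_full F\<rparr>)) hull (EU F L)"

definition U_rel ::
  "('a::comm_ring_1, 'z) form_ring_scheme \<Rightarrow> 'a set \<times> ('a \<times> 'a) set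
     \<Rightarrow> ('a, 'n::finite) matrix set" where
  "U_rel F = (\<lambda>(I, \<Omega>). {\<sigma> \<in> carrier (unitary_group F).
     (\<forall>i\<in>idx_hb. \<forall>j\<in>idx_hb. \<sigma> $ i $ j - mat 1 $ i $ j \<in> I) \<and>
     (\<forall>u. u $ Zero \<in> J_Delta F \<longrightarrow> heis_cong F \<Omega> (Q_form F (\<sigma> *v u)) (Q_form F u))})"

definition NU_rel ::
  "('a::comm_ring_1, 'z) form_ring_scheme \<Rightarrow> 'a set \<times> ('a \<times> 'a) set
     \<Rightarrow> ('a, 'n::finite) matrix set" where
  "NU_rel F L = normalizer (unitary_group F) (U_rel F L)"

definition group_commutator :: "('g, 'z) monoid_scheme \<Rightarrow> 'g \<Rightarrow> 'g \<Rightarrow> 'g" where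
  "group_commutator G g h = g \<otimes>\<^bsub>G\<^esub> h \<otimes>\<^bsub>G\<^esub> inv\<^bsub>G\<^esub> g \<otimes>\<^bsub>G\<^esub> inv\<^bsub>G\<^esub> h"

definition CU_rel ::
  "('a::comm_ring_1, 'z) form_ring_scheme \<Rightarrow> 'a set \<times> ('a \<times> 'a) set
     \<Rightarrow> ('a, 'n::finite) matrix set" where
  "CU_rel F L = {\<sigma> \<in> NU_rel F L.
     generate (unitary_group F) {group_commutator (unitary_group F) \<sigma> \<tau> | \<tau>. \<tau> \<in> EU_full F}
       \<subseteq> U_rel F L}"


section \<open>The upper level of a subgroup\<close>

definition upper_gens ::
  "('a::comm_ring_1, 'z) form_ring_scheme \<Rightarrow> ('a, 'n::finite) matrix set \<Rightarrow> 'a set" where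
  "upper_gens F H =
     {\<sigma> $ i $ j | \<sigma> i j. \<sigma> \<in> H \<and> i \<in> idx_hb \<and> j \<in> idx_hb \<and> i \<noteq> j} \<union>
     {\<sigma> $ i $ i - \<sigma> $ j $ j | \<sigma> i j. \<sigma> \<in> H \<and> i \<in> idx_hb \<and> j \<in> idx_hb \<and> i \<noteq> j} \<union>
     {\<sigma> $ i $ Zero * y | \<sigma> i y. \<sigma> \<in> H \<and> i \<in> idx_hb \<and> y \<in> J_Delta F} \<union>
     {bar F y * mu F * \<sigma> $ Zero $ j | \<sigma> j y. \<sigma> \<in> H \<and> j \<in> idx_hb \<and> y \<in> J_Delta F} \<union>
     {bar F y * mu F * (\<sigma> $ Zero $ Zero - \<sigma> $ j $ j) * z | \<sigma> j y z.
        \<sigma> \<in> H \<and> j \<in> idx_hb \<and> y \<in> J_Delta F \<and> z \<in> J_Delta F}"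

definition upper_ideal ::
  "('a::comm_ring_1, 'z) form_ring_scheme \<Rightarrow> ('a, 'n::finite) matrix set \<Rightarrow> 'a set" where
  "upper_ideal F H = ideal.span (upper_gens F H \<union> bar F ` upper_gens F H)"

definition upper_form_gens ::
  "('a::comm_ring_1, 'z) form_ring_scheme \<Rightarrow> ('a, 'n::finite) matrix set \<Rightarrow> ('a \<times> 'a) set" where
  "upper_form_gens F H =
     {Q_form F (column j \<sigma>) | \<sigma> j. \<sigma> \<in> H \<and> j \<in> idx_hb} \<union>
     {heis_minus F
        (heis_act F (heis_minus F (Q_form F (column Zero \<sigma>)) (1, 0)) y \<otimes>\<^bsub>heisenberg F\<^esub> (y, z))
        (heis_act F (y, z) (\<sigma> $ i $ i)) | \<sigma> i y z.
        \<sigma> \<in> H \<and> i \<in> idx_hb \<and> (y, z) \<in> Delta F}"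

definition upper_level ::
  "('a::comm_ring_1, 'z) form_ring_scheme \<Rightarrow> ('a, 'n::finite) matrix set
     \<Rightarrow> 'a set \<times> ('a \<times> 'a) set" where
  "upper_level F H =
     (upper_ideal F H,
      Omega_min F (upper_ideal F H) <#>\<^bsub>heisenberg F\<^esub> heis_span F (upper_form_gens F H) UNIV)"

end

theory Submission
  imports Defs
begin

text \<open>
  The proof has two parts, one for each inclusion.

  Both rest on a description of elementary matrices as transvections
  \<open>tv u v y : w \<mapsto> w + (B v w + y * B u w) u - \<lambda>\<^sup>-\<^sup>1 (B u w) v\<close> (\<open>sk_vec\<close>, \<open>tv_vec\<close>).  Conjugation by a unitary
  matrix \<open>\<sigma>\<close> simply replaces \<open>u\<close>, \<open>v\<close> by \<open>\<sigma> u\<close>, \<open>\<sigma> v\<close> (\<open>tv_conj\<close>).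

  \<^bold>\<open>Lower bound.\<close>  Let \<open>E\<close> be the relative elementary group and \<open>\<sigma> \<in> H\<close>.  For \<open>\<tau>\<close>, \<open>\<tau>'\<close> in \<open>E\<close> and
  \<open>\<xi> = \<sigma> \<tau> \<sigma>\<^sup>-\<^sup>1\<close> the element \<open>(\<tau> \<tau>' \<tau>\<^sup>-\<^sup>1) (\<xi> \<tau>'\<^sup>-\<^sup>1 \<xi>\<^sup>-\<^sup>1)\<close> is in \<open>H\<close>.  If \<open>\<tau>\<close> is built from vectors orthogonal
  to row \<open>i\<close> of \<open>\<sigma>\<close>, then \<open>\<xi>\<close> fixes the basis vector \<open>f\<close> opposite to \<open>i\<close>.  Choosing \<open>\<tau>'\<close> in the direction \<open>f\<close> keeps
  the second factor in the unipotent radical at \<open>f\<close>, and a few more commutators reduce everything to a single short root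
  element with coefficient \<open>\<sigma>\<^sub>i\<^sub>j cj(\<sigma>\<^sub>i\<^sub>i) x\<close>, with \<open>x\<close> any element of \<open>I\<^sup>5\<close> (\<open>basic_extraction\<close>).

  This holds for all subgroups normalised by \<open>E\<close>, and elementary matrices permute these.  Conjugating by elementary
  matrices that commute with the root element therefore gives more coefficients (\<open>polarise\<close>): first the other products of
  two entries of a row, then, since rows are unimodular, the entries themselves (\<open>row_entry\<close>), then all generators of the
  ideal \<open>J\<close> of the upper level (\<open>upper_ideal_extraction\<close>).  The root element appears first in certain positions; moving it
  costs a factor from \<open>I\<close>, and the total is \<open>J I\<^sup>7\<close>.  Commutators of the short root elements found yield
  long and extra short ones with coefficients from \<open>J I\<^sup>8\<close>.

  With these at hand the first construction is repeated with a \<open>\<tau>\<close> whose factors except one are in \<open>H\<close>.  What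
  survives is an extra short root element with coefficient \<open>Q(\<sigma>\<^sub>*\<^sub>p) \<circ> x\<close>, with \<open>x\<close> in \<open>I\<^sup>9\<close>
  (\<open>column_extraction\<close>), respectively in \<open>I\<^sup>1\<^sup>0\<close> at arbitrary positions (\<open>column_ext_in\<close>).  Conjugation by an extra
  short root element turns a column into a generator of the second kind of the form parameter of the upper level
  (\<open>mixed_column\<close>), so these are covered as well.  Thus \<open>H\<close> contains the elementary subgroup of level
  \<open>U(H) * I\<^sup>1\<^sup>0\<close> (\<open>EU_prod_sub\<close>), and so do all its conjugates by elementary matrices, whose upper levels are not smaller
  (\<open>upper_level_conj\<close>); the normal closure follows.

  \<^bold>\<open>Upper bound.\<close>  A matrix \<open>\<sigma>\<close> whose generators lie in the level \<open>(J, S)\<close> acts like a scalar \<open>s\<close>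
  modulo the level.  For \<open>Q\<close> this means that \<open>Q(\<sigma> v)\<close> and \<open>Q(v)\<close> differ, up to a factor in \<open>S\<close>, by
  \<open>\<alpha> \<circ> s\<close> minus \<open>\<alpha>\<close>, for any \<open>\<alpha> \<in> \<Delta>\<close> with first component \<open>v\<^sub>0\<close> (\<open>in_level_displ\<close>).  Hence \<open>\<sigma>\<close> normalises the congruence
  subgroup (\<open>in_level_conj\<close>) and commutes with elementary matrices modulo it (\<open>in_level_commutator\<close>).  The latter also shows
  that matrices of a given level are closed under conjugation by elementary matrices, which is what the comparison of
  the upper levels of conjugate subgroups needs.
\<close>

section \<open>Indices, columns and the hermitian form\<close>

text \<open>As a simplification rule the module law \<open>a * (b * x) = (a * b) * x\<close> loops against the
  associativity law of multiplication.\<close>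

declare ideal.scale_scale [simp del]

lemma neg_neg_idx [simp]: "- (- i) = (i :: 'n idx)"
  and neg_eq_idx [simp]: "- i = - j \<longleftrightarrow> i = (j :: 'n idx)"
  and neg_Zero [simp]: "- Zero = (Zero :: 'n idx)"
  and neg_Pos [simp]: "- Pos a = Neg a"
  and neg_Neg [simp]: "- Neg a = Pos a"
  by (auto simp: uminus_idx_def split: idx.splits)

lemma neg_iff: "- i = j \<longleftrightarrow> i = - (j :: 'n idx)"
  by (metis neg_neg_idx)

lemma neg_eq_Zero [simp]: "- i = Zero \<longleftrightarrow> i = (Zero :: 'n idx)" "Zero = - i \<longleftrightarrow> i = (Zero :: 'n idx)"
  by (auto simp: uminus_idx_def split: idx.splits)

lemma neg_eq_self [simp]: "- i = i \<longleftrightarrow> i = (Zero :: 'n idx)" "i = - i \<longleftrightarrow> i = (Zero :: 'n idx)"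
  by (auto simp: uminus_idx_def split: idx.splits)

lemma in_idx_hb [simp]: "i \<in> idx_hb \<longleftrightarrow> i \<noteq> Zero"
  by (simp add: idx_hb_def)

definition apart :: "'n idx \<Rightarrow> 'n idx \<Rightarrow> bool" where
  "apart i j \<longleftrightarrow> i \<noteq> j \<and> i \<noteq> - j"

lemma apartD:
  assumes "apart i j"
  shows "i \<noteq> j" "j \<noteq> i" "i \<noteq> - j" "- j \<noteq> i" "- i \<noteq> j" "j \<noteq> - i"
  using assms by (auto simp: apart_def)

lemma apart_sym: "apart i j \<longleftrightarrow> apart j i"
  by (auto simp: apart_def)

lemma apart_neg [simp]: "apart (- i) j \<longleftrightarrow> apart i j" "apart i (- j) \<longleftrightarrow> apart i j"
  by (auto simp: apart_def)

text \<open>Three pairs of opposite indices exhaust at most three of the \<open>n\<close> pairs; this is where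
  \<open>n \<ge> 4\<close> enters.\<close>

lemma ex_apart_three:
  fixes i j k :: "'n::finite idx"
  assumes "CARD('n) \<ge> 4"
  obtains l where "l \<noteq> Zero" "apart l i" "apart l j" "apart l k"
proof -
  define r where "r = (\<lambda>i :: 'n idx. case i of Pos a \<Rightarrow> {a} | Neg a \<Rightarrow> {a} | Zero \<Rightarrow> {})"
  have c1: "finite (r i) \<and> card (r i) \<le> 1" for i
    by (auto simp: r_def split: idx.splits)
  have "card (r i \<union> r j \<union> r k) \<le> card (r i \<union> r j) + card (r k)"
    by (rule card_Un_le)
  also have "\<dots> \<le> (card (r i) + card (r j)) + card (r k)"
    using card_Un_le by (rule add_right_mono)
  also have "\<dots> \<le> 3"
    using c1[of i] c1[of j] c1[of k] by linarith
  finally have "r i \<union> r j \<union> r k \<noteq> UNIV"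
    using assms by auto
  then obtain a where a: "a \<notin> r i" "a \<notin> r j" "a \<notin> r k" by blast
  have "apart (Pos a) l" if "a \<notin> r l" for l
    using that by (auto simp: apart_def r_def uminus_idx_def split: idx.splits)
  with a show thesis by (intro that[of "Pos a"]) auto
qed

lemma matrix_eqI:
  fixes A :: "('a::comm_ring_1, 'n::finite) matrix"
  assumes "\<And>w. A *v w = B *v w"
  shows "A = B"
  using assms by (simp add: matrix_eq)

lemma matrix_vector_minus_mat: "(- A) *v w = - (A *v (w :: ('a::comm_ring_1, 'n::finite) column))"
  by (simp add: matrix_vector_mult_def vec_eq_iff sum_negf)

lemma matrix_vector_uminus_right: "A *v (- w) = - (A *v (w :: ('a::comm_ring_1, 'n::finite) column))"
  by (simp add: matrix_vector_mult_def vec_eq_iff sum_negf)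

lemma matrix_vector_scale_right: "A *v (r *s w) = r *s (A *v (w :: ('a::comm_ring_1, 'n::finite) column))"
  by (simp add: matrix_vector_mult_def vec_eq_iff sum_distrib_left mult_ac)

lemmas mv_linear = matrix_vector_mult_add_rdistrib matrix_vector_right_distrib matrix_vector_scale_right
  matrix_vector_mult_diff_rdistrib matrix_vector_mult_diff_distrib matrix_vector_uminus_right matrix_vector_minus_mat

lemma axis_nth_if: "axis i x $ k = (if k = i then x else 0)"
  by (simp add: axis_def)

lemma matrix_vector_axis: "(A *v axis j x) $ i = A $ i $ j * (x::'a::comm_ring_1)"
  by (simp add: matrix_vector_mult_def axis_def if_distrib[of "\<lambda>z. _ * z"] cong: if_cong)

lemma axis_scale: "r *s axis j x = axis j (r * (x::'a::comm_ring_1))"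
  by (simp add: vec_eq_iff axis_nth_if)

lemma axis_add: "axis j x + axis j y = axis j (x + (y::'a::comm_ring_1))"
  by (simp add: vec_eq_iff axis_nth_if)

lemma axis_minus: "axis j x - axis j y = axis j (x - (y::'a::comm_ring_1))"
  by (simp add: vec_eq_iff axis_nth_if)

lemma axis_uminus: "- axis j x = axis j (- (x::'a::comm_ring_1))"
  by (simp add: vec_eq_iff axis_nth_if)

lemma axis_zero [simp]: "axis j (0::'a::comm_ring_1) = 0"
  by (simp add: vec_eq_iff axis_nth_if)

text \<open>With these weights the three sums in the definition of the hermitian form become one sum over all
  indices (\<open>B_eq_sum\<close> below).\<close>

definition wt :: "('a::comm_ring_1, 'z) hermitian_ring_scheme \<Rightarrow> 'n idx \<Rightarrow> 'a" where
  "wt F i = (case i of Pos a \<Rightarrow> 1 | Zero \<Rightarrow> mu F | Neg a \<Rightarrow> lam F)"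

lemma wt_simps [simp]: "wt F (Pos a) = 1" "wt F Zero = mu F" "wt F (Neg a) = lam F"
  by (simp_all add: wt_def)

lemma sum_idx:
  fixes f :: "'n::finite idx \<Rightarrow> 'a::comm_monoid_add"
  shows "sum f UNIV = sum f (range Pos) + f Zero + sum f (range Neg)"
proof -
  have "sum f UNIV = sum f (insert Zero (range Pos \<union> range Neg))"
    by (simp add: UNIV_idx)
  also have "\<dots> = f Zero + sum f (range Pos \<union> range Neg)"
    by (subst sum.insert) auto
  also have "sum f (range Pos \<union> range Neg) = sum f (range Pos) + sum f (range Neg)"
    by (rule sum.union_disjoint) auto
  finally show ?thesis by (simp add: add_ac)
qed

locale hermitian_forms =
  fixes F :: "'a::comm_ring_1 form_ring"
  assumes hermitian_form_ring: "hermitian_form_ring F"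
begin

text \<open>Since the ring is commutative, \<open>bar\<close> is an involutive ring automorphism and \<open>\<lambda>\<close> is a
  unit with inverse \<open>il\<close>, of norm one.\<close>

abbreviation cj :: "'a \<Rightarrow> 'a" where "cj \<equiv> bar F"
abbreviation lm :: 'a where "lm \<equiv> lam F"
abbreviation il :: 'a where "il \<equiv> bar F (lam F)"
abbreviation B :: "('a, 'n::finite) column \<Rightarrow> ('a, 'n) column \<Rightarrow> 'a" where "B \<equiv> B_form F"

lemma hermitian_ring: "hermitian_ring F"
  using hermitian_form_ring by (simp add: hermitian_form_ring_def)

lemma cj_add [simp]: "cj (x + y) = cj x + cj y"
  and cj_mult [simp]: "cj (x * y) = cj x * cj y"
  and cj_one [simp]: "cj 1 = 1"
  and mu_eq: "mu F = cj (mu F) * lm"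
  using hermitian_ring unfolding hermitian_ring_def by (blast, metis mult.commute, blast, blast)

lemma lm_il [simp]: "lm * il = 1" "il * lm = 1"
  using hermitian_ring_lam_inverse[OF hermitian_ring] by (simp_all add: mult.commute)

lemma lm_il_cancel [simp]: "lm * (il * x) = x" "il * (lm * x) = x"
  by (simp_all flip: mult.assoc)

lemma cj_cj [simp]: "cj (cj x) = x"
proof -
  have "cj (cj x) = lm * x * il"
    using hermitian_ring unfolding hermitian_ring_def by blast
  also have "\<dots> = (lm * il) * x" by (simp only: mult_ac)
  finally show ?thesis by simp
qed

lemma cj_zero [simp]: "cj 0 = 0"
  using cj_add[of 0 0] by simp

lemma cj_minus [simp]: "cj (- x) = - cj x"
  using cj_add[of x "- x"] by (simp add: eq_neg_iff_add_eq_0 add.commute)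

lemma cj_diff [simp]: "cj (x - y) = cj x - cj y"
  using cj_add[of x "- y"] by simp

lemma cj_sum [simp]: "cj (sum f A) = (\<Sum>i\<in>A. cj (f i))"
  by (induction A rule: infinite_finite_induct) auto

lemma cj_mu [simp]: "cj (mu F) = mu F * il"
  using mu_eq by (metis lm_il(1) mult.assoc mult.right_neutral)

lemma wt_neg: "wt F (- i) = lm * cj (wt F i)"
proof (cases i)
  case Zero
  have "mu F = lm * cj (mu F)" using mu_eq by (metis mult.commute)
  then show ?thesis using Zero by (simp only: neg_Zero wt_simps)
qed auto

lemma B_eq_sum: "B u v = (\<Sum>i\<in>UNIV. cj (u $ i) * wt F i * v $ (- i))"
proof -
  have "(\<Sum>i\<in>range Pos. cj (u $ i) * wt F i * v $ (- i)) = (\<Sum>i\<in>range Pos. cj (u $ i) * v $ (- i))"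
    "(\<Sum>i\<in>range Neg. cj (u $ i) * wt F i * v $ (- i)) = (\<Sum>i\<in>range Neg. cj (u $ i) * lm * v $ (- i))"
    by (auto intro!: sum.cong)
  then show ?thesis by (simp add: sum_idx B_form_def)
qed

lemma B_add_left [simp]: "B (u + u') v = B u v + B u' v"
  and B_add_right [simp]: "B u (v + v') = B u v + B u v'"
  and B_scale_left [simp]: "B (r *s u) v = cj r * B u v"
  and B_scale_right [simp]: "B u (r *s v) = r * B u v"
  and B_minus_left [simp]: "B (- u) v = - B u v"
  and B_minus_right [simp]: "B u (- v) = - B u v"
  and B_diff_left [simp]: "B (u - u') v = B u v - B u' v"
  and B_diff_right [simp]: "B u (v - v') = B u v - B u v'"
  and B_zero_left [simp]: "B 0 v = 0"
  and B_zero_right [simp]: "B u 0 = 0"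
  by (simp_all add: B_eq_sum distrib_left distrib_right left_diff_distrib right_diff_distrib
      sum.distrib sum_subtractf sum_negf sum_distrib_left mult_ac)

lemma neg_bij: "bij_betw uminus UNIV (UNIV :: 'n idx set)"
  by (rule bij_betw_byWitness[where f' = uminus]) auto

lemma B_swap: "B v u = lm * cj (B u v)"
proof -
  have "B v u = (\<Sum>i\<in>UNIV. cj (v $ (- i)) * wt F (- i) * u $ i)"
    unfolding B_eq_sum by (rule sum.reindex_bij_betw[OF neg_bij, symmetric, THEN trans]) simp
  also have "\<dots> = lm * cj (B u v)"
    by (simp add: B_eq_sum sum_distrib_left wt_neg mult_ac)
  finally show ?thesis .
qed

lemma B_axis_left [simp]: "B (axis i x) v = cj x * wt F i * v $ (- i)"
proof -
  have "B (axis i x) v = (\<Sum>k\<in>UNIV. if k = i then cj x * wt F i * v $ (- i) else 0)"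
    unfolding B_eq_sum by (rule sum.cong) (auto simp: axis_nth_if)
  then show ?thesis by simp
qed

lemma B_axis_right [simp]: "B v (axis i x) = cj (v $ (- i)) * wt F (- i) * x"
  using B_swap[of v "axis i x"] by (simp add: wt_neg mult_ac)

lemma wt_unit: "i \<noteq> Zero \<Longrightarrow> cj (wt F i) * wt F i = 1"
  by (cases i) auto

lemma wt_unit' [simp]: "i \<noteq> Zero \<Longrightarrow> wt F i * cj (wt F i) = 1"
  by (cases i) auto

section \<open>The Heisenberg group and the form parameter\<close>

abbreviation HG :: "('a \<times> 'a) monoid" where "HG \<equiv> heisenberg F"
abbreviation hplus :: "'a \<times> 'a \<Rightarrow> 'a \<times> 'a \<Rightarrow> 'a \<times> 'a" (infixl "\<dotplus>" 70) where
  "\<alpha> \<dotplus> \<beta> \<equiv> \<alpha> \<otimes>\<^bsub>heisenberg F\<^esub> \<beta>"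
abbreviation hminus :: "'a \<times> 'a \<Rightarrow> 'a \<times> 'a" ("\<dotminus> _" [81] 80) where
  "\<dotminus> \<alpha> \<equiv> inv\<^bsub>heisenberg F\<^esub> \<alpha>"
abbreviation act :: "'a \<times> 'a \<Rightarrow> 'a \<Rightarrow> 'a \<times> 'a" where "act \<equiv> heis_act F"
text \<open>The elements \<open>trc z\<close> form \<open>\<Delta>\<^sub>m\<^sub>i\<^sub>n\<close>; they are the traces that measure the failure of
  additivity of \<open>Q\<close> and of the action.\<close>

abbreviation trc :: "'a \<Rightarrow> 'a \<times> 'a" where "trc z \<equiv> (0, z - cj z * lm)"
abbreviation U :: "('a, 'n::finite) matrix monoid" where "U \<equiv> unitary_group F"
abbreviation Q :: "('a, 'n::finite) column \<Rightarrow> 'a \<times> 'a" where "Q \<equiv> Q_form F"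
abbreviation D :: "('a \<times> 'a) set" where "D \<equiv> Delta F"
abbreviation JD :: "'a set" where "JD \<equiv> J_Delta F"

sublocale heis: group "heisenberg F"
  by (rule heisenberg_group[OF hermitian_ring])

lemma heis_carrier [simp]: "carrier HG = UNIV"
  by (simp add: heisenberg_def)

lemma heis_mult [simp]: "(x1, y1) \<dotplus> (x2, y2) = (x1 + x2, y1 + y2 - cj x1 * mu F * x2)"
  by (simp add: heisenberg_def)

lemma heis_one [simp]: "\<one>\<^bsub>HG\<^esub> = (0, 0)"
  by (simp add: heisenberg_def)

lemma heis_inv [simp]: "\<dotminus> (x, y) = (- x, - y - cj x * mu F * x)"
  by (rule heis.inv_equality) (auto simp: algebra_simps)

lemma heis_minus [simp]:
  "heis_minus F (x1, y1) (x2, y2) = (x1 - x2, y1 - y2 - cj x2 * mu F * x2 + cj x1 * mu F * x2)"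
  by (simp add: heis_minus_def)

lemma heis_act [simp]: "act (x, y) a = (x * a, cj a * y * a)"
  by (simp add: heis_act_def)

lemma heis_act_mult: "act (\<alpha> \<dotplus> \<beta>) a = act \<alpha> a \<dotplus> act \<beta> a"
  by (cases \<alpha>; cases \<beta>) (simp add: algebra_simps)

lemma heis_act_inv: "act (\<dotminus> \<alpha>) a = \<dotminus> (act \<alpha> a)"
  by (cases \<alpha>) (simp add: algebra_simps)

lemma heis_act_act: "act (act \<alpha> a) b = act \<alpha> (a * b)"
  by (cases \<alpha>) (simp add: algebra_simps)

lemma D_submodule: "R_submodule F D"
  and D_min: "Delta_min F \<subseteq> D" and D_max: "D \<subseteq> Delta_max F"
  using hermitian_form_ring by (auto simp: hermitian_form_ring_def)

lemma submodule_subgroup: "R_submodule F S \<Longrightarrow> subgroup S HG"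
  by (simp add: R_submodule_def)

lemma submodule_act: "R_submodule F S \<Longrightarrow> \<alpha> \<in> S \<Longrightarrow> act \<alpha> a \<in> S"
  by (simp add: R_submodule_def)

lemma D_subgroup: "subgroup D HG"
  using D_submodule by (rule submodule_subgroup)

lemmas D_mult = subgroup.m_closed[OF D_subgroup]
  and D_inv = subgroup.m_inv_closed[OF D_subgroup]

lemma D_zero [simp]: "(0, 0) \<in> D"
  using subgroup.one_closed[OF D_subgroup] by simp

lemma D_act: "\<alpha> \<in> D \<Longrightarrow> act \<alpha> a \<in> D"
  using D_submodule by (rule submodule_act)

lemma D_long: "trc z \<in> D"
  using D_min by (auto simp: Delta_min_def)

lemma D_eq: "(x, y) \<in> D \<Longrightarrow> cj x * mu F * x + y + cj y * lm = 0"
  using D_max by (auto simp: Delta_max_def)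

lemma D_eq': assumes "(x, y) \<in> D" shows "cj x * mu F * x = - y - cj y * lm"
  using D_eq[OF assms] by (simp add: eq_neg_iff_add_eq_0 algebra_simps)

lemma D_neg_fst: assumes "(x, y) \<in> D" shows "(- x, y) \<in> D"
  using D_act[OF assms, of "- 1"] by simp

lemma JD_iff: "x \<in> JD \<longleftrightarrow> (\<exists>y. (x, y) \<in> D)"
  by (simp add: J_Delta_def)

lemma JD_ideal: "ideal.subspace JD"
proof (rule ideal.subspaceI)
  show "0 \<in> JD" using D_zero unfolding JD_iff by blast
  show "x + y \<in> JD" if xy: "x \<in> JD" "y \<in> JD" for x y
  proof -
    from xy obtain x' y' where "(x, x') \<in> D" "(y, y') \<in> D" unfolding JD_iff by blast
    from D_mult[OF this] show ?thesis by (auto simp: JD_iff)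
  qed
  show "c * x \<in> JD" if x: "x \<in> JD" for c x
  proof -
    from x obtain x' where "(x, x') \<in> D" unfolding JD_iff by blast
    from D_act[OF this, of c] show ?thesis by (auto simp: JD_iff mult.commute)
  qed
qed

lemma JD_mult: "x \<in> JD \<Longrightarrow> x * c \<in> JD" "x \<in> JD \<Longrightarrow> c * x \<in> JD"
  using ideal.subspace_scale[OF JD_ideal, of x c] by (auto simp: mult.commute)

lemmas JD_add = ideal.subspace_add[OF JD_ideal]
  and JD_diff = ideal.subspace_diff[OF JD_ideal]
  and JD_zero = ideal.subspace_0[OF JD_ideal]

text \<open>The second component of \<open>Q v\<close> is \<open>pr v v\<close>, and the even part of the hermitian form is
  \<open>pr\<close> symmetrised (\<open>B_pr\<close> below), so \<open>pr\<close> makes \<open>Q\<close> accessible to bilinear computations.\<close>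

definition pr :: "('a, 'n::finite) column \<Rightarrow> ('a, 'n) column \<Rightarrow> 'a" where
  "pr u v = (\<Sum>i\<in>range Pos. cj (v $ i) * u $ (- i))"

lemma Q_eq: "Q v = (v $ Zero, pr v v)"
  by (simp add: Q_form_def pr_def)

lemma pr_add_left: "pr (u + u') v = pr u v + pr u' v"
  and pr_add_right: "pr u (v + v') = pr u v + pr u v'"
  and pr_scale_left: "pr (r *s u) v = r * pr u v"
  and pr_scale_right: "pr u (r *s v) = cj r * pr u v"
  and pr_minus_left: "pr (- u) v = - pr u v"
  and pr_minus_right: "pr u (- v) = - pr u v"
  and pr_diff_left: "pr (u - u') v = pr u v - pr u' v"
  and pr_diff_right: "pr u (v - v') = pr u v - pr u v'"
  by (simp_all add: pr_def distrib_left distrib_right left_diff_distrib right_diff_distrib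
      sum.distrib sum_subtractf sum_negf sum_distrib_left mult_ac)

lemmas pr_linear = pr_add_left pr_add_right pr_scale_left pr_scale_right pr_minus_left
  pr_minus_right pr_diff_left pr_diff_right

lemma B_pr: "B u v = pr v u + cj (u $ Zero) * mu F * v $ Zero + lm * cj (pr u v)"
proof -
  have "(\<Sum>i\<in>range Neg. cj (u $ i) * lm * v $ (- i)) = (\<Sum>i\<in>range Pos. cj (u $ (- i)) * lm * v $ i)"
    by (rule sum.reindex_bij_witness[where i = uminus and j = uminus]) auto
  then show ?thesis by (simp add: B_form_def pr_def sum_distrib_left mult_ac)
qed

lemma pr_axis_left: "pr (axis i x) v = (if i \<in> range Neg then cj (v $ (- i)) * x else 0)"
proof -
  have "pr (axis i x) v = (\<Sum>k\<in>range Pos. if k = - i then cj (v $ (- i)) * x else 0)"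
    unfolding pr_def by (rule sum.cong) (auto simp: axis_nth_if)
  also have "\<dots> = (if - i \<in> range Pos then cj (v $ (- i)) * x else 0)"
    by (simp add: sum.delta)
  finally show ?thesis by (cases i) auto
qed

lemma pr_axis_right: "pr u (axis i x) = (if i \<in> range Pos then cj x * u $ (- i) else 0)"
proof -
  have "pr u (axis i x) = (\<Sum>k\<in>range Pos. if k = i then cj x * u $ (- i) else 0)"
    unfolding pr_def by (rule sum.cong) (auto simp: axis_nth_if)
  then show ?thesis by (simp add: sum.delta)
qed

lemma pr_axis_axis [simp]: "pr (axis i x) (axis i y) = 0"
  by (auto simp: pr_axis_left axis_nth_if)

section \<open>The unitary group\<close>

definition unitary :: "('a, 'n::finite) matrix \<Rightarrow> bool" where
  "unitary \<sigma> \<longleftrightarrow> invertible \<sigma> \<and> (\<forall>u v. B (\<sigma> *v u) (\<sigma> *v v) = B u v) \<and>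
     (\<forall>u. heis_minus F (Q (\<sigma> *v u)) (Q u) \<in> D)"

lemma carrier_U [simp]: "\<sigma> \<in> carrier U \<longleftrightarrow> unitary \<sigma>"
  by (simp add: unitary_group_def unitary_def heis_cong_def)

lemma mult_U [simp]: "\<sigma> \<otimes>\<^bsub>U\<^esub> \<tau> = \<sigma> ** \<tau>"
  and one_U [simp]: "\<one>\<^bsub>U\<^esub> = mat 1"
  by (simp_all add: unitary_group_def)

lemma unitary_B: "unitary \<sigma> \<Longrightarrow> B (\<sigma> *v u) (\<sigma> *v v) = B u v"
  by (simp add: unitary_def)

lemma unitary_Q: "unitary \<sigma> \<Longrightarrow> heis_minus F (Q (\<sigma> *v u)) (Q u) \<in> D"
  by (simp add: unitary_def)

lemma heis_minus_trans:
  "heis_minus F \<alpha> \<beta> \<dotplus> heis_minus F \<beta> \<gamma> = heis_minus F \<alpha> \<gamma>"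
  by (cases \<alpha>; cases \<beta>; cases \<gamma>) (simp add: algebra_simps)

lemma heis_minus_inv: "\<dotminus> (heis_minus F \<alpha> \<beta>) = heis_minus F \<beta> \<alpha>"
  by (cases \<alpha>; cases \<beta>) (simp add: algebra_simps)

lemma unitary_mult:
  assumes "unitary \<sigma>" "unitary \<tau>" shows "unitary (\<sigma> ** \<tau>)"
proof -
  have "heis_minus F (Q (\<sigma> *v (\<tau> *v u))) (Q (\<tau> *v u)) \<dotplus> heis_minus F (Q (\<tau> *v u)) (Q u) \<in> D" for u
    using assms by (intro D_mult unitary_Q)
  then show ?thesis
    using assms by (auto simp: unitary_def invertible_mult heis_minus_trans simp flip: matrix_vector_mul_assoc)
qed

lemma unitary_one [simp]: "unitary (mat 1)"
proof -
  have "heis_minus F \<alpha> \<alpha> = (0, 0)" for \<alpha>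
    by (cases \<alpha>) (simp add: algebra_simps)
  then show ?thesis by (auto simp: unitary_def invertible_def intro: exI[of _ "mat 1"])
qed

lemma unitary_left_inverse:
  assumes "unitary \<sigma>" obtains \<tau> where "unitary \<tau>" "\<tau> ** \<sigma> = mat 1"
proof -
  from assms obtain \<tau> where t: "\<tau> ** \<sigma> = mat 1" "\<sigma> ** \<tau> = mat 1"
    by (auto simp: unitary_def invertible_def)
  have st: "\<sigma> *v (\<tau> *v u) = u" for u by (simp add: matrix_vector_mul_assoc t)
  have "B (\<tau> *v u) (\<tau> *v v) = B u v" for u v
    using unitary_B[OF assms, of "\<tau> *v u" "\<tau> *v v"] by (simp add: st)
  moreover have "heis_minus F (Q (\<tau> *v u)) (Q u) \<in> D" for u
    using D_inv[OF unitary_Q[OF assms, of "\<tau> *v u"]] by (simp add: st heis_minus_inv)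
  moreover have "invertible \<tau>" using t by (auto simp: invertible_def)
  ultimately show thesis using t by (intro that[of \<tau>]) (auto simp: unitary_def)
qed

sublocale U: group "unitary_group F :: ('a, 'n::finite) matrix monoid"
proof (rule groupI)
  show "\<exists>\<tau>\<in>carrier U. \<tau> \<otimes>\<^bsub>U\<^esub> \<sigma> = \<one>\<^bsub>U\<^esub>" if "\<sigma> \<in> carrier U" for \<sigma> :: "('a, 'n::finite) matrix"
  proof -
    from that have "unitary \<sigma>" by simp
    then obtain \<tau> where "unitary \<tau>" "\<tau> ** \<sigma> = mat 1" by (rule unitary_left_inverse)
    then show ?thesis by (intro bexI[of _ \<tau>]) simp_all
  qed
qed (auto simp: unitary_mult matrix_mul_assoc)

abbreviation iv :: "('a, 'n::finite) matrix \<Rightarrow> ('a, 'n) matrix" where "iv \<sigma> \<equiv> inv\<^bsub>U\<^esub> \<sigma>"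

lemma unitary_iv [simp]: "unitary \<sigma> \<Longrightarrow> unitary (iv \<sigma>)"
  using U.inv_closed by simp

lemma iv_mult [simp]: "unitary \<sigma> \<Longrightarrow> iv \<sigma> ** \<sigma> = mat 1" "unitary \<sigma> \<Longrightarrow> \<sigma> ** iv \<sigma> = mat 1"
  using U.l_inv[of \<sigma>] U.r_inv[of \<sigma>] by simp_all

lemma iv_vec [simp]: "unitary \<sigma> \<Longrightarrow> iv \<sigma> *v (\<sigma> *v u) = u" "unitary \<sigma> \<Longrightarrow> \<sigma> *v (iv \<sigma> *v u) = u"
  by (simp_all add: matrix_vector_mul_assoc)

lemma iv_eqI: "unitary \<sigma> \<Longrightarrow> unitary \<tau> \<Longrightarrow> \<tau> ** \<sigma> = mat 1 \<Longrightarrow> iv \<sigma> = \<tau>"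
  using U.inv_equality[of \<tau> \<sigma>] by simp

lemma iv_iv [simp]: "unitary \<sigma> \<Longrightarrow> iv (iv \<sigma>) = \<sigma>"
  using U.inv_inv by simp

lemma iv_prod: "unitary \<sigma> \<Longrightarrow> unitary \<tau> \<Longrightarrow> iv (\<sigma> ** \<tau>) = iv \<tau> ** iv \<sigma>"
  using U.inv_mult_group[of \<sigma> \<tau>] by simp

lemma mult_iv_cancel [simp]:
  "unitary \<sigma> \<Longrightarrow> \<sigma> ** (iv \<sigma> ** A) = A" "unitary \<sigma> \<Longrightarrow> iv \<sigma> ** (\<sigma> ** A) = A"
  by (simp_all add: matrix_mul_assoc)

lemma unitary_B_iv: assumes "unitary \<sigma>" shows "B (iv \<sigma> *v u) v = B u (\<sigma> *v v)"
  using unitary_B[OF assms, of "iv \<sigma> *v u" v] assms by simp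

text \<open>A unitary matrix and its inverse are adjoint with respect to \<open>B\<close>.  On basis vectors this exchanges
  rows and columns, so that every result on rows has a counterpart for columns.\<close>

lemma iv_entry:
  assumes "unitary \<sigma>"
  shows "cj (iv \<sigma> $ i $ j) * wt F i = wt F j * \<sigma> $ (- j) $ (- i)"
  using unitary_B_iv[OF assms, of "axis j 1" "axis (- i) 1"]
  by (simp add: matrix_vector_axis mult_ac)

end

section \<open>Transvections\<close>

lemma matrix_mult_linear:
  fixes A :: "('a::comm_ring_1, 'n::finite) matrix"
  shows "(A + A') ** C = A ** C + A' ** C" "(A - A') ** C = A ** C - A' ** C" "(- A) ** C = - (A ** C)"
    "C ** (A + A') = C ** A + C ** A'" "C ** (A - A') = C ** A - C ** A'" "C ** (- A) = - (C ** A)"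
  by (rule matrix_eqI; simp add: mv_linear flip: matrix_vector_mul_assoc)+

text \<open>Cancellation of a unit against its inverse inside the normal form of a product.\<close>

lemma unit_cancel:
  fixes a :: "'a::comm_ring_1"
  assumes "a * b = 1"
  shows "a * (x * b) = x" "a * (x * (b * y)) = x * y" "a * (x * (z * b)) = x * z"
    "a * (x * (z * (b * y))) = x * (z * y)" "a * (x * (z * (v * b))) = x * (z * v)"
    "a * (x * (z * (v * (b * y)))) = x * (z * (v * y))"
proof -
  have E: "c = (a * b) * c" for c by (simp add: assms)
  show "a * (x * b) = x" by (subst (2) E) (simp only: mult_ac)
  show "a * (x * (b * y)) = x * y" by (subst (2) E) (simp only: mult_ac)
  show "a * (x * (z * b)) = x * z" by (subst (2) E) (simp only: mult_ac)
  show "a * (x * (z * (b * y))) = x * (z * y)" by (subst (2) E) (simp only: mult_ac)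
  show "a * (x * (z * (v * b))) = x * (z * v)" by (subst (2) E) (simp only: mult_ac)
  show "a * (x * (z * (v * (b * y)))) = x * (z * (v * y))" by (subst (2) E) (simp only: mult_ac)
qed

context hermitian_forms
begin

lemmas lm_il_simps [simp] = unit_cancel[OF lm_il(1)] unit_cancel[OF lm_il(2)]

text \<open>The transvections \<open>w \<mapsto> w + (B v w + y * B u w) u - \<lambda>\<^sup>-\<^sup>1 (B u w) v\<close> contain all elementary
  matrices.  Written this way they are compatible with conjugation, \<open>\<sigma> tv(u,v,y) \<sigma>\<^sup>-\<^sup>1 = tv(\<sigma>u,\<sigma>v,y)\<close>,
  and this formula replaces nearly all matrix calculations.  The matrix is split into the part \<open>sk\<close>
  that is additive in both vectors and the long root part \<open>lg\<close>.\<close>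

definition sk :: "('a, 'n::finite) column \<Rightarrow> ('a, 'n) column \<Rightarrow> ('a, 'n) matrix" where
  "sk u v = (\<chi> k l. u $ k * B v (axis l 1) - il * v $ k * B u (axis l 1))"

definition lg :: "('a, 'n::finite) column \<Rightarrow> 'a \<Rightarrow> ('a, 'n) matrix" where
  "lg u y = (\<chi> k l. u $ k * y * B u (axis l 1))"

definition tv :: "('a, 'n::finite) column \<Rightarrow> ('a, 'n) column \<Rightarrow> 'a \<Rightarrow> ('a, 'n) matrix" where
  "tv u v y = mat 1 + sk u v + lg u y"

lemma B_as_sum: "B u w = (\<Sum>l\<in>UNIV. B u (axis l 1) * w $ l)"
proof -
  have "(\<Sum>l\<in>UNIV. B u (axis l 1) * w $ l) = (\<Sum>l\<in>UNIV. cj (u $ (- l)) * wt F (- l) * w $ l)"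
    by simp
  also have "\<dots> = (\<Sum>l\<in>UNIV. cj (u $ l) * wt F l * w $ (- l))"
    by (rule sum.reindex_bij_witness[where i = uminus and j = uminus]) auto
  finally show ?thesis by (simp add: B_eq_sum)
qed

lemma sk_vec: "sk u v *v w = B v w *s u - (il * B u w) *s v"
  unfolding vec_eq_iff sk_def
  by (simp add: matrix_vector_mult_def left_diff_distrib right_diff_distrib sum_subtractf B_as_sum[of v w] B_as_sum[of u w]
      sum_distrib_left sum_distrib_right mult_ac del: B_axis_right)

lemma lg_vec: "lg u y *v w = (y * B u w) *s u"
  unfolding vec_eq_iff lg_def
  by (simp add: matrix_vector_mult_def B_as_sum[of u w] sum_distrib_left sum_distrib_right mult_ac
      del: B_axis_right)

lemma tv_vec: "tv u v y *v w = w + (B v w + y * B u w) *s u - (il * B u w) *s v"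
  by (simp add: tv_def matrix_vector_mult_add_rdistrib sk_vec lg_vec vector_sadd_rdistrib)

lemma sk_add_left: "sk (u + u') v = sk u v + sk u' v"
  and sk_add_right: "sk u (v + v') = sk u v + sk u v'"
  and sk_diff_left: "sk (u - u') v = sk u v - sk u' v"
  and sk_diff_right: "sk u (v - v') = sk u v - sk u v'"
  and sk_minus_left: "sk (- u) v = - sk u v"
  and sk_minus_right: "sk u (- v) = - sk u v"
  and sk_zero_left [simp]: "sk 0 v = 0"
  and sk_zero_right [simp]: "sk u 0 = 0"
  by (simp_all add: sk_def vec_eq_iff algebra_simps)

lemmas sk_linear = sk_add_left sk_add_right sk_diff_left sk_diff_right sk_minus_left sk_minus_right

lemma lg_zero [simp]: "lg u 0 = 0"
  by (simp add: lg_def vec_eq_iff)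

lemma sk_swap_scale: "sk u (x *s v) = sk (cj x *s u) v"
  by (simp add: sk_def vec_eq_iff algebra_simps)

lemma tv_zero [simp]: "tv u v 0 = mat 1 + sk u v"
  by (simp add: tv_def)

lemma sk_conj: "unitary \<sigma> \<Longrightarrow> \<sigma> ** sk u v = sk (\<sigma> *v u) (\<sigma> *v v) ** \<sigma>"
  by (rule matrix_eqI) (simp add: sk_vec mv_linear unitary_B flip: matrix_vector_mul_assoc)

lemma lg_conj: "unitary \<sigma> \<Longrightarrow> \<sigma> ** lg u y = lg (\<sigma> *v u) y ** \<sigma>"
  by (rule matrix_eqI) (simp add: lg_vec mv_linear unitary_B flip: matrix_vector_mul_assoc)

lemma tv_conj: "unitary \<sigma> \<Longrightarrow> \<sigma> ** tv u v y = tv (\<sigma> *v u) (\<sigma> *v v) y ** \<sigma>"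
  by (simp add: tv_def matrix_mult_linear sk_conj lg_conj)

lemma tv_conj': "unitary \<sigma> \<Longrightarrow> \<sigma> ** tv u v y ** iv \<sigma> = tv (\<sigma> *v u) (\<sigma> *v v) y"
  by (simp add: tv_conj flip: matrix_mul_assoc)

lemma sk_sk_zero:
  assumes "B u u' = 0" "B u v' = 0" "B v u' = 0" "B v v' = 0"
  shows "sk u v ** sk u' v' = 0"
  by (rule matrix_eqI) (simp add: sk_vec mv_linear assms flip: matrix_vector_mul_assoc)

lemma B_sym_zero: "B u v = 0 \<Longrightarrow> B v u = 0"
  using B_swap[of v u] by simp

text \<open>The transvections with a fixed isotropic direction \<open>f\<close> and \<open>v\<close> orthogonal to \<open>f\<close> are closed under
  products; they make up the unipotent radical of the stabiliser of \<open>f\<close>.\<close>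

lemma tv_mult:
  assumes "B f f = 0" "B f v = 0" "B f v' = 0"
  shows "tv f v y ** tv f v' y' = tv f (v + v') (y + y' - il * B v v')"
proof (rule matrix_eqI)
  fix w
  have "B v f = 0" using assms(2) by (rule B_sym_zero)
  then show "(tv f v y ** tv f v' y') *v w = tv f (v + v') (y + y' - il * B v v') *v w"
    by (simp add: tv_vec assms vec_eq_iff algebra_simps flip: matrix_vector_mul_assoc)
qed

lemma tv_opp:
  assumes "B f f = 0" "B f v = 0"
  shows "tv f v y ** tv f (- v) (- y - il * B v v) = mat 1"
    "tv f (- v) (- y - il * B v v) ** tv f v y = mat 1"
  using assms by (simp_all add: tv_mult)

text \<open>For a basis vector \<open>f\<close> the change of \<open>Q\<close> under a transvection is, up to a trace, obtained by the
  action from one fixed element of the Heisenberg group.  This both decides when the transvection is unitary and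
  measures how it moves vectors.\<close>

lemma tv_displ:
  fixes v :: "('a, 'n::finite) column"
  assumes i: "i \<noteq> Zero" and v: "v $ (- i) = 0"
  defines "f \<equiv> axis i 1 :: ('a, 'n) column"
  shows "heis_minus F (Q (tv f v y *v w)) (Q w) = act (v $ Zero, pr v v + cj y) (- (il * B f w))
    \<dotplus> trc ((B v w + y * B f w) * pr f w - (il * B f w) * pr v w - cj (il * B f w) * (B v w + y * B f w) * pr f v
      - cj (il * B f w) * (B v w + y * B f w) - cj (il * B f w) * (il * B f w) * cj y)"
proof -
  have f0: "f $ Zero = 0" and pf: "pr f f = 0" and fv: "B f v = 0"
    using i v by (simp_all add: f_def axis_nth_if)
  define t where "t = il * B f w"
  define s where "s = B v w + y * B f w"
  have Bfw: "B f w = lm * t" by (simp add: t_def)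
  have E: "tv f v y *v w = w + s *s f - t *s v"
    by (simp add: tv_vec t_def s_def)
  have p1: "pr w f = lm * t - lm * cj (pr f w)"
    using B_pr[of f w] by (simp add: f0 Bfw)
  have p2: "pr v f = - lm * cj (pr f v)"
    using B_pr[of f v] by (simp add: f0 fv eq_neg_iff_add_eq_0)
  have p3: "pr w v = s - y * lm * t - cj (v $ Zero) * mu F * w $ Zero - lm * cj (pr v w)"
    using B_pr[of v w] by (simp add: s_def Bfw mult_ac)
  show ?thesis
    unfolding E Q_eq t_def[symmetric] s_def[symmetric]
    by (simp add: f0 pr_linear pf p1 p2 p3 algebra_simps)
qed

lemma tv_unitary:
  fixes v :: "('a, 'n::finite) column"
  assumes i: "i \<noteq> Zero" and v: "v $ (- i) = 0" and d: "(v $ Zero, pr v v + cj y) \<in> D"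
  shows "unitary (tv (axis i 1) v y)"
proof -
  define f :: "('a, 'n) column" where "f = axis i 1"
  have ff: "B f f = 0" and fv: "B f v = 0"
    using i v by (simp_all add: f_def axis_nth_if)
  have vf: "B v f = 0" using fv by (rule B_sym_zero)
  have inv: "invertible (tv f v y)"
    using tv_opp[OF ff fv, of y] unfolding invertible_def by blast
  have tr: "B v v = - cj y - lm * y"
    using D_eq'[OF d] by (simp add: B_pr[of v v] algebra_simps)
  have BB: "B (tv f v y *v u) (tv f v y *v w) = B u w" for u w
  proof -
    have "B u f = lm * cj (B f u)" "B u v = lm * cj (B v u)"
      by (rule B_swap)+
    then show ?thesis
      by (simp add: tv_vec ff fv vf tr algebra_simps)
  qed
  have QQ: "heis_minus F (Q (tv f v y *v w)) (Q w) \<in> D" for w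
    unfolding f_def tv_displ[OF i v] using d by (simp only: D_mult D_act D_long)
  show ?thesis using inv BB QQ unfolding unitary_def f_def by blast
qed

lemma tv_inv:
  assumes "i \<noteq> Zero" "v $ (- i) = 0" "(v $ Zero, pr v v + cj y) \<in> D"
  shows "iv (tv (axis i 1) v y) = tv (axis i 1) (- v) (- y - il * B v v)"
proof -
  have u: "unitary (tv (axis i 1) v y)" using assms by (rule tv_unitary)
  have "B (axis i 1) (axis i 1) = 0" "B (axis i 1) v = 0"
    using assms(1,2) by (simp_all add: axis_nth_if)
  from tv_opp(1)[OF this, of y]
  have "iv (tv (axis i 1) v y) ** (tv (axis i 1) v y ** tv (axis i 1) (- v) (- y - il * B v v)) = iv (tv (axis i 1) v y)"
    by simp
  then show ?thesis using u by simp
qed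

section \<open>Root elements\<close>

text \<open>Short and extra short root elements as transvections.  Up to units in the coefficients they are the
  matrices \<open>T\<^sub>i\<^sub>,\<^sub>-\<^sub>j\<close> and \<open>T\<^sub>i\<close> (\<open>EU_gens\<close> below); long root elements are the \<open>ext i (trc z)\<close>.\<close>

definition sht :: "'n::finite idx \<Rightarrow> 'n idx \<Rightarrow> 'a \<Rightarrow> ('a, 'n) matrix" where
  "sht i j x = tv (axis i 1) (axis j x) 0"

definition ext :: "'n::finite idx \<Rightarrow> 'a \<times> 'a \<Rightarrow> ('a, 'n) matrix" where
  "ext i \<alpha> = tv (axis i 1) (axis Zero (fst \<alpha>)) (cj (snd \<alpha>))"

text \<open>The pairs \<open>(i, j)\<close> that carry a short root element \<open>sht i j x\<close>.\<close>

definition rt :: "'n idx \<Rightarrow> 'n idx \<Rightarrow> bool" where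
  "rt i j \<longleftrightarrow> i \<noteq> Zero \<and> j \<noteq> Zero \<and> apart i j"

lemma rtD:
  assumes "rt i j"
  shows "i \<noteq> Zero" "j \<noteq> Zero" "i \<noteq> j" "j \<noteq> i" "i \<noteq> - j" "- j \<noteq> i" "- i \<noteq> j" "j \<noteq> - i"
    "Zero \<noteq> i" "Zero \<noteq> j"
  using assms apartD[of i j] by (auto simp: rt_def)

lemma rt_sym: "rt i j \<longleftrightarrow> rt j i"
  by (auto simp: rt_def apart_sym)

lemma rt_neg [simp]: "rt (- i) j \<longleftrightarrow> rt i j" "rt i (- j) \<longleftrightarrow> rt i j"
  by (auto simp: rt_def)

lemma sht_unitary [simp]: "rt i j \<Longrightarrow> unitary (sht i j x)"
  unfolding sht_def by (rule tv_unitary) (auto dest: rtD simp: axis_nth_if)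

lemma sht_iv [simp]: "rt i j \<Longrightarrow> iv (sht i j x) = sht i j (- x)"
  unfolding sht_def
  by (subst tv_inv) (auto dest: rtD simp: axis_nth_if axis_uminus)

lemma sht_add: "rt i j \<Longrightarrow> sht i j x ** sht i j y = sht i j (x + y)"
  unfolding sht_def
  by (subst tv_mult) (auto dest: rtD simp: axis_nth_if axis_add simp del: tv_zero)

lemma sht_vec: "sht i j x *v w = w + axis i (cj x * wt F j * w $ (- j)) - axis j (il * x * wt F i * w $ (- i))"
  by (simp add: sht_def tv_vec axis_scale mult_ac del: tv_zero)

lemma sht_swap: "sht i j x = sht j i (- lm * cj x)"
  by (rule matrix_eqI) (simp add: sht_vec axis_uminus algebra_simps flip: axis_uminus)

lemma ext_unitary [simp]: "i \<noteq> Zero \<Longrightarrow> \<alpha> \<in> D \<Longrightarrow> unitary (ext i \<alpha>)"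
  unfolding ext_def by (rule tv_unitary) (auto simp: axis_nth_if)

lemma ext_vec: "ext i \<alpha> *v w = w + axis i (cj (fst \<alpha>) * mu F * w $ Zero + cj (snd \<alpha>) * wt F i * w $ (- i))
    - axis Zero (il * wt F i * w $ (- i) * fst \<alpha>)"
  by (simp add: ext_def tv_vec axis_scale mult_ac)

lemma ext_mult:
  assumes "i \<noteq> Zero"
  shows "ext i \<alpha> ** ext i \<beta> = ext i (\<beta> \<dotplus> \<alpha>)"
  using assms unfolding ext_def
  by (subst tv_mult) (cases \<alpha>; cases \<beta>; simp add: axis_nth_if axis_add algebra_simps)+

lemma ext_iv:
  assumes "i \<noteq> Zero" "\<alpha> \<in> D"
  shows "iv (ext i \<alpha>) = ext i (\<dotminus> \<alpha>)"
proof (rule iv_eqI)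
  have "ext i (0, 0) = mat 1"
    by (rule matrix_eqI) (simp add: ext_vec)
  then show "ext i (\<dotminus> \<alpha>) ** ext i \<alpha> = mat 1"
    using assms(1) heis.r_inv[of \<alpha>] by (simp add: ext_mult)
qed (use assms D_inv in auto)

lemma sk_conj': "unitary \<sigma> \<Longrightarrow> \<sigma> ** sk u v ** iv \<sigma> = sk (\<sigma> *v u) (\<sigma> *v v)"
  by (simp add: sk_conj flip: matrix_mul_assoc)

section \<open>Involution invariant ideals\<close>

lemma inv_ideal_cj: "invariant_ideal F A \<Longrightarrow> x \<in> A \<Longrightarrow> cj x \<in> A"
  by (simp add: invariant_ideal_def)

lemma inv_ideal_sub: "invariant_ideal F A \<Longrightarrow> ideal.subspace A"
  by (simp add: invariant_ideal_def)

lemma ideal_mult_left: "ideal.subspace A \<Longrightarrow> x \<in> A \<Longrightarrow> c * x \<in> A"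
  by (rule ideal.subspace_scale)

lemma ideal_mult_right: "ideal.subspace A \<Longrightarrow> x \<in> A \<Longrightarrow> x * c \<in> A"
  using ideal.subspace_scale[of A x c] by (simp add: mult.commute)

lemma ideal_mult_induct [consumes 1, case_names mult add zero]:
  assumes "x \<in> ideal_mult A A'"
    and "\<And>c a b. a \<in> A \<Longrightarrow> b \<in> A' \<Longrightarrow> P (c * (a * b))"
    and "\<And>x y. P x \<Longrightarrow> P y \<Longrightarrow> P (x + y)" and "P 0"
  shows "P x"
proof -
  have "\<forall>c. P (c * x)"
    using assms(1) unfolding ideal_mult_def
  proof (induction x rule: ideal.span_induct_alt)
    case base then show ?case using assms(4) by simp
  next
    case (step c x y)
    then show ?case
      using assms(2) assms(3)
      by (auto simp: distrib_left simp flip: mult.assoc[of _ c])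
  qed
  from this[rule_format, of 1] show ?thesis by simp
qed

lemma ideal_mult_in: "a \<in> A \<Longrightarrow> b \<in> A' \<Longrightarrow> a * b \<in> ideal_mult A A'"
  unfolding ideal_mult_def by (rule ideal.span_base) blast

lemma ideal_mult_subspace: "ideal.subspace (ideal_mult A A')"
  by (simp add: ideal_mult_def)

lemma ideal_mult_inv:
  assumes "invariant_ideal F A" "invariant_ideal F A'"
  shows "invariant_ideal F (ideal_mult A A')"
  unfolding invariant_ideal_def
proof (intro conjI ballI ideal_mult_subspace)
  fix x assume "x \<in> ideal_mult A A'"
  then show "cj x \<in> ideal_mult A A'"
  proof (induction rule: ideal_mult_induct)
    case (mult c a b)
    then show ?case
      using assms by (simp, intro ideal_mult_left[OF ideal_mult_subspace] ideal_mult_in inv_ideal_cj)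
  qed (auto intro: ideal.subspace_add ideal.subspace_0 ideal_mult_subspace)
qed

lemma UNIV_inv: "invariant_ideal F UNIV"
  by (simp add: invariant_ideal_def ideal.subspace_UNIV)

lemma ideal_power_inv: "invariant_ideal F A \<Longrightarrow> invariant_ideal F (ideal_power A k)"
  by (induction k) (auto intro: UNIV_inv ideal_mult_inv)

lemma ideal_mult_sub_right: "ideal.subspace A' \<Longrightarrow> ideal_mult A A' \<subseteq> A'"
  by (auto elim!: ideal_mult_induct intro!: ideal_mult_left ideal.subspace_add ideal.subspace_0)

lemma ideal_mult_sub_left: assumes "ideal.subspace A" shows "ideal_mult A A' \<subseteq> A"
proof
  fix x assume "x \<in> ideal_mult A A'"
  then show "x \<in> A"
    by (induction rule: ideal_mult_induct)
      (use assms in \<open>auto intro: ideal_mult_left[OF assms] ideal_mult_right[OF assms] ideal.subspace_add ideal.subspace_0\<close>)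
qed

lemma ideal_power_Suc_sub: "invariant_ideal F A \<Longrightarrow> ideal_power A (Suc k) \<subseteq> ideal_power A k"
  using ideal_mult_sub_right[OF inv_ideal_sub[OF ideal_power_inv]] by simp

section \<open>The elementary subgroup\<close>

abbreviation EL :: "('a, 'n::finite) matrix set" where "EL \<equiv> EU_full F"

lemma T_short_sht:
  assumes "rt i j"
  shows "T_short F i j x = sht i (- j) (cj x * wt F (- j))"
    "sht i (- j) x = T_short F i j (cj x * wt F (- j))"
proof -
  have *: "T_short F i j x *v w = w + axis i (x * w $ j)
      - axis (- j) (lam_power F ((eps j - 1) div 2) * cj x * lam_power F ((1 - eps i) div 2) * w $ (- i))" for x w
  proof -
    have "ematrix a b y *v w = axis a (y * w $ b)" for a b :: "'b idx" and y
      by (simp add: vec_eq_iff matrix_vector_mult_def ematrix_def axis_nth_if if_distrib[of "\<lambda>z. z * _"] cong: if_cong)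
    then show ?thesis by (simp add: T_short_def mv_linear)
  qed
  have u: "lam_power F ((eps j - 1) div 2) = il * wt F (- j)" "lam_power F ((1 - eps i) div 2) = wt F i"
    using rtD[OF assms] by (cases i; cases j; simp add: eps_def lam_power_def mult.commute)+
  have w: "wt F (- j) * cj (wt F (- j)) = 1" using rtD[OF assms] by simp
  show 1: "T_short F i j x = sht i (- j) (cj x * wt F (- j))" for x
  proof (rule matrix_eqI)
    fix v
    have "x * cj (wt F (- j)) * wt F (- j) * v $ j = (wt F (- j) * cj (wt F (- j))) * (x * v $ j)"
      by (simp only: mult_ac)
    then show "T_short F i j x *v v = sht i (- j) (cj x * wt F (- j)) *v v"
      by (simp add: * u sht_vec w) (simp add: mult_ac)
  qed
  have "x * cj (wt F (- j)) * wt F (- j) = (wt F (- j) * cj (wt F (- j))) * x"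
    by (simp only: mult_ac)
  then show "sht i (- j) x = T_short F i j (cj x * wt F (- j))"
    by (simp add: 1 w)
qed

lemma T_extra_ext:
  assumes "i \<noteq> Zero"
  shows "i = Pos k \<Longrightarrow> T_extra F i (x, y) = ext i (act (x, cj y) (- lm))"
    "i = Neg k \<Longrightarrow> (x, y) \<in> D \<Longrightarrow> T_extra F i (x, y) = ext i (\<dotminus> (x, y))"
proof -
  have e: "ematrix a b y *v w = axis a (y * w $ b)" for a b :: "'b idx" and y and w
    by (simp add: vec_eq_iff matrix_vector_mult_def ematrix_def axis_nth_if if_distrib[of "\<lambda>z. z * _"] cong: if_cong)
  have v: "T_extra F i (x, y) *v w = w + axis Zero (x * w $ (- i))
      - axis i (lam_power F (- ((1 + eps i) div 2)) * cj x * mu F * w $ Zero) + axis i (y * w $ (- i))" for w x y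
    by (simp add: T_extra_def mv_linear e)
  show "T_extra F i (x, y) = ext i (act (x, cj y) (- lm))" if "i = Pos k"
    by (rule matrix_eqI)
      (unfold v, simp add: ext_vec that eps_def lam_power_def axis_uminus axis_add axis_nth_if vec_eq_iff algebra_simps)
  assume i: "i = Neg k" and d: "(x, y) \<in> D"
  have *: "- y - cj x * mu F * x = cj y * lm" using D_eq'[OF d] by simp
  show "T_extra F i (x, y) = ext i (\<dotminus> (x, y))"
    by (rule matrix_eqI)
      (unfold v heis_inv *, simp add: ext_vec i eps_def lam_power_def axis_nth_if vec_eq_iff algebra_simps)
qed

text \<open>The units by which the two parametrisations differ preserve the ideal and the form parameter.
  The sign conventions of \<open>T_extra\<close> disappear: for positive indices the substitution involves
  \<open>\<lambda>\<close>, for negative ones the inverse in the Heisenberg group.\<close>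

lemma EU_gens:
  assumes A: "invariant_ideal F A" and S: "R_submodule F S" "S \<subseteq> D"
  shows "EU F (A, S) = generate (U :: ('a, 'n::finite) matrix monoid) ({sht i j x | i j x. rt i j \<and> x \<in> A} \<union> {ext i \<alpha> | i \<alpha>. i \<noteq> Zero \<and> \<alpha> \<in> S})"
proof -
  have rt: "i \<in> idx_hb \<and> j \<in> idx_hb \<and> i \<noteq> j \<and> i \<noteq> - j \<longleftrightarrow> rt i j" for i j :: "'n idx"
    by (auto simp: rt_def apart_def)
  have cjA: "cj x * c \<in> A" if "x \<in> A" for x c
    using A that by (intro ideal_mult_right inv_ideal_sub inv_ideal_cj)
  have 1: "{T_short F i j x :: ('a, 'n) matrix | i j x. i \<in> idx_hb \<and> j \<in> idx_hb \<and> i \<noteq> j \<and> i \<noteq> - j \<and> x \<in> A}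
    = {sht i j x | i j x. rt i j \<and> x \<in> A}" (is "?L = ?R")
  proof
    show "?L \<subseteq> ?R"
    proof
      fix t assume "t \<in> ?L"
      then obtain i j x where "t = T_short F i j x" "rt i j" "x \<in> A" by (auto simp: rt_def apart_def)
      then have "t = sht i (- j) (cj x * wt F (- j))" "rt i (- j)" "cj x * wt F (- j) \<in> A"
        using T_short_sht(1)[of i j x] cjA by auto
      then show "t \<in> ?R" by blast
    qed
    show "?R \<subseteq> ?L"
    proof
      fix t assume "t \<in> ?R"
      then obtain i j x where "t = sht i j x" "rt i j" "x \<in> A" by auto
      then have "t = T_short F i (- j) (cj x * wt F j)" "rt i (- j)" "cj x * wt F j \<in> A"
        using T_short_sht(2)[of i "- j" x] cjA by auto
      then show "t \<in> ?L" using rt[of i "- j"] by blast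
    qed
  qed
  have 2: "{T_extra F i \<alpha> :: ('a, 'n) matrix | i \<alpha>. i \<in> idx_hb \<and> \<alpha> \<in> signed F (- eps i) S} = {ext i \<alpha> | i \<alpha>. i \<noteq> Zero \<and> \<alpha> \<in> S}" (is "?L = ?R")
  proof
    show "?L \<subseteq> ?R"
    proof
      fix t assume "t \<in> ?L"
      then obtain i x y where t: "t = T_extra F i (x, y)" "i \<noteq> Zero" "(x, y) \<in> signed F (- eps i) S" by auto
      show "t \<in> ?R"
      proof (cases i)
        case (Pos k)
        with t(3) have "(x, cj y) \<in> S" by (simp add: signed_def eps_def)
        with submodule_act[OF S(1)] show ?thesis using T_extra_ext(1)[OF t(2) Pos] t by blast
      next
        case (Neg k)
        with t(3) have "(x, y) \<in> S" by (simp add: signed_def eps_def)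
        moreover then have "\<dotminus> (x, y) \<in> S"
          using subgroup.m_inv_closed[OF submodule_subgroup[OF S(1)]] by blast
        ultimately show ?thesis using T_extra_ext(2)[OF t(2) Neg] t S by blast
      qed (use t in simp)
    qed
    show "?R \<subseteq> ?L"
    proof
      fix t assume "t \<in> ?R"
      then obtain i \<alpha> where t: "t = ext i \<alpha>" "i \<noteq> Zero" "\<alpha> \<in> S" by auto
      show "t \<in> ?L"
      proof (cases i)
        case (Pos k)
        obtain x y where xy: "act \<alpha> (- il) = (x, y)" by fastforce
        then have "(x, y) \<in> S" using submodule_act[OF S(1) t(3)] by metis
        then have "(x, cj y) \<in> signed F (- eps i) S" by (simp add: signed_def eps_def Pos)
        moreover have "act (x, cj (cj y)) (- lm) = \<alpha>"
          unfolding cj_cj by (simp only: xy[symmetric] heis_act_act) (cases \<alpha>; simp)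
        then have "T_extra F i (x, cj y) = t"
          using T_extra_ext(1)[OF t(2) Pos] t by simp
        ultimately show ?thesis using t(2) by auto
      next
        case (Neg k)
        obtain x y where xy: "\<dotminus> \<alpha> = (x, y)" by fastforce
        then have xyS: "(x, y) \<in> S" using subgroup.m_inv_closed[OF submodule_subgroup[OF S(1)] t(3)] by metis
        then have "(x, y) \<in> signed F (- eps i) S" by (simp add: signed_def eps_def Neg)
        moreover have "\<dotminus> (x, y) = \<alpha>" unfolding xy[symmetric] by (rule heis.inv_inv) simp
        then have "T_extra F i (x, y) = t"
          using T_extra_ext(2)[OF t(2) Neg, of x y] S xyS t by auto
        ultimately show ?thesis using t(2) by auto
      qed (use t in simp)
    qed
  qed
  show ?thesis by (simp only: EU_def prod.case 1 2)
qed

lemma EL_gens: "EL = generate U ({sht i j x | i j x. rt i j} \<union> {ext i \<alpha> | i \<alpha>. i \<noteq> Zero \<and> \<alpha> \<in> D})"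
  using EU_gens[OF UNIV_inv D_submodule] by simp

lemma EL_subgroup: "subgroup EL (unitary_group F :: ('a, 'n::finite) matrix monoid)"
  unfolding EL_gens by (rule U.generate_is_subgroup) auto

lemma EL_unitary: "g \<in> EL \<Longrightarrow> unitary g"
  using subgroup.subset[OF EL_subgroup] by auto

lemma EL_mult: "g \<in> EL \<Longrightarrow> g' \<in> EL \<Longrightarrow> g ** g' \<in> EL"
  using subgroup.m_closed[OF EL_subgroup] by simp

lemma EL_iv: "g \<in> EL \<Longrightarrow> iv g \<in> EL"
  by (rule subgroup.m_inv_closed[OF EL_subgroup])

lemma sht_EL: "rt i j \<Longrightarrow> sht i j x \<in> EL"
  unfolding EL_gens by (rule generate.incl) blast

lemma ext_EL: "i \<noteq> Zero \<Longrightarrow> \<alpha> \<in> D \<Longrightarrow> ext i \<alpha> \<in> EL"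
  unfolding EL_gens by (rule generate.incl) blast

lemma EL_induct [consumes 1, case_names one sht ext mult]:
  assumes "g \<in> EL" and "P (mat 1)" and sht: "\<And>i j x. rt i j \<Longrightarrow> P (sht i j x)"
    and ext: "\<And>i \<alpha>. i \<noteq> Zero \<Longrightarrow> \<alpha> \<in> D \<Longrightarrow> P (ext i \<alpha>)"
    and mult: "\<And>g h. g \<in> EL \<Longrightarrow> h \<in> EL \<Longrightarrow> P g \<Longrightarrow> P h \<Longrightarrow> P (g ** h)"
  shows "P g"
  using assms(1) unfolding EL_gens
proof (induction rule: generate.induct)
  case one then show ?case using assms(2) by simp
next
  case (incl h) then show ?case using sht ext by auto
next
  case (inv h) then show ?case using sht ext D_inv by (auto simp: ext_iv)
next
  case (eng g h) then show ?case using mult unfolding EL_gens by simp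
qed

lemma unitary_JD: "unitary \<sigma> \<Longrightarrow> j \<noteq> Zero \<Longrightarrow> \<sigma> $ Zero $ j \<in> JD"
  using unitary_Q[of \<sigma> "axis j 1"]
  by (auto simp: JD_iff Q_eq matrix_vector_axis axis_nth_if)

lemma entry_mult3: "(A ** S ** C) $ a $ b = (A *v (S *v (C *v axis b 1))) $ a"
  for A :: "('a, 'n::finite) matrix"
proof -
  have "(A ** S ** C) $ a $ b = ((A ** S ** C) *v axis b 1) $ a" by (simp add: matrix_vector_axis)
  then show ?thesis by (simp flip: matrix_vector_mul_assoc)
qed

end

section \<open>Subgroups normalised by a relative elementary group\<close>

text \<open>The properties of the relative elementary group \<open>E\<close> of level \<open>(I, \<Omega>)\<close> on which the
  extraction of elementary matrices rests: \<open>E\<close> is normalised by the elementary group and contains the root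
  elements of minimal level \<open>\<Omega>\<^sup>I\<^sub>m\<^sub>i\<^sub>n\<close>.\<close>

locale relative_level = hermitian_forms F
  for F :: "'a::comm_ring_1 form_ring" +
  fixes I :: "'a set" and E :: "('a, 'n::finite) matrix set"
  assumes card_n: "CARD('n) \<ge> 4"
    and I_inv: "invariant_ideal F I"
    and E_sub: "subgroup E (unitary_group F)"
    and E_conj: "\<And>g e. g \<in> EU_full F \<Longrightarrow> e \<in> E \<Longrightarrow> g ** e ** inv\<^bsub>unitary_group F\<^esub> g \<in> E"
    and E_sht: "\<And>i j x. rt i j \<Longrightarrow> x \<in> I \<Longrightarrow> sht i j x \<in> E"
    and E_ext: "\<And>i \<alpha> a. i \<noteq> Zero \<Longrightarrow> \<alpha> \<in> Delta F \<Longrightarrow> a \<in> I \<Longrightarrow> ext i (act \<alpha> a) \<in> E"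
    and E_long: "\<And>i z. i \<noteq> Zero \<Longrightarrow> z \<in> I \<Longrightarrow> ext i (trc z) \<in> E"
begin

definition normalised :: "('a, 'n) matrix set \<Rightarrow> bool" where
  "normalised H \<longleftrightarrow> subgroup H U \<and> (\<forall>e\<in>E. \<forall>h\<in>H. e ** h ** iv e \<in> H)"

lemma I_sub: "ideal.subspace I" using I_inv by (rule inv_ideal_sub)

lemma I_mult: "x \<in> I \<Longrightarrow> x * c \<in> I" "x \<in> I \<Longrightarrow> c * x \<in> I"
  using I_sub by (auto intro: ideal_mult_left ideal_mult_right)

lemma E_unitary: "e \<in> E \<Longrightarrow> unitary e"
  using subgroup.subset[OF E_sub] by auto

lemma E_mult: "e \<in> E \<Longrightarrow> e' \<in> E \<Longrightarrow> e ** e' \<in> E"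
  using subgroup.m_closed[OF E_sub] by simp

lemma E_iv: "e \<in> E \<Longrightarrow> iv e \<in> E"
  using subgroup.m_inv_closed[OF E_sub] by simp

context
  fixes H :: "('a, 'n) matrix set"
  assumes H: "normalised H"
begin

lemma H_sub: "subgroup H U" using H by (simp add: normalised_def)

lemma H_unitary: "h \<in> H \<Longrightarrow> unitary h"
  using subgroup.subset[OF H_sub] by auto

lemma H_mult: "h \<in> H \<Longrightarrow> h' \<in> H \<Longrightarrow> h ** h' \<in> H"
  using subgroup.m_closed[OF H_sub] by simp

lemma H_iv: "h \<in> H \<Longrightarrow> iv h \<in> H"
  using subgroup.m_inv_closed[OF H_sub] by simp

lemma H_one: "mat 1 \<in> H"
  using subgroup.one_closed[OF H_sub] by simp

lemma H_conj: "e \<in> E \<Longrightarrow> h \<in> H \<Longrightarrow> e ** h ** iv e \<in> H"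
  using H by (simp add: normalised_def)

lemma H_conj': "e \<in> E \<Longrightarrow> h \<in> H \<Longrightarrow> iv e ** h ** e \<in> H"
  using H_conj[OF E_iv, of e h] by (simp add: E_unitary)

lemma H_comm: "e \<in> E \<Longrightarrow> h \<in> H \<Longrightarrow> e ** h ** iv e ** iv h \<in> H"
  by (intro H_mult H_conj H_iv)

lemma H_comm': "e \<in> E \<Longrightarrow> h \<in> H \<Longrightarrow> h ** e ** iv h ** iv e \<in> H"
  using H_mult[OF _ H_conj[OF _ H_iv], of h e h] by (simp add: matrix_mul_assoc)

text \<open>If \<open>\<tau>\<close> fixes a vector that \<open>\<sigma>\<close> maps to \<open>f\<close>, then \<open>\<xi> = \<sigma>\<tau>\<sigma>\<^sup>-\<^sup>1\<close> fixes \<open>f\<close>, and for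
  a transvection \<open>\<tau>'\<close> in the direction \<open>f\<close> the second factor of the product below is again such a transvection.
  The element is in \<open>H\<close> because it is conjugate to the commutator of \<open>\<tau>'\<close> with the
  element \<open>\<tau>\<^sup>-\<^sup>1\<sigma>\<tau>\<sigma>\<^sup>-\<^sup>1\<close> of \<open>H\<close>.\<close>

lemma extract_conj:
  assumes s: "s \<in> H" and t: "t \<in> E" and t': "t' \<in> E"
  shows "(t ** t' ** iv t) ** ((s ** t ** iv s) ** iv t' ** iv (s ** t ** iv s)) \<in> H"
proof -
  note u = H_unitary[OF s] E_unitary[OF t] E_unitary[OF t']
  have "iv t ** s ** t ** iv s \<in> H"
    by (intro H_mult H_conj' H_iv s t)
  from H_conj[OF t H_comm[OF t' this]] show ?thesis
    using u by (simp add: iv_prod unitary_mult flip: matrix_mul_assoc)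
qed

lemma extract_conj2:
  assumes h: "A ** v \<in> H" and A: "A \<in> E" and v: "unitary v" and t: "t \<in> E"
  shows "(v ** t ** iv v) ** (iv A ** iv t ** A) \<in> H"
proof -
  note u = E_unitary[OF A] E_unitary[OF t] v
  from H_conj'[OF A H_comm'[OF t h]] show ?thesis
    using u by (simp add: iv_prod unitary_mult flip: matrix_mul_assoc)
qed

end

section \<open>The basic extraction\<close>

lemma sht_sk: "mat 1 + sk (axis i x) (axis j y) = sht i j (cj x * y)"
proof -
  have "sk (axis i x) (axis j y) = sk (axis i 1) (axis j (cj x * y))"
    using sk_swap_scale[of "axis i 1" "cj x" "axis j y"] by (simp add: axis_scale)
  then show ?thesis by (simp add: sht_def)
qed

text \<open>In contrast to different indices, equal indices give a long root element, whose coefficient is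
  symmetrised.\<close>

lemma long_sk: "mat 1 + sk (axis i x) (axis i y) = ext i (trc (cj x * y))"
  by (rule matrix_eqI)
    (simp add: sk_vec ext_vec mv_linear axis_scale axis_add axis_minus algebra_simps)

text \<open>The transvection \<open>t = 1 + sk u v\<close> has \<open>u\<close>, \<open>v\<close> supported on the coordinates \<open>i\<close>, \<open>j\<close>, \<open>p\<close> and
  orthogonal to the row \<open>i\<close> of \<open>\<sigma>\<close>, so that \<open>\<sigma> t \<sigma>\<^sup>-\<^sup>1\<close> fixes the basis vector \<open>f\<close> opposite
  to \<open>i\<close>.  The element of \<open>H\<close> obtained from it with \<open>t' = sht (- i) k b\<close> is \<open>A \<nu>\<close> with \<open>A\<close> in \<open>E\<close> and \<open>\<nu>\<close> a
  transvection in the direction \<open>f\<close>.  The matrix \<open>\<nu>\<close> depends on all of \<open>\<sigma>\<close>, but its commutator with another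
  transvection \<open>t''\<close> in the direction \<open>f\<close> is a long root element at \<open>f\<close>.  What remains is a sum
  \<open>S f e\<^sub>k\<close> of matrices of type \<open>sk\<close>; commutators with two elements of \<open>E\<close> that move \<open>e\<^sub>k\<close> and \<open>f\<close> are mixed
  differences and remove all terms except one short root element.\<close>

lemma basic_extraction_aux:
  assumes H: "normalised H" and s: "\<sigma> \<in> H"
    and ij: "rt i j" and ip: "rt i p" and jp: "rt j p" and ki: "rt k i" and kj: "rt k j" and kp: "rt k p"
    and mq: "rt m q" and qk: "rt q k" and qi: "rt q i" and qp: "q \<noteq> p"
    and mi: "rt m i" and mp: "m \<noteq> p" and mk: "m \<noteq> - k"
    and I: "a \<in> I" "b \<in> I" "d \<in> I" "d' \<in> I" "d'' \<in> I"
  shows "sht m q (\<sigma> $ i $ j * cj (\<sigma> $ i $ i) * (a * b * d * cj d' * d'' * (cj (wt F i) * cj (wt F i) * wt F (- k) * il * wt F p))) \<in> H"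
proof -
  note idx = rtD[OF ij] rtD[OF ip] rtD[OF jp] rtD[OF ki] rtD[OF kj] rtD[OF kp] rtD[OF mq] rtD[OF qk]
    rtD[OF qi] rtD[OF mi] qp qp[symmetric] mp mp[symmetric] mk mk[symmetric]
  note ev = axis_nth_if idx neg_iff
  define f :: "('a, 'n) column" where "f = axis (- i) 1"
  define sj where "sj = \<sigma> $ i $ j"
  define si where "si = \<sigma> $ i $ i"
  define sp where "sp = \<sigma> $ i $ p"
  \<comment> \<open>the row of \<open>\<sigma>\<close> vanishes on these two vectors\<close>
  define u where "u = axis i (- sp) + axis p si"
  define v where "v = axis i (- (sj * a)) + axis j (si * a)"
  define t where "t = mat 1 + sk u v"
  define x :: "('a, 'n) column" where "x = axis k b"
  define t' where "t' = sht (- i) k b"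
  define \<xi> where "\<xi> = \<sigma> ** t ** iv \<sigma>"
  have us: "unitary \<sigma>" using H s by (rule H_unitary)
  have Buv: "B u v = 0" "B v u = 0" "B u u = 0" "B v v = 0"
    by (simp_all add: u_def v_def ev)
  have tE: "t \<in> E"
  proof -
    have "t = (mat 1 + sk (axis i (- sp)) (axis i (- (sj * a)))) ** (mat 1 + sk (axis i (- sp)) (axis j (si * a)))
      ** ((mat 1 + sk (axis p si) (axis i (- (sj * a)))) ** (mat 1 + sk (axis p si) (axis j (si * a))))"
      by (simp add: t_def u_def v_def sk_add_left sk_add_right matrix_mult_linear sk_sk_zero ev)
    also have "\<dots> \<in> E"
    proof (intro E_mult)
      have IN: "- (x * y) \<in> I" if "y \<in> I" for x y
        using that by (intro ideal.subspace_neg[OF I_sub] I_mult)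
      show "mat 1 + sk (axis i (- sp)) (axis i (- (sj * a))) \<in> E"
        unfolding long_sk using I by (intro E_long) (auto simp: idx intro!: I_mult)
      show "mat 1 + sk (axis i (- sp)) (axis j (si * a)) \<in> E"
        "mat 1 + sk (axis p si) (axis i (- (sj * a))) \<in> E" "mat 1 + sk (axis p si) (axis j (si * a)) \<in> E"
        unfolding sht_sk using I ij ip jp by (auto simp: rt_sym intro!: E_sht I_mult IN)
    qed
    finally show ?thesis .
  qed
  have t'E: "t' \<in> E" unfolding t'_def using ki I by (intro E_sht) (auto simp: rt_sym)
  note ut = E_unitary[OF tE] E_unitary[OF t'E]
  have t'_tv: "t' = mat 1 + sk f x" by (simp add: t'_def sht_def f_def x_def)
  have ff: "B f f = 0" "B f x = 0" "B x f = 0" "B x x = 0"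
    by (simp_all add: f_def x_def ev)
  have ux: "unitary \<xi>" unfolding \<xi>_def using us ut by (simp add: unitary_mult)
  have xf: "\<xi> *v f = f"
  proof -
    have "B u (iv \<sigma> *v f) = B (\<sigma> *v u) f" "B v (iv \<sigma> *v f) = B (\<sigma> *v v) f"
      using unitary_B[OF us, of _ "iv \<sigma> *v f"] us by simp_all
    then have "B u (iv \<sigma> *v f) = 0" "B v (iv \<sigma> *v f) = 0"
      by (simp_all add: f_def u_def v_def mv_linear matrix_vector_axis sp_def sj_def si_def)
    then have "t *v (iv \<sigma> *v f) = iv \<sigma> *v f" by (simp add: t_def mv_linear sk_vec)
    then show ?thesis using us by (simp add: \<xi>_def flip: matrix_vector_mul_assoc)
  qed
  define r where "r = B v f *s u - (il * B u f) *s v"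
  have tf: "t *v f = f + r" by (simp add: t_def mv_linear sk_vec r_def)
  have tx: "t *v x = x" by (simp add: t_def mv_linear sk_vec u_def v_def x_def ev)
  have rp: "r $ p = - (cj sj * cj a * wt F i * si)"
    by (simp add: r_def u_def v_def f_def ev)
  have rk: "B r x = 0" "B x r = 0"
    by (simp_all add: r_def u_def v_def x_def ev)
  define v0 where "v0 = x - \<xi> *v x"
  define \<nu> where "\<nu> = t' ** (\<xi> ** iv t' ** iv \<xi>)"
  define A where "A = t ** t' ** iv t ** iv t'"
  have AE: "A \<in> E" unfolding A_def by (intro E_mult E_iv tE t'E)
  have h2: "A ** \<nu> \<in> H"
    using extract_conj[OF H s tE t'E] ut unfolding A_def \<nu>_def \<xi>_def
    by (simp flip: matrix_mul_assoc)
  have u\<nu>: "unitary \<nu>" unfolding \<nu>_def using ut ux by (simp add: unitary_mult)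
  have ivt': "iv t' = mat 1 + sk f (- x)"
  proof -
    have "iv t' = sht (- i) k (- b)"
      unfolding t'_def using ki by (intro sht_iv) (simp add: rt_sym)
    then show ?thesis by (simp add: sht_def f_def x_def axis_uminus)
  qed
  have fxx: "B f (\<xi> *v x) = 0"
    using unitary_B[OF ux, of f x] ff by (simp add: xf)
  have \<nu>_eq: "\<nu> = tv f x 0 ** tv f (- (\<xi> *v x)) 0"
    unfolding \<nu>_def ivt' using tv_conj'[OF ux, of f "- x" 0]
    by (simp add: t'_tv xf mv_linear)
  have \<nu>_tv: "\<nu> = tv f v0 (il * B x (\<xi> *v x))"
    unfolding \<nu>_eq using ff fxx by (subst tv_mult) (simp_all add: v0_def)
  have fv0: "B f v0 = 0" "B v0 f = 0"
    using ff fxx B_sym_zero by (auto simp: v0_def)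
  define t'' where "t'' = sht (- i) (- p) d"
  have t''E: "t'' \<in> E" unfolding t''_def using ip I by (intro E_sht) auto
  have t''_tv: "t'' = mat 1 + sk f (axis (- p) d)"
    by (simp add: t''_def sht_def f_def)
  define T0 where "T0 = B v0 (axis (- p) d)"
  define T1 where "T1 = il * B r f * b"
  define T2 where "T2 = il * (cj (r $ p) * wt F p * d) * b"
  have \<nu>f: "\<nu> *v f = f"
    unfolding \<nu>_tv by (simp add: tv_vec ff fv0)
  have \<nu>p: "\<nu> *v axis (- p) d = axis (- p) d + T0 *s f"
    unfolding \<nu>_tv by (simp add: tv_vec T0_def f_def ev)
  have c1: "\<nu> ** t'' ** iv \<nu> = mat 1 + sk f (axis (- p) d + T0 *s f)"
    unfolding t''_tv using tv_conj'[OF u\<nu>, of f _ 0] by (simp add: \<nu>f \<nu>p)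
  have ivA: "iv A = (mat 1 + sk f x) ** (mat 1 + sk (f + r) (- x))"
  proof -
    have "iv A = t' ** (t ** iv t' ** iv t)"
      unfolding A_def using ut by (simp add: iv_prod unitary_mult flip: matrix_mul_assoc)
    also have "t ** iv t' ** iv t = mat 1 + sk (f + r) (- x)"
      unfolding ivt' using tv_conj'[OF ut(1), of f "- x" 0] by (simp add: tf tx mv_linear)
    finally show ?thesis by (simp add: t'_tv)
  qed
  have ivA_f: "iv A *v f = f + axis k T1"
    unfolding ivA by (simp add: mv_linear sk_vec ff rk T1_def axis_scale vector_smult_rneg flip: matrix_vector_mul_assoc)
      (simp add: x_def axis_scale mult_ac)
  have ivA_p: "iv A *v axis (- p) d = axis (- p) d + axis k T2"
    unfolding ivA by (simp add: mv_linear sk_vec ff rk T2_def f_def x_def ev axis_scale vector_smult_rneg flip: matrix_vector_mul_assoc)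
  have c2: "iv A ** iv t'' ** A = mat 1 - sk (f + axis k T1) (axis (- p) d + axis k T2)"
  proof -
    have "iv t'' = tv f (- axis (- p) d) 0"
    proof -
      have "iv t'' = sht (- i) (- p) (- d)"
        unfolding t''_def using ip by (intro sht_iv) simp
      then show ?thesis by (simp add: sht_def f_def axis_uminus)
    qed
    then have "iv A ** iv t'' ** iv (iv A) = tv (f + axis k T1) (- (axis (- p) d + axis k T2)) 0"
      using E_unitary[OF AE] by (simp only: tv_conj' unitary_iv ivA_f ivA_p mv_linear)
    then show ?thesis using E_unitary[OF AE] by (simp add: sk_minus_right del: minus_add_distrib)
  qed
  \<comment> \<open>the parameters \<open>T0\<close>, \<open>T1\<close>, \<open>T2\<close> are constants of \<open>S\<close>; only \<open>T2\<close> survives, and only it is known\<close>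
  define S where "S = (\<lambda>(f :: ('a, 'n) column) (g :: ('a, 'n) column).
    sk f (axis (- p) d + T0 *s f) - sk (f + T1 *s g) (axis (- p) d + T2 *s g))"
  define ek :: "('a, 'n) column" where "ek = axis k 1"
  have h3: "mat 1 + S f ek \<in> H"
  proof -
    have "(\<nu> ** t'' ** iv \<nu>) ** (iv A ** iv t'' ** A) = mat 1 + S f ek"
      unfolding c1 c2 S_def ek_def axis_scale
      by (simp add: matrix_mult_linear sk_sk_zero f_def ev axis_scale)
    then show ?thesis using extract_conj2[OF H h2 AE u\<nu> t''E] by simp
  qed
  define g where "g = sht q (- k) d'"
  define g' where "g' = sht m i d''"
  have gE: "g \<in> E" "g' \<in> E" unfolding g_def g'_def using qk mi I by (auto intro!: E_sht)
  note ug = gE[THEN E_unitary]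
  define t3 where "t3 = cj d' * wt F (- k)"
  define t4 where "t4 = cj d'' * wt F i"
  define ek' where "ek' = ek + axis q t3"
  define f' where "f' = f + axis m t4"
  have gv: "g *v f = f" "g *v axis (- p) d = axis (- p) d" "g *v ek = ek'"
    by (simp_all add: g_def sht_vec f_def ek_def ek'_def t3_def ev)
  have g'v: "g' *v f = f'" "g' *v axis (- p) d = axis (- p) d" "g' *v ek = ek" "g' *v ek' = ek'"
    by (simp_all add: g'_def sht_vec f_def f'_def ek_def ek'_def t4_def ev)
  \<comment> \<open>all vectors that occur span an isotropic subspace, so products of matrices of type \<open>S\<close> vanish\<close>
  have SS: "S a b ** S a' b' = 0" if "a \<in> {f, f'}" "a' \<in> {f, f'}" "b \<in> {ek, ek'}" "b' \<in> {ek, ek'}" for a a' b b'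
  proof -
    let ?e = "axis (- p) d"
    let ?L = "{- i, m, - p, k, q}"
    have "\<forall>a\<in>?L. \<forall>b\<in>?L. - b \<noteq> a"
    proof -
      have "k \<noteq> - m" using mk by (metis neg_neg_idx)
      then show ?thesis by (simp add: idx neg_iff)
    qed
    then have L: "B (axis a x) (axis b y) = 0" if "a \<in> ?L" "b \<in> ?L" for a b x y
      using that by (auto simp: axis_nth_if)
    have "\<exists>a y. a \<in> ?L \<and> x = axis a y" if "x \<in> {f, axis m t4, ?e, ek, axis q t3}" for x
      using that by (auto simp: f_def ek_def)
    then have base: "B x y = 0" if "x \<in> {f, axis m t4, ?e, ek, axis q t3}" "y \<in> {f, axis m t4, ?e, ek, axis q t3}" for x y
      using that L by metis
    have "B a a' = 0" "B a ?e = 0" "B a b' = 0" "B ?e a' = 0" "B ?e ?e = 0" "B ?e b' = 0"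
      "B b a' = 0" "B b ?e = 0" "B b b' = 0"
      using that by (auto simp: f'_def ek'_def base simp del: B_axis_left B_axis_right)
    then show ?thesis
      unfolding S_def by (simp add: matrix_mult_linear sk_sk_zero del: B_axis_left B_axis_right)
  qed
  have conj: "h ** (mat 1 + S a b) ** iv h = mat 1 + S (h *v a) (h *v b)"
    if "unitary h" "h *v axis (- p) d = axis (- p) d" for h a b
    using that by (simp add: S_def matrix_mult_linear sk_conj mv_linear flip: matrix_mul_assoc)
  have inv: "iv (mat 1 + P) = mat 1 - P" if "unitary (mat 1 + P)" "P ** P = 0" for P
  proof -
    have "(mat 1 + P) ** (mat 1 - P) = mat 1" using that by (simp add: matrix_mult_linear)
    then have "iv (mat 1 + P) ** ((mat 1 + P) ** (mat 1 - P)) = iv (mat 1 + P)" by simp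
    then show ?thesis using that by simp
  qed
  define P where "P = S f ek' - S f ek"
  have h4: "mat 1 + P \<in> H"
  proof -
    have cg: "g ** (mat 1 + S f ek) ** iv g = mat 1 + S f ek'"
      using conj[OF ug(1) gv(2)] by (simp add: gv)
    have "g ** (mat 1 + S f ek) ** iv g ** iv (mat 1 + S f ek) \<in> H"
      by (rule H_comm[OF H gE(1) h3])
    moreover have "g ** (mat 1 + S f ek) ** iv g ** iv (mat 1 + S f ek) = mat 1 + P"
      using SS H_unitary[OF H h3] unfolding cg P_def
      by (subst inv) (auto simp: matrix_mult_linear)
    ultimately show ?thesis by simp
  qed
  have "g' ** (mat 1 + P) ** iv g' = g' ** (mat 1 + S f ek') ** iv g' - g' ** (mat 1 + S f ek) ** iv g' + mat 1"
    using ug by (simp add: P_def matrix_mult_linear)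
  also have "\<dots> = mat 1 + (S f' ek' - S f' ek)"
    using ug by (simp add: conj g'v)
  finally have c: "g' ** (mat 1 + P) ** iv g' = mat 1 + (S f' ek' - S f' ek)" .
  have h5: "mat 1 + ((S f' ek' - S f' ek) - (S f ek' - S f ek)) \<in> H"
  proof -
    have "g' ** (mat 1 + P) ** iv g' ** iv (mat 1 + P) \<in> H"
      by (rule H_comm[OF H gE(2) h4])
    moreover have "g' ** (mat 1 + P) ** iv g' ** iv (mat 1 + P) = mat 1 + ((S f' ek' - S f' ek) - P)"
      using SS H_unitary[OF H h4] unfolding c
      by (subst inv) (auto simp: P_def matrix_mult_linear)
    ultimately show ?thesis by (simp add: P_def)
  qed
  have "(S f' ek' - S f' ek) - (S f ek' - S f ek) = sk (axis m t4) (axis q (- (T2 * t3)))"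
    by (simp add: S_def ek'_def f'_def sk_linear axis_scale vector_add_ldistrib flip: axis_uminus)
  with h5 have "sht m q (cj t4 * - (T2 * t3)) \<in> H" by (simp add: sht_sk)
  then show ?thesis
    by (simp add: T2_def t3_def t4_def rp sj_def si_def mult_ac)
qed

end

context hermitian_forms
begin

lemma ideal_power_Suc_induct [consumes 2, case_names mult add zero]:
  assumes "invariant_ideal F A" "x \<in> ideal_power A (Suc k)"
    and P: "\<And>a z. a \<in> A \<Longrightarrow> z \<in> ideal_power A k \<Longrightarrow> P (a * z)"
    and "\<And>x y. P x \<Longrightarrow> P y \<Longrightarrow> P (x + y)" and "P 0"
  shows "P x"
  using assms(2) unfolding ideal_power.simps
proof (induction rule: ideal_mult_induct)
  case (mult c a b)
  have "P (a * (c * b))"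
    using mult assms(1) by (intro P ideal_mult_left inv_ideal_sub ideal_power_inv)
  then show ?case by (simp add: mult.left_commute)
qed (use assms in auto)

lemma ideal_power_5_induct:
  assumes A: "invariant_ideal F A" and x: "x \<in> ideal_power A 5"
    and P: "\<And>a b c d e z. a \<in> A \<Longrightarrow> b \<in> A \<Longrightarrow> c \<in> A \<Longrightarrow> d \<in> A \<Longrightarrow> e \<in> A \<Longrightarrow> P (a * (b * (c * (d * (e * z)))))"
    and add: "\<And>x y. P x \<Longrightarrow> P y \<Longrightarrow> P (x + y)" and "P 0"
  shows "P x"
proof -
  note ind = ideal_power_Suc_induct[OF A]
  have 1: "P (a * (b * (c * (d * x))))"
    if "x \<in> ideal_power A (Suc 0)" "a \<in> A" "b \<in> A" "c \<in> A" "d \<in> A" for a b c d x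
    using that(1) by (rule ind) (use P that add \<open>P 0\<close> in \<open>auto simp: distrib_left\<close>)
  have 2: "P (a * (b * (c * x)))"
    if "x \<in> ideal_power A (Suc (Suc 0))" "a \<in> A" "b \<in> A" "c \<in> A" for a b c x
    using that(1) by (rule ind) (use 1 that add \<open>P 0\<close> in \<open>auto simp: distrib_left simp del: ideal_power.simps\<close>)
  have 3: "P (a * (b * x))"
    if "x \<in> ideal_power A (Suc (Suc (Suc 0)))" "a \<in> A" "b \<in> A" for a b x
    using that(1) by (rule ind) (use 2 that add \<open>P 0\<close> in \<open>auto simp: distrib_left simp del: ideal_power.simps\<close>)
  have 4: "P (a * x)"
    if "x \<in> ideal_power A (Suc (Suc (Suc (Suc 0))))" "a \<in> A" for a x
    using that(1) by (rule ind) (use 3 that add \<open>P 0\<close> in \<open>auto simp: distrib_left simp del: ideal_power.simps\<close>)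
  have "x \<in> ideal_power A (Suc (Suc (Suc (Suc (Suc 0)))))"
    using x by (simp add: eval_nat_numeral)
  then show ?thesis
    by (rule ind) (use 4 add \<open>P 0\<close> in \<open>auto simp del: ideal_power.simps\<close>)
qed

end

context relative_level
begin

section \<open>Positions of root elements\<close>

text \<open>The coefficients that, multiplied by elements of \<open>A\<close>, give root elements of \<open>H\<close> in position \<open>(m, q)\<close>:
  an ideal quotient, which is an ideal itself (\<open>colon_ideal\<close>).  The extraction results for short root elements take the form of membership in
  \<open>colon H m q (I\<^sup>k)\<close>.\<close>

definition colon :: "('a, 'n) matrix set \<Rightarrow> 'n idx \<Rightarrow> 'n idx \<Rightarrow> 'a set \<Rightarrow> 'a set" where
  "colon H m q A = {y. \<forall>x\<in>A. sht m q (y * x) \<in> H}"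

lemma colonD: "y \<in> colon H m q A \<Longrightarrow> x \<in> A \<Longrightarrow> sht m q (y * x) \<in> H"
  by (simp add: colon_def)

lemma colon_mono: "A \<subseteq> A' \<Longrightarrow> y \<in> colon H m q A' \<Longrightarrow> y \<in> colon H m q A"
  by (auto simp: colon_def)

lemma sht_zero [simp]: "sht m q 0 = mat 1"
  by (simp add: sht_def)

lemma colon_ideal:
  assumes "normalised H" "rt m q" "ideal.subspace A"
  shows "ideal.subspace (colon H m q A)"
proof (rule ideal.subspaceI)
  show "0 \<in> colon H m q A" using H_one[OF assms(1)] by (simp add: colon_def)
  show "x + y \<in> colon H m q A" if "x \<in> colon H m q A" "y \<in> colon H m q A" for x y
    using that assms H_mult[OF assms(1)] by (auto simp: colon_def distrib_right simp flip: sht_add)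
  show "c * x \<in> colon H m q A" if "x \<in> colon H m q A" for c x
    unfolding colon_def
  proof (intro CollectI ballI)
    fix z assume "z \<in> A"
    then have "c * z \<in> A" by (rule ideal_mult_left[OF assms(3)])
    from colonD[OF that this] show "sht m q (c * x * z) \<in> H" by (simp add: mult_ac)
  qed
qed

lemma colon_unit:
  assumes "normalised H" "rt m q" "ideal.subspace A" "y * c \<in> colon H m q A" "c * d = 1"
  shows "y \<in> colon H m q A"
  using ideal_mult_right[OF colon_ideal[OF assms(1-3)] assms(4), of d] assms(5) by (simp add: mult.assoc)

text \<open>The position \<open>(q, m)\<close> carries the same root elements as \<open>(m, q)\<close>, with conjugate coefficients.\<close>

lemma colon_swap:
  assumes "invariant_ideal F A"
  shows "cj y \<in> colon H q m A \<longleftrightarrow> y \<in> colon H m q A"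
proof -
  have *: "cj y \<in> colon H q m A" if y: "y \<in> colon H m q A" for y q m
    unfolding colon_def
  proof (intro CollectI ballI)
    fix x assume "x \<in> A"
    then have "- lm * cj x \<in> A"
      using assms by (intro ideal_mult_left inv_ideal_sub inv_ideal_cj)
    with y have "sht m q (y * (- lm * cj x)) \<in> H" by (rule colonD)
    then show "sht q m (cj y * x) \<in> H"
      by (subst (asm) sht_swap) (simp add: mult_ac)
  qed
  from *[of y m q] *[of "cj y" q m] show ?thesis by auto
qed

lemma sht_fix: "k \<noteq> - i \<Longrightarrow> k \<noteq> - j \<Longrightarrow> sht i j x *v axis k y = axis k y"
  by (auto simp: sht_vec axis_nth_if)

text \<open>The commutator of a root element in position \<open>(m, q)\<close> with one from \<open>E\<close> in position \<open>(m', - m)\<close> is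
  a root element in position \<open>(m', q)\<close>, so changing a position costs one factor from \<open>I\<close>.\<close>

lemma colon_move:
  assumes H: "normalised H" and mq: "rt m q" and m'q: "rt m' q" and mm: "apart m m'" and A: "ideal.subspace A"
    and y: "y \<in> colon H m q A"
  shows "y \<in> colon H m' q (ideal_mult I A)"
proof -
  have idx: "m \<noteq> Zero" "m' \<noteq> Zero" "q \<noteq> Zero" "m \<noteq> q" "m \<noteq> - q" "m' \<noteq> q" "m' \<noteq> - q" "m \<noteq> m'" "m \<noteq> - m'"
    "q \<noteq> m" "q \<noteq> - m" "q \<noteq> m'" "q \<noteq> - m'" "m' \<noteq> m" "m' \<noteq> - m"
    "- q \<noteq> m" "- q \<noteq> m'" "- m \<noteq> m'" "- m' \<noteq> m" "- m \<noteq> q" "- m' \<noteq> q"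
    using rtD[OF mq] rtD[OF m'q] apartD[OF mm] by auto
  have m'm: "rt m' (- m)" using mm idx by (simp add: rt_def apart_sym)
  have 1: "sht m' q (y * (b * x)) \<in> H" if b: "b \<in> I" and x: "x \<in> A" for b x
  proof -
    define g where "g = sht m' (- m) (b * wt F (- m))"
    have gE: "g \<in> E" unfolding g_def using m'm b by (intro E_sht I_mult)
    have h: "sht m q (y * x) \<in> H" using y x by (rule colonD)
    have ug: "unitary g" using gE by (rule E_unitary)
    have w: "wt F (- m) * cj (wt F (- m)) = 1" using idx by simp
    have gm: "g *v axis m 1 = axis m 1 + axis m' (cj b)"
      using idx w by (simp add: g_def sht_vec axis_nth_if) (simp add: mult_ac)
    have gq: "g *v axis q (y * x) = axis q (y * x)"
      unfolding g_def by (rule sht_fix) (use idx in auto)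
    have c: "g ** sht m q (y * x) ** iv g = mat 1 + sk (axis m 1 + axis m' (cj b)) (axis q (y * x))"
      using tv_conj'[OF ug, of "axis m 1" "axis q (y * x)" 0] by (simp add: sht_def gm gq)
    have i: "iv (sht m q (y * x)) = mat 1 + sk (axis m 1) (axis q (- (y * x)))"
      using mq by simp (simp add: sht_def)
    have "g ** sht m q (y * x) ** iv g ** iv (sht m q (y * x)) \<in> H"
      by (rule H_comm[OF H gE h])
    also have "g ** sht m q (y * x) ** iv g ** iv (sht m q (y * x)) = mat 1 + sk (axis m' (cj b)) (axis q (y * x))"
      unfolding c i
      by (simp add: matrix_mult_linear sk_sk_zero axis_nth_if idx sk_linear flip: axis_uminus)
    finally show ?thesis by (simp add: sht_sk mult_ac)
  qed
  show ?thesis unfolding colon_def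
  proof (intro CollectI ballI)
    fix x assume "x \<in> ideal_mult I A"
    then show "sht m' q (y * x) \<in> H"
    proof (induction rule: ideal_mult_induct)
      case (mult c a b)
      then show ?case using 1[of "c * a" b] by (simp add: I_mult mult_ac)
    next
      case (add u v)
      then show ?case using H_mult[OF H add] m'q by (simp add: sht_add distrib_left)
    qed (simp add: H_one[OF H])
  qed
qed

lemma colon_move2:
  assumes H: "normalised H" and mq: "rt m q" and mq': "rt m q'" and qq: "apart q q'" and A: "invariant_ideal F A"
    and y: "y \<in> colon H m q A"
  shows "y \<in> colon H m q' (ideal_mult I A)"
proof -
  have "cj y \<in> colon H q m A" using y A by (simp add: colon_swap)
  then have "cj y \<in> colon H q' m (ideal_mult I A)"
    by (rule colon_move[OF H _ _ qq inv_ideal_sub[OF A], rotated 2]) (use mq mq' rt_sym in blast)+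
  then show ?thesis using A I_inv by (simp add: colon_swap ideal_mult_inv)
qed

abbreviation pw :: "nat \<Rightarrow> 'a set" where "pw \<equiv> ideal_power I"

lemma pw_inv: "invariant_ideal F (pw k)" using I_inv by (rule ideal_power_inv)
lemma pw_sub: "ideal.subspace (pw k)" using pw_inv by (rule inv_ideal_sub)
lemma pw_Suc: "pw (Suc k) \<subseteq> pw k" using I_inv by (rule ideal_power_Suc_sub)
lemma pw_mono: "k \<le> l \<Longrightarrow> pw l \<subseteq> pw k"
  by (induction rule: dec_induct) (use pw_Suc in auto)

text \<open>If \<open>q\<close> is \<open>j\<close> up to sign, then \<open>k = m\<close> and a fourth index \<open>p\<close> satisfy all constraints of the
  preceding lemma, otherwise \<open>p = - q\<close> and a fourth index \<open>k\<close> do.  The five factors from \<open>I\<close> are absorbed by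
  \<open>I\<^sup>5\<close>, and the unit \<open>w\<close> by the first of them.\<close>

lemma basic_extraction:
  assumes H: "normalised H" and s: "\<sigma> \<in> H" and ij: "rt i j" and mq: "rt m q" and mi: "rt m i" and qi: "rt q i"
  shows "\<sigma> $ i $ j * cj (\<sigma> $ i $ i) \<in> colon H m q (pw 5)"
proof -
  obtain p k where pk: "rt i p" "rt j p" "rt k i" "rt k j" "rt k p" "rt q k" "q \<noteq> p" "m \<noteq> p" "m \<noteq> - k"
  proof (cases "apart q j")
    case False
    obtain p where p: "p \<noteq> Zero" "apart p i" "apart p j" "apart p m"
      using ex_apart_three[OF card_n, of i j m] by blast
    have qj: "q = j \<or> q = - j" using False by (auto simp: apart_def)
    show thesis
      using p qj mq mi qi ij rtD[OF mq] apartD[OF p(4)] apartD[OF p(3)]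
      by (intro that[of p m]) (auto simp: rt_def apart_sym)
  next
    case True
    obtain k where k: "k \<noteq> Zero" "apart k i" "apart k j" "apart k q"
      using ex_apart_three[OF card_n, of i j q] by blast
    define k' where "k' = (if m = - k then - k else k)"
    have k': "k' \<noteq> Zero" "apart k' i" "apart k' j" "apart k' q" "m \<noteq> - k'"
      using k by (auto simp: k'_def)
    show thesis
      using True k' mq mi qi ij rtD[OF mq]
      by (intro that[of "- q" k']) (auto simp: rt_def apart_sym)
  qed
  define w where "w = cj (wt F i) * cj (wt F i) * wt F (- k) * il * wt F p"
  have w1: "w * cj w = 1"
  proof -
    have "w * cj w = (wt F i * cj (wt F i)) * (wt F i * cj (wt F i)) * (wt F (- k) * cj (wt F (- k))) * (lm * il) * (wt F p * cj (wt F p))"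
      by (simp add: w_def mult_ac)
    also have "\<dots> = 1" using rtD[OF pk(1)] rtD[OF pk(3)] by simp
    finally show ?thesis .
  qed
  have 1: "sht m q (\<sigma> $ i $ j * cj (\<sigma> $ i $ i) * (a * (b * (c * (d * (e * z)))))) \<in> H"
    if I: "a \<in> I" "b \<in> I" "c \<in> I" "d \<in> I" "e \<in> I" for a b c d e z
  proof -
    have "sht m q (\<sigma> $ i $ j * cj (\<sigma> $ i $ i) * ((a * cj w * z) * b * c * cj (cj d) * e * w)) \<in> H"
      unfolding w_def
      by (rule basic_extraction_aux[OF H s ij pk(1,2,3,4,5) mq pk(6) qi pk(7) mi pk(8,9)])
        (use I in \<open>auto intro: I_mult inv_ideal_cj[OF I_inv]\<close>)
    also have "(a * cj w * z) * b * c * cj (cj d) * e * w = (w * cj w) * (a * (b * (c * (d * (e * z)))))"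
      by (simp add: mult_ac)
    finally show ?thesis by (simp add: w1)
  qed
  show ?thesis unfolding colon_def
  proof (intro CollectI ballI)
    fix x assume "x \<in> pw 5"
    with I_inv show "sht m q (\<sigma> $ i $ j * cj (\<sigma> $ i $ i) * x) \<in> H"
      by (rule ideal_power_5_induct)
        (use 1 H_mult[OF H] mq H_one[OF H] in \<open>auto simp: distrib_left simp flip: sht_add\<close>)
  qed
qed

section \<open>Polarisation\<close>

definition cnjg :: "('a, 'n) matrix \<Rightarrow> ('a, 'n) matrix set \<Rightarrow> ('a, 'n) matrix set" where
  "cnjg g H = (\<lambda>h. g ** h ** iv g) ` H"

text \<open>\<open>E\<close> is invariant under conjugation by elementary matrices, so they permute the subgroups that
  it normalises.\<close>

lemma normalised_cnjg:
  assumes H: "normalised H" and g: "g \<in> EL"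
  shows "normalised (cnjg g H)"
proof -
  note u = H_unitary[OF H] EL_unitary[OF g]
  have "subgroup (cnjg g H) U"
  proof (rule U.subgroupI)
    show "cnjg g H \<subseteq> carrier U" using u by (auto simp: cnjg_def unitary_mult)
    show "cnjg g H \<noteq> {}" using H_one[OF H] by (auto simp: cnjg_def)
    show "iv a \<in> cnjg g H" if "a \<in> cnjg g H" for a
    proof -
      from that obtain h where h: "h \<in> H" "a = g ** h ** iv g" by (auto simp: cnjg_def)
      then have "iv a = g ** iv h ** iv g"
        using u by (simp add: iv_prod unitary_mult flip: matrix_mul_assoc)
      then show ?thesis using H_iv[OF H h(1)] by (auto simp: cnjg_def)
    qed
    show "a \<otimes>\<^bsub>U\<^esub> b \<in> cnjg g H" if "a \<in> cnjg g H" "b \<in> cnjg g H" for a b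
    proof -
      from that obtain h k where h: "h \<in> H" "a = g ** h ** iv g" "k \<in> H" "b = g ** k ** iv g" by (auto simp: cnjg_def)
      then have "a ** b = g ** (h ** k) ** iv g"
        using u by (simp flip: matrix_mul_assoc)
      then show ?thesis using H_mult[OF H h(1,3)] by (auto simp: cnjg_def)
    qed
  qed
  moreover have "e ** a ** iv e \<in> cnjg g H" if "e \<in> E" "a \<in> cnjg g H" for e a
  proof -
    from that obtain h where h: "h \<in> H" "a = g ** h ** iv g" by (auto simp: cnjg_def)
    define e' where "e' = iv g ** e ** g"
    have e': "e' \<in> E" using E_conj[OF EL_iv[OF g] that(1)] u(2) by (simp add: e'_def)
    have "e ** a ** iv e = g ** (e' ** h ** iv e') ** iv g"
      using u h E_unitary[OF that(1)]
      by (simp add: e'_def iv_prod unitary_mult flip: matrix_mul_assoc)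
    then show ?thesis using H_conj[OF H e' h(1)] by (auto simp: cnjg_def)
  qed
  ultimately show ?thesis by (simp add: normalised_def)
qed

text \<open>A membership statement that holds for all subgroups normalised by \<open>E\<close> may be applied to the
  conjugates of \<open>H\<close>.  If \<open>g\<close> commutes with the root element under consideration, the root element then lies in \<open>H\<close>
  itself, and the statement holds for \<open>g\<^sup>-\<^sup>1 \<sigma> g\<close>.  Expanding the entries of this matrix yields new statements.\<close>

lemma polarise:
  assumes all: "\<And>H \<sigma>. normalised H \<Longrightarrow> \<sigma> \<in> H \<Longrightarrow> \<phi> \<sigma> \<in> colon H m q A"
    and g: "g \<in> EL"
    and fix': "g *v axis m 1 = axis m 1" "g *v axis q 1 = axis q 1"
    and H: "normalised H" and s: "\<sigma> \<in> H"
  shows "\<phi> (iv g ** \<sigma> ** g) \<in> colon H m q A"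
  unfolding colon_def
proof (intro CollectI ballI)
  fix x assume x: "x \<in> A"
  note ug = EL_unitary[OF g]
  have "normalised (cnjg (iv g) H)" by (rule normalised_cnjg[OF H EL_iv[OF g]])
  moreover have "iv g ** \<sigma> ** g \<in> cnjg (iv g) H" using s ug by (auto simp: cnjg_def)
  ultimately have "sht m q (\<phi> (iv g ** \<sigma> ** g) * x) \<in> cnjg (iv g) H" using all x by (blast dest: colonD)
  then obtain h where h: "h \<in> H" "sht m q (\<phi> (iv g ** \<sigma> ** g) * x) = iv g ** h ** g" using ug by (auto simp: cnjg_def)
  have "g *v axis q y = axis q y" for y
    using matrix_vector_scale_right[of g y "axis q 1"] by (simp add: fix' axis_scale)
  then have "g ** sht m q y ** iv g = sht m q y" for y
    unfolding sht_def by (simp only: tv_conj'[OF ug] fix')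
  from this[of "\<phi> (iv g ** \<sigma> ** g) * x"] have "sht m q (\<phi> (iv g ** \<sigma> ** g) * x) = h"
    unfolding h(2) using ug by (simp flip: matrix_mul_assoc)
  then show "sht m q (\<phi> (iv g ** \<sigma> ** g) * x) \<in> H" using h by simp
qed

lemma polarise_sht:
  assumes "\<And>H \<sigma>. normalised H \<Longrightarrow> \<sigma> \<in> H \<Longrightarrow> \<phi> \<sigma> \<in> colon H m q A"
    and ab: "rt a b" and fix': "m \<noteq> - a" "m \<noteq> - b" "q \<noteq> - a" "q \<noteq> - b"
    and "normalised H" "\<sigma> \<in> H"
  shows "\<phi> (sht a b (- r) ** \<sigma> ** sht a b r) \<in> colon H m q A"
proof -
  have "\<phi> (iv (sht a b r) ** \<sigma> ** sht a b r) \<in> colon H m q A"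
    by (rule polarise[where \<phi> = \<phi>, OF assms(1) sht_EL[OF ab] sht_fix sht_fix]) (use assms in auto)
  then show ?thesis using ab by simp
qed

lemma polarise_ext:
  assumes "\<And>H \<sigma>. normalised H \<Longrightarrow> \<sigma> \<in> H \<Longrightarrow> \<phi> \<sigma> \<in> colon H m q A"
    and a: "a \<noteq> Zero" "\<alpha> \<in> D" and fix': "m \<noteq> - a" "m \<noteq> Zero" "q \<noteq> - a" "q \<noteq> Zero"
    and "normalised H" "\<sigma> \<in> H"
  shows "\<phi> (ext a (\<dotminus> \<alpha>) ** \<sigma> ** ext a \<alpha>) \<in> colon H m q A"
proof -
  have ne: "- a \<noteq> m" "- a \<noteq> q" using fix' by auto
  have "\<phi> (iv (ext a \<alpha>) ** \<sigma> ** ext a \<alpha>) \<in> colon H m q A"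
    by (rule polarise[where \<phi> = \<phi>, OF assms(1) ext_EL[OF a]])
      (use assms ne in \<open>auto simp: ext_vec axis_nth_if\<close>)
  then show ?thesis using a by (simp add: ext_iv)
qed

lemma colon_up: "y \<in> colon H m q (pw k) \<Longrightarrow> k \<le> l \<Longrightarrow> y \<in> colon H m q (pw l)"
  by (rule colon_mono[OF pw_mono])

lemma colon_move_pw:
  assumes "normalised H" "y \<in> colon H m' q (pw k)" "rt m' q" "rt m q" "apart m' m"
  shows "y \<in> colon H m q (pw (Suc k))"
  using colon_move[OF assms(1,3,4,5) pw_sub assms(2)] by simp

lemma colon_move2_pw:
  assumes "normalised H" "y \<in> colon H m q' (pw k)" "rt m q'" "rt m q" "apart q' q"
  shows "y \<in> colon H m q (pw (Suc k))"
  using colon_move2[OF assms(1,3,4,5) pw_inv assms(2)] by simp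

lemma colon_swap_pw: "cj y \<in> colon H q m (pw k) \<longleftrightarrow> y \<in> colon H m q (pw k)"
  by (rule colon_swap[OF pw_inv])

lemmas colon_add = ideal.subspace_add[OF colon_ideal[OF _ _ pw_sub]]
  and colon_diff = ideal.subspace_diff[OF colon_ideal[OF _ _ pw_sub]]
  and colon_neg = ideal.subspace_neg[OF colon_ideal[OF _ _ pw_sub]]
  and colon_mult = ideal_mult_right[OF colon_ideal[OF _ _ pw_sub]]
  and colon_mult' = ideal_mult_left[OF colon_ideal[OF _ _ pw_sub]]
  and colon_cancel = colon_unit[OF _ _ pw_sub]

lemma wt_cancel: "i \<noteq> Zero \<Longrightarrow> cj (wt F i) * wt F i = 1" "i \<noteq> Zero \<Longrightarrow> wt F i * cj (wt F i) = 1"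
  "i \<noteq> Zero \<Longrightarrow> (il * wt F i) * (lm * cj (wt F i)) = 1"
  using wt_unit[of i] by (simp_all add: mult_ac)

section \<open>Entries of a row\<close>

text \<open>Here and in the next lemmas \<open>i\<close> is a fixed row and \<open>m\<close>, \<open>q\<close> avoid \<open>i\<close> up to sign.
  Conjugation by \<open>sht l (- i)\<close> adds a multiple of column \<open>l\<close> to column \<open>i\<close>, so basic extraction
  yields the product with \<open>\<sigma>\<^sub>i\<^sub>l\<close> instead of \<open>\<sigma>\<^sub>i\<^sub>i\<close>.  If \<open>l\<close> is opposite to \<open>m\<close> or \<open>q\<close> the
  conjugating matrix does not commute with the root element; then another position is used and moved afterwards,
  which accounts for the sixth factor from \<open>I\<close>.\<close>

lemma row_product:
  assumes H: "normalised H" and s: "\<sigma> \<in> H" and ij: "rt i j" and li: "rt l i" and lj: "l \<noteq> - j"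
    and mq: "rt m q" and mi: "rt m i" and qi: "rt q i"
  shows "\<sigma> $ i $ j * cj (\<sigma> $ i $ l) \<in> colon H m q (pw 6)"
proof -
  have 5: "\<sigma> $ i $ j * cj (\<sigma> $ i $ l) \<in> colon H m q (pw 5)"
    if mq: "rt m q" "rt m i" "rt q i" and lm: "l \<noteq> - m" "l \<noteq> - q" for m q
  proof -
    define \<sigma>' where "\<sigma>' = sht l (- i) (- 1) ** \<sigma> ** sht l (- i) 1"
    have ne: "l \<noteq> - j" "m \<noteq> - l" "q \<noteq> - l" "j \<noteq> - l" "m \<noteq> i" "q \<noteq> i" "j \<noteq> i" "i \<noteq> j"
      using lm lj rtD[OF mq(2)] rtD[OF mq(3)] rtD[OF ij] by (auto simp flip: neg_iff)
    have "\<sigma>' $ i $ j * cj (\<sigma>' $ i $ i) \<in> colon H m q (pw 5)"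
      unfolding \<sigma>'_def by (rule polarise_sht) (use H s li ne mq ij in \<open>auto intro: basic_extraction\<close>)
    moreover have "\<sigma>' $ i $ j = \<sigma> $ i $ j" "\<sigma>' $ i $ i = \<sigma> $ i $ i + \<sigma> $ i $ l * wt F (- i)"
      using rtD[OF li] rtD[OF ij] ne unfolding \<sigma>'_def entry_mult3
      by (simp_all add: sht_vec axis_nth_if mv_linear matrix_vector_axis neg_iff)
    moreover have "\<sigma> $ i $ j * cj (\<sigma> $ i $ i) \<in> colon H m q (pw 5)"
      by (rule basic_extraction[OF H s ij mq])
    ultimately have "\<sigma> $ i $ j * cj (\<sigma> $ i $ l) * cj (wt F (- i)) \<in> colon H m q (pw 5)"
      using colon_diff[OF H mq(1)] by (fastforce simp: algebra_simps)
    then show ?thesis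
      by (rule colon_cancel[OF H mq(1) _ wt_cancel(1)]) (use rtD[OF ij] in simp)
  qed
  consider "l \<noteq> - m" "l \<noteq> - q" | "l = - m" | "l = - q" by blast
  then show ?thesis
  proof cases
    case 1 then show ?thesis using 5 mq mi qi by (intro colon_up[of _ _ _ _ 5 6]) auto
  next
    case 2
    obtain m' where m': "m' \<noteq> Zero" "apart m' m" "apart m' q" "apart m' i"
      using ex_apart_three[OF card_n, of m q i] by blast
    have "\<sigma> $ i $ j * cj (\<sigma> $ i $ l) \<in> colon H m q (pw (Suc 5))"
      by (rule colon_move_pw[OF H 5[of m' q]])
        (use m' mq mi qi 2 rtD[OF mq] apartD[OF m'(2)] in \<open>auto simp: rt_def\<close>)
    then show ?thesis by simp
  next
    case 3
    obtain q' where q': "q' \<noteq> Zero" "apart q' q" "apart q' m" "apart q' i"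
      using ex_apart_three[OF card_n, of q m i] by blast
    have "\<sigma> $ i $ j * cj (\<sigma> $ i $ l) \<in> colon H m q (pw (Suc 5))"
      by (rule colon_move2_pw[OF H 5[of m q']])
        (use q' mq mi qi 3 rtD[OF mq] apartD[OF q'(2)] in \<open>auto simp: rt_def apart_sym\<close>)
    then show ?thesis by simp
  qed
qed

text \<open>Polarising again: column \<open>- i\<close> is added to a column \<open>j\<close> for which the product is known.\<close>

lemma row_product_opp:
  assumes H: "normalised H" and s: "\<sigma> \<in> H" and li: "rt l i"
    and mq: "rt m q" and mi: "rt m i" and qi: "rt q i"
  shows "\<sigma> $ i $ (- i) * cj (\<sigma> $ i $ l) \<in> colon H m q (pw 6)"
proof -
  obtain j where j: "rt j i" "rt j l" "j \<noteq> m" "j \<noteq> q"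
  proof (cases "apart q l")
    case True
    then show thesis using mq qi li rtD[OF mq] rtD[OF qi]
      by (intro that[of "- q"]) (auto simp: rt_def)
  next
    case False
    then have "q = l \<or> q = - l" by (auto simp: apart_def)
    then show thesis using mq mi qi li rtD[OF mq] rtD[OF qi]
      by (intro that[of "- m"]) (auto simp: rt_def)
  qed
  define \<sigma>' where "\<sigma>' = sht (- i) (- j) (- 1) ** \<sigma> ** sht (- i) (- j) 1"
  have ij: "rt i j" "rt (- i) (- j)" using j(1) by (simp_all add: rt_sym)
  have "\<sigma>' $ i $ j * cj (\<sigma>' $ i $ l) \<in> colon H m q (pw 6)"
    unfolding \<sigma>'_def
    by (rule polarise_sht[where \<phi> = "\<lambda>\<sigma>. \<sigma> $ i $ j * cj (\<sigma> $ i $ l)"])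
      (use H s j mq mi qi li ij rtD[OF j(1)] rtD[OF j(2)] rtD[OF mi] rtD[OF qi] in \<open>auto intro: row_product\<close>)
  moreover have "\<sigma>' $ i $ j = \<sigma> $ i $ j + \<sigma> $ i $ (- i) * wt F (- j)" "\<sigma>' $ i $ l = \<sigma> $ i $ l"
    using rtD[OF li] rtD[OF ij(1)] rtD[OF j(2)] unfolding \<sigma>'_def entry_mult3
    by (simp_all add: sht_vec axis_nth_if mv_linear matrix_vector_axis neg_iff)
  moreover have "\<sigma> $ i $ j * cj (\<sigma> $ i $ l) \<in> colon H m q (pw 6)"
    by (rule row_product[OF H s ij(1) li _ mq mi qi]) (use rtD[OF j(2)] in auto)
  ultimately have "\<sigma> $ i $ (- i) * cj (\<sigma> $ i $ l) * wt F (- j) \<in> colon H m q (pw 6)"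
    using colon_diff[OF H mq] by (fastforce simp: algebra_simps)
  then show ?thesis
    by (rule colon_cancel[OF H mq _ wt_cancel(2)]) (use rtD[OF j(1)] in simp)
qed

text \<open>For the opposite columns \<open>j\<close> and \<open>- j\<close> of the row both factors change under the conjugation,
  and the product \<open>\<sigma>\<^sub>i\<^sub>j cj(\<sigma>\<^sub>i\<^sub>,\<^sub>-\<^sub>j)\<close> appears only in combination with another unknown product.
  Multiplication by \<open>\<sigma>\<^sub>i\<^sub>j\<close> turns the latter into a known one.\<close>

lemma row_product_square:
  assumes H: "normalised H" and s: "\<sigma> \<in> H" and ij: "rt i j"
    and mq: "rt m q" and mi: "rt m i" and qi: "rt q i"
  shows "\<sigma> $ i $ j * (\<sigma> $ i $ j * cj (\<sigma> $ i $ (- j))) \<in> colon H m q (pw 6)"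
proof -
  define \<sigma>' where "\<sigma>' = sht (- j) (- i) (- 1) ** \<sigma> ** sht (- j) (- i) 1"
  have ji: "rt (- j) (- i)" using ij by (simp add: rt_sym)
  define s where "s = (\<lambda>k. \<sigma> $ i $ k)"
  have e: "\<sigma>' $ i $ j = s j - s (- i) * (il * wt F (- j))" "\<sigma>' $ i $ i = s i + s (- j) * wt F (- i)"
    using rtD[OF ij] unfolding \<sigma>'_def entry_mult3 s_def
    by (simp_all add: sht_vec axis_nth_if mv_linear matrix_vector_axis neg_iff)
  define X where "X = (s j - s (- i) * (il * wt F (- j))) * cj (s i + s (- j) * wt F (- i))"
  have 5: "X \<in> colon H m q (pw 5)" if "rt m q" "rt m i" "rt q i" "m \<noteq> j" "q \<noteq> j" for m q
  proof -
    have "\<sigma>' $ i $ j * cj (\<sigma>' $ i $ i) \<in> colon H m q (pw 5)"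
      unfolding \<sigma>'_def
      by (rule polarise_sht[where \<phi> = "\<lambda>\<sigma>. \<sigma> $ i $ j * cj (\<sigma> $ i $ i)"])
        (use H \<open>\<sigma> \<in> H\<close> that ij ji rtD[OF that(2)] rtD[OF that(3)] in \<open>auto intro: basic_extraction\<close>)
    then show ?thesis by (simp only: e X_def)
  qed
  have X: "X \<in> colon H m q (pw 6)"
  proof -
    consider "m \<noteq> j" "q \<noteq> j" | "m = j" | "q = j" by blast
    then show ?thesis
    proof cases
      case 1 then show ?thesis using 5 mq mi qi by (intro colon_up[of _ _ _ _ 5 6]) auto
    next
      case 2
      obtain m' where m': "m' \<noteq> Zero" "apart m' m" "apart m' q" "apart m' i"
        using ex_apart_three[OF card_n, of m q i] by blast
      have "X \<in> colon H m q (pw (Suc 5))"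
        by (rule colon_move_pw[OF H 5[of m' q]])
          (use m' mq mi qi 2 rtD[OF mq] apartD[OF m'(2)] in \<open>auto simp: rt_def\<close>)
      then show ?thesis by simp
    next
      case 3
      obtain q' where q': "q' \<noteq> Zero" "apart q' q" "apart q' m" "apart q' i"
        using ex_apart_three[OF card_n, of q m i] by blast
      have "X \<in> colon H m q (pw (Suc 5))"
        by (rule colon_move2_pw[OF H 5[of m q']])
          (use q' mq mi qi 3 rtD[OF mq] apartD[OF q'(2)] in \<open>auto simp: rt_def apart_sym\<close>)
      then show ?thesis by simp
    qed
  qed
  have 1: "s j * cj (s i) \<in> colon H m q (pw 6)"
    using basic_extraction[OF H \<open>\<sigma> \<in> H\<close> ij mq mi qi] unfolding s_def by (rule colon_up) simp
  have 2: "s (- i) * cj (s (- j)) \<in> colon H m q (pw 6)"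
    unfolding s_def by (rule row_product_opp[OF H \<open>\<sigma> \<in> H\<close> _ mq mi qi]) (use ij in \<open>simp add: rt_sym\<close>)
  have "s j * X - (s j * cj (s i)) * s j + (s j * cj (s i)) * (s (- i) * (il * wt F (- j)))
      + (s (- i) * cj (s (- j))) * (s j * (il * wt F (- j)) * cj (wt F (- i))) \<in> colon H m q (pw 6)"
    by (intro colon_add[OF H mq] colon_diff[OF H mq] colon_mult[OF H mq] colon_mult'[OF H mq] X 1 2)
  also have "s j * X - (s j * cj (s i)) * s j + (s j * cj (s i)) * (s (- i) * (il * wt F (- j)))
      + (s (- i) * cj (s (- j))) * (s j * (il * wt F (- j)) * cj (wt F (- i)))
    = s j * (s j * cj (s (- j))) * cj (wt F (- i))"
    by (simp add: X_def algebra_simps)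
  finally show ?thesis unfolding s_def
    by (rule colon_cancel[OF H mq _ wt_cancel(1)]) (use rtD[OF ij] in simp)
qed

text \<open>An extra short root element adds a multiple of column \<open>Zero\<close> to column \<open>i\<close>.\<close>

lemma row_product_zero:
  assumes H: "normalised H" and s: "\<sigma> \<in> H" and ij: "rt i j"
    and mq: "rt m q" and mi: "rt m i" and qi: "rt q i" and y: "y \<in> JD"
  shows "\<sigma> $ i $ j * cj (\<sigma> $ i $ Zero * y) \<in> colon H m q (pw 6)"
proof -
  obtain z where z: "(y, z) \<in> D" using y by (auto simp: JD_iff)
  define \<sigma>' where "\<sigma>' = ext (- i) (\<dotminus> (y, z)) ** \<sigma> ** ext (- i) (y, z)"
  define s where "s = (\<lambda>k. \<sigma> $ i $ k)"
  have e: "\<sigma>' $ i $ j = s j" "\<sigma>' $ i $ i = s i + s (- i) * (cj z * wt F (- i)) - s Zero * (il * wt F (- i) * y)"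
    using rtD[OF ij] unfolding \<sigma>'_def entry_mult3 s_def
    by (simp_all add: ext_vec axis_nth_if mv_linear matrix_vector_axis neg_iff del: heis_inv)
  have "\<sigma>' $ i $ j * cj (\<sigma>' $ i $ i) \<in> colon H m q (pw 5)"
    unfolding \<sigma>'_def
    by (rule polarise_ext[where \<phi> = "\<lambda>\<sigma>. \<sigma> $ i $ j * cj (\<sigma> $ i $ i)"])
      (use H \<open>\<sigma> \<in> H\<close> ij mq mi qi rtD[OF mi] rtD[OF qi] z in \<open>auto intro: basic_extraction\<close>)
  then have X: "s j * cj (s i + s (- i) * (cj z * wt F (- i)) - s Zero * (il * wt F (- i) * y)) \<in> colon H m q (pw 6)"
    unfolding e by (rule colon_up) simp
  have 1: "s j * cj (s i) \<in> colon H m q (pw 6)"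
    using basic_extraction[OF H \<open>\<sigma> \<in> H\<close> ij mq mi qi] unfolding s_def by (rule colon_up) simp
  have "s (- i) * cj (s j) \<in> colon H q m (pw 6)"
    unfolding s_def by (rule row_product_opp[OF H \<open>\<sigma> \<in> H\<close>]) (use ij mq mi qi in \<open>simp_all add: rt_sym\<close>)
  then have 2: "s j * cj (s (- i)) \<in> colon H m q (pw 6)"
    using colon_swap_pw[of "s (- i) * cj (s j)" H m q 6] by (simp add: mult.commute)
  have "s j * cj (s i) + s j * cj (s (- i)) * cj (cj z * wt F (- i))
      - s j * cj (s i + s (- i) * (cj z * wt F (- i)) - s Zero * (il * wt F (- i) * y)) \<in> colon H m q (pw 6)"
    by (intro colon_add[OF H mq] colon_diff[OF H mq] colon_mult[OF H mq] X 1 2)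
  also have "s j * cj (s i) + s j * cj (s (- i)) * cj (cj z * wt F (- i))
      - s j * cj (s i + s (- i) * (cj z * wt F (- i)) - s Zero * (il * wt F (- i) * y))
    = s j * cj (s Zero * y) * cj (il * wt F (- i))"
    by (simp add: algebra_simps)
  finally show ?thesis unfolding s_def
    by (rule colon_cancel[OF H mq, where d = "il * wt F (- i)"]) (use rtD[OF ij] wt_cancel[of "- i"] in \<open>simp add: mult_ac\<close>)
qed

text \<open>The row is unimodular, \<open>1 = \<Sum>\<^sub>k s\<^sub>k w\<^sub>k\<close>, which removes the second factor of the products found so
  far.  The product \<open>t = s\<^sub>j cj(s\<^sub>-\<^sub>j)\<close> of opposite entries is missing from the list; it is obtained first,
  by the same argument applied to \<open>t\<close> in place of \<open>s\<^sub>j\<close>.\<close>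

lemma row_entry:
  assumes H: "normalised H" and s: "\<sigma> \<in> H" and ij: "rt i j"
    and mq: "rt m q" and mi: "rt m i" and qi: "rt q i"
  shows "\<sigma> $ i $ j \<in> colon H m q (pw 6)"
proof -
  let ?K = "colon H m q (pw 6)"
  note K = colon_ideal[OF H mq pw_sub[of 6]]
  define s where "s = (\<lambda>k. \<sigma> $ i $ k)"
  define w where "w = (\<lambda>k. iv \<sigma> $ k $ i)"
  have us: "unitary \<sigma>" using H s by (rule H_unitary)
  have "(\<sigma> ** iv \<sigma>) $ i $ i = 1" using us by (simp add: mat_def)
  then have one: "(\<Sum>k\<in>UNIV. s k * w k) = 1" by (simp add: matrix_matrix_mult_def s_def w_def)
  \<comment> \<open>the products with the entry in column \<open>Zero\<close> are available for coefficients in \<open>J(\<Delta>)\<close> only\<close>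
  have w0: "w Zero \<in> JD" unfolding w_def using us rtD[OF ij] by (intro unitary_JD) auto
  have mq': "rt q m" using mq by (simp add: rt_sym)
  have P1: "s a * cj (s i) \<in> colon H m q (pw 6)" if "rt i a" "rt m q" "rt m i" "rt q i" for a m q
    using basic_extraction[OF H \<open>\<sigma> \<in> H\<close> that] unfolding s_def by (rule colon_up) simp
  have conj: "y * cj z \<in> colon H m q (pw 6)" if "z * cj y \<in> colon H q m (pw 6)" for y z
    using that colon_swap_pw[of "z * cj y" H m q 6] by (simp add: mult.commute)
  have L: "s a * cj (s k * w k) \<in> ?K" if a: "rt i a" and k: "k \<noteq> - a" for a k
  proof -
    consider "k = Zero" | "k = i" | "k = - i" | "rt k i" using rtD[OF ij] by (auto simp: rt_def apart_def)
    then show ?thesis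
    proof cases
      case 1
      then show ?thesis unfolding s_def using row_product_zero[OF H \<open>\<sigma> \<in> H\<close> a mq mi qi w0] by simp
    next
      case 2
      then show ?thesis using ideal_mult_right[OF K P1[OF a mq mi qi], of "cj (w i)"] by (simp add: mult_ac)
    next
      case 3
      have "s (- i) * cj (s a) \<in> colon H q m (pw 6)"
        unfolding s_def by (rule row_product_opp[OF H \<open>\<sigma> \<in> H\<close> _ mq' qi mi]) (use a in \<open>simp add: rt_sym\<close>)
      from ideal_mult_right[OF K conj[OF this], of "cj (w k)"] 3 show ?thesis by (simp add: mult_ac)
    next
      case 4
      then have "s a * cj (s k) \<in> ?K"
        unfolding s_def by (intro row_product[OF H \<open>\<sigma> \<in> H\<close> a _ k mq mi qi])
      from ideal_mult_right[OF K this, of "cj (w k)"] show ?thesis by (simp add: mult_ac)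
    qed
  qed
  define t where "t = s j * cj (s (- j))"
  have T: "t * (s k * w k) \<in> ?K" for k
  proof -
    have R: "z * (s k * w k) \<in> ?K" if "s k * (c * z) \<in> ?K" "c * c' = 1" for z c c'
    proof -
      have "s k * (c * z) * (c' * w k) \<in> ?K" by (rule ideal_mult_right[OF K that(1)])
      also have "s k * (c * z) * (c' * w k) = (c * c') * (z * (s k * w k))" by (simp add: mult_ac)
      finally show ?thesis using that(2) by simp
    qed
    have ij': "rt i (- j)" using ij by simp
    consider "k = Zero" | "k = i" | "k = - i" | "k = j" | "rt k i" "k \<noteq> j"
      using rtD[OF ij] by (auto simp: rt_def apart_def)
    then show ?thesis
    proof cases
      case 1
      have "s (- j) * cj (s Zero * w Zero) \<in> colon H q m (pw 6)"
        unfolding s_def by (rule row_product_zero[OF H \<open>\<sigma> \<in> H\<close> ij' mq' qi mi w0])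
      from ideal_mult_right[OF K conj[OF this], of "s j"] 1 show ?thesis by (simp add: t_def mult_ac)
    next
      case 2
      have "s (- j) * cj (s i) \<in> colon H q m (pw 6)" using P1[OF ij' mq' qi mi] .
      from ideal_mult_right[OF K conj[OF this], of "s j * w i"] 2 show ?thesis by (simp add: t_def mult_ac)
    next
      case 3
      have "s (- i) * cj (s (- j)) \<in> ?K"
        unfolding s_def by (rule row_product_opp[OF H \<open>\<sigma> \<in> H\<close> _ mq mi qi]) (use ij in \<open>simp add: rt_sym\<close>)
      from ideal_mult_right[OF K this, of "s j * w (- i)"] 3 show ?thesis by (simp add: t_def mult_ac)
    next
      case 4
      from ideal_mult_right[OF K row_product_square[OF H \<open>\<sigma> \<in> H\<close> ij mq mi qi], of "w j"] 4
      show ?thesis by (simp add: t_def s_def mult_ac)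
    next
      case 5
      have "s k * cj (s (- j)) \<in> ?K"
        unfolding s_def by (rule row_product[OF H \<open>\<sigma> \<in> H\<close> _ _ _ mq mi qi])
          (use 5 ij in \<open>auto simp: rt_sym\<close>)
      from ideal_mult_right[OF K this, of "s j * w k"] show ?thesis by (simp add: t_def mult_ac)
    qed
  qed
  have "(\<Sum>k\<in>UNIV. t * (s k * w k)) \<in> ?K" by (rule ideal.subspace_sum[OF K T])
  then have "t \<in> ?K" by (simp add: one flip: sum_distrib_left)
  then have L': "s j * cj (s k * w k) \<in> ?K" for k
    using L[OF ij, of k] ideal_mult_right[OF K, of t "cj (w k)"]
    by (cases "k = - j") (auto simp: t_def mult_ac)
  have "(\<Sum>k\<in>UNIV. s j * cj (s k * w k)) \<in> ?K" by (rule ideal.subspace_sum[OF K L'])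
  also have "(\<Sum>k\<in>UNIV. s j * cj (s k * w k)) = s j * cj (\<Sum>k\<in>UNIV. s k * w k)"
    by (simp add: sum_distrib_left)
  finally show ?thesis unfolding one by (simp add: s_def)
qed

text \<open>Positions that avoid \<open>j\<close> instead of \<open>i\<close> are reached through the inverse of \<open>\<sigma>\<close>, whose rows are the
  columns of \<open>\<sigma>\<close>.  In the remaining case \<open>m\<close> and \<open>q\<close> hit both \<open>i\<close> and \<open>j\<close>, and a move is needed.\<close>

lemma entry_extraction:
  assumes H: "normalised H" and s: "\<sigma> \<in> H" and ij: "rt i j" and mq: "rt m q"
  shows "\<sigma> $ i $ j \<in> colon H m q (pw 7)"
proof -
  have us: "unitary \<sigma>" using H s by (rule H_unitary)
  have c: "\<sigma> $ i $ j \<in> colon H m q (pw 6)" if mq: "rt m q" "rt m j" "rt q j" for m q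
  proof -
    have "iv \<sigma> $ (- j) $ (- i) \<in> colon H q m (pw 6)"
      by (rule row_entry[OF H H_iv[OF H s]]) (use that ij in \<open>simp_all add: rt_sym\<close>)
    then have "cj (iv \<sigma> $ (- j) $ (- i)) \<in> colon H m q (pw 6)" by (simp add: colon_swap_pw)
    then have "cj (iv \<sigma> $ (- j) $ (- i)) * wt F (- j) \<in> colon H m q (pw 6)"
      by (rule colon_mult[OF H mq(1)])
    then have "\<sigma> $ i $ j * wt F (- i) \<in> colon H m q (pw 6)"
      by (simp only: iv_entry[OF us, of "- j" "- i"] neg_neg_idx mult.commute[of "wt F (- i)"])
    then show ?thesis
      by (rule colon_cancel[OF H mq(1) _ wt_cancel(2)]) (use rtD[OF ij] in simp)
  qed
  have r: "\<sigma> $ i $ j \<in> colon H m q (pw 6)" if "rt m q" "rt m i" "rt q i" for m q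
    by (rule row_entry[OF H s ij that])
  consider "rt m i" "rt q i" | "rt m j" "rt q j" | "\<not> rt m i" "\<not> rt q j" | "\<not> rt m j" "\<not> rt q i"
  proof -
    have "rt x j" if "\<not> rt x i" "x \<noteq> Zero" for x
      using that ij by (auto simp: rt_def apart_def)
    with that rtD[OF mq] show thesis by metis
  qed
  then show ?thesis
  proof cases
    case 1 then show ?thesis using r mq by (intro colon_up[of _ _ _ _ 6 7]) auto
  next
    case 2 then show ?thesis using c mq by (intro colon_up[of _ _ _ _ 6 7]) auto
  next
    case 3
    then have mi: "m = i \<or> m = - i" and qj: "q = j \<or> q = - j" using mq ij by (auto simp: rt_def apart_def)
    obtain m' where m': "m' \<noteq> Zero" "apart m' i" "apart m' j"
      using ex_apart_three[OF card_n, of i j j] by blast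
    have "\<sigma> $ i $ j \<in> colon H m q (pw (Suc 6))"
      by (rule colon_move_pw[OF H r[of m' q]])
        (use m' mi qj mq ij in \<open>auto simp: rt_def apart_sym\<close>)
    then show ?thesis by simp
  next
    case 4
    then have mi: "q = i \<or> q = - i" and qj: "m = j \<or> m = - j" using mq ij by (auto simp: rt_def apart_def)
    obtain q' where q': "q' \<noteq> Zero" "apart q' i" "apart q' j"
      using ex_apart_three[OF card_n, of i j j] by blast
    have "\<sigma> $ i $ j \<in> colon H m q (pw (Suc 6))"
      by (rule colon_move2_pw[OF H r[of m q']])
        (use q' mi qj mq ij in \<open>auto simp: rt_def apart_sym\<close>)
    then show ?thesis by simp
  qed
qed

end

context hermitian_forms
begin

text \<open>The action is additive in the ring element up to a trace, because the equation of \<open>\<Delta>\<^sub>m\<^sub>a\<^sub>x\<close>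
  turns the mixed term of the Heisenberg multiplication into one.\<close>

lemma heis_act_add:
  assumes "\<alpha> \<in> D"
  shows "act \<alpha> (a + b) = act \<alpha> a \<dotplus> act \<alpha> b \<dotplus>
    trc (cj b * a * snd \<alpha>)"
proof -
  obtain x y where xy: "\<alpha> = (x, y)" by fastforce
  have "cj x * mu F * x + y + cj y * lm = 0" using D_eq assms xy by blast
  then have "b * cj a * (cj x * mu F * x + y + cj y * lm) = 0" by simp
  then show ?thesis by (simp add: xy algebra_simps)
qed

end

context relative_level
begin

section \<open>The ideal of the upper level\<close>

text \<open>Adding column \<open>- i\<close> to column \<open>j\<close> in the statement for \<open>\<sigma>\<^sub>i\<^sub>j\<close>.\<close>

lemma opposite_entry_extraction:
  assumes H: "normalised H" and s: "\<sigma> \<in> H" and i: "i \<noteq> Zero" and mq: "rt m q"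
  shows "\<sigma> $ i $ (- i) \<in> colon H m q (pw 7)"
proof -
  have 6: "\<sigma> $ i $ (- i) \<in> colon H m q (pw 6)" if mq: "rt m q" and mi: "rt m i" and qi: "rt q i" for m q
  proof -
    define j where "j = - m"
    have ij: "rt i j" "rt (- i) (- j)" "j \<noteq> m" "j \<noteq> q" "m \<noteq> j" "q \<noteq> j"
      using mi rtD[OF mq] by (auto simp: j_def rt_sym)
    define \<sigma>' where "\<sigma>' = sht (- i) (- j) (- 1) ** \<sigma> ** sht (- i) (- j) 1"
    have "\<sigma>' $ i $ j \<in> colon H m q (pw 6)"
      unfolding \<sigma>'_def
      by (rule polarise_sht[where \<phi> = "\<lambda>\<sigma>. \<sigma> $ i $ j"])
        (use H s mq mi qi ij rtD[OF mi] rtD[OF qi] in \<open>auto intro: row_entry\<close>)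
    moreover have "\<sigma>' $ i $ j = \<sigma> $ i $ j + \<sigma> $ i $ (- i) * wt F (- j)"
      using rtD[OF ij(1)] unfolding \<sigma>'_def entry_mult3
      by (simp_all add: sht_vec axis_nth_if mv_linear matrix_vector_axis neg_iff)
    moreover have "\<sigma> $ i $ j \<in> colon H m q (pw 6)"
      by (rule row_entry[OF H s ij(1) mq mi qi])
    ultimately have "\<sigma> $ i $ (- i) * wt F (- j) \<in> colon H m q (pw 6)"
      using colon_diff[OF H mq] by fastforce
    then show ?thesis
      by (rule colon_cancel[OF H mq _ wt_cancel(2)]) (use rtD[OF ij(1)] in simp)
  qed
  consider "rt m i" "rt q i" | "m = i \<or> m = - i" | "q = i \<or> q = - i"
    using mq i by (auto simp: rt_def apart_def)
  then show ?thesis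
  proof cases
    case 1 then show ?thesis using 6 mq by (intro colon_up[of _ _ _ _ 6 7]) auto
  next
    case 2
    obtain m' where m': "m' \<noteq> Zero" "apart m' i" "apart m' q"
      using ex_apart_three[OF card_n, of i q q] by blast
    have "\<sigma> $ i $ (- i) \<in> colon H m q (pw (Suc 6))"
      by (rule colon_move_pw[OF H 6[of m' q]])
        (use m' 2 mq i in \<open>auto simp: rt_def apart_sym\<close>)
    then show ?thesis by simp
  next
    case 3
    obtain q' where q': "q' \<noteq> Zero" "apart q' i" "apart q' m"
      using ex_apart_three[OF card_n, of i m m] by blast
    have "\<sigma> $ i $ (- i) \<in> colon H m q (pw (Suc 6))"
      by (rule colon_move2_pw[OF H 6[of m q']])
        (use q' 3 mq i in \<open>auto simp: rt_def apart_sym\<close>)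
    then show ?thesis by simp
  qed
qed

lemma off_diagonal_extraction:
  assumes H: "normalised H" and s: "\<sigma> \<in> H" and ij: "i \<noteq> Zero" "j \<noteq> Zero" "i \<noteq> j" and mq: "rt m q"
  shows "\<sigma> $ i $ j \<in> colon H m q (pw 7)"
proof (cases "j = - i")
  case True
  then show ?thesis using opposite_entry_extraction[OF H s ij(1) mq] by simp
next
  case False
  then have "rt i j" using ij by (auto simp: rt_def apart_def)
  then show ?thesis by (rule entry_extraction[OF H s _ mq])
qed

text \<open>Conjugation by \<open>sht i (- j)\<close> adds \<open>\<sigma>\<^sub>i\<^sub>i - \<sigma>\<^sub>j\<^sub>j\<close>, up to a unit and an
  off-diagonal entry, to the entry \<open>\<sigma>\<^sub>i\<^sub>j\<close>.  It commutes with the root element only for some pairs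
  \<open>(i, j)\<close>; all others are compared through an index \<open>l\<close> that avoids \<open>m\<close> and \<open>q\<close>.\<close>

lemma diagonal_extraction:
  assumes H: "normalised H" and s: "\<sigma> \<in> H" and ij: "i \<noteq> Zero" "j \<noteq> Zero" and mq: "rt m q"
  shows "\<sigma> $ i $ i - \<sigma> $ j $ j \<in> colon H m q (pw 7)"
proof -
  let ?K = "colon H m q (pw 7)"
  have 1: "\<sigma> $ i $ i - \<sigma> $ j $ j \<in> ?K" if ij: "rt i j" and ne: "i \<noteq> - m" "i \<noteq> - q" "j \<noteq> m" "j \<noteq> q" for i j
  proof -
    define \<sigma>' where "\<sigma>' = sht i (- j) (- 1) ** \<sigma> ** sht i (- j) 1"
    have ne': "m \<noteq> - i" "q \<noteq> - i" "m \<noteq> j" "q \<noteq> j" using ne by auto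
    have "\<sigma>' $ i $ j \<in> ?K"
      unfolding \<sigma>'_def
      by (rule polarise_sht[where \<phi> = "\<lambda>\<sigma>. \<sigma> $ i $ j"])
        (use H s mq ij ne' in \<open>auto intro: entry_extraction\<close>)
    moreover have "\<sigma>' $ i $ j = \<sigma> $ i $ j + \<sigma> $ i $ i * wt F (- j) - wt F (- j) * (\<sigma> $ j $ j + \<sigma> $ j $ i * wt F (- j))"
      using rtD[OF ij] unfolding \<sigma>'_def entry_mult3
      by (simp add: sht_vec axis_nth_if mv_linear matrix_vector_axis neg_iff algebra_simps)
    moreover have "\<sigma> $ i $ j \<in> ?K" by (rule entry_extraction[OF H s ij mq])
    moreover have "\<sigma> $ j $ i * (wt F (- j) * wt F (- j)) \<in> ?K"
      by (intro colon_mult[OF H mq] entry_extraction[OF H s _ mq]) (use ij in \<open>simp add: rt_sym\<close>)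
    ultimately have "\<sigma>' $ i $ j - \<sigma> $ i $ j + \<sigma> $ j $ i * (wt F (- j) * wt F (- j)) \<in> ?K"
      by (intro colon_add[OF H mq] colon_diff[OF H mq])
    also have "\<sigma>' $ i $ j - \<sigma> $ i $ j + \<sigma> $ j $ i * (wt F (- j) * wt F (- j)) = (\<sigma> $ i $ i - \<sigma> $ j $ j) * wt F (- j)"
      by (simp add: \<open>\<sigma>' $ i $ j = _\<close> algebra_simps)
    finally show ?thesis
      by (rule colon_cancel[OF H mq _ wt_cancel(2)]) (use rtD[OF ij] in simp)
  qed
  obtain l where l: "l \<noteq> Zero" "apart l m" "apart l q"
    using ex_apart_three[OF card_n, of m q q] by blast
  have swap: "y - x \<in> ?K" if "x - y \<in> ?K" for x y
    using colon_neg[OF H mq that] by simp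
  have 2: "\<sigma> $ i $ i - \<sigma> $ l $ l \<in> ?K" if i: "i \<noteq> Zero" "apart i l" and l: "l \<noteq> Zero" "apart l m" "apart l q" for i l
  proof (cases "i = - m \<or> i = - q")
    case True
    have "\<sigma> $ l $ l - \<sigma> $ i $ i \<in> ?K"
      by (rule 1) (use True that apartD[OF l(2)] apartD[OF l(3)] rtD[OF mq] in \<open>auto simp: rt_def apart_sym\<close>)
    then show ?thesis by (rule swap)
  next
    case False
    show ?thesis
      by (rule 1) (use False that apartD[OF l(2)] apartD[OF l(3)] in \<open>auto simp: rt_def apart_sym\<close>)
  qed
  have m: "\<sigma> $ m $ m - \<sigma> $ l $ l \<in> ?K" if "l \<noteq> Zero" "apart l m" "apart l q" for l
    by (rule 2) (use that rtD[OF mq] in \<open>auto simp: apart_sym\<close>)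
  have 3: "\<sigma> $ i $ i - \<sigma> $ l $ l \<in> ?K" if i: "i \<noteq> Zero" for i
  proof -
    consider "apart i l" | "i = l" | "i = - l" by (auto simp: apart_def)
    then show ?thesis
    proof cases
      case 1 then show ?thesis using 2 i l by blast
    next
      case 2 then show ?thesis using ideal.subspace_0[OF colon_ideal[OF H mq pw_sub]] by simp
    next
      case 3
      have "(\<sigma> $ m $ m - \<sigma> $ l $ l) - (\<sigma> $ m $ m - \<sigma> $ (- l) $ (- l)) \<in> ?K"
        by (intro colon_diff[OF H mq] m) (use l in auto)
      then show ?thesis using 3 by simp
    qed
  qed
  have "(\<sigma> $ i $ i - \<sigma> $ l $ l) - (\<sigma> $ j $ j - \<sigma> $ l $ l) \<in> ?K"
    by (intro colon_diff[OF H mq] 3 ij)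
  then show ?thesis by simp
qed

text \<open>The choice is such that root elements in position \<open>(i, - j)\<close> and extra short ones at \<open>- j\<close>
  commute with those in position \<open>(m, q)\<close>.\<close>

lemma ex_commuting_index:
  assumes i: "i \<noteq> Zero" and mq: "rt m q"
  obtains j where "rt i j" "j \<noteq> m" "j \<noteq> q" "m \<noteq> j" "q \<noteq> j"
proof (cases "rt m i")
  case True
  then show ?thesis using rtD[OF mq] by (intro that[of "- m"]) (auto simp: rt_sym)
next
  case False
  then have "rt q i" using mq i by (auto simp: rt_def apart_def)
  then show ?thesis using rtD[OF mq] by (intro that[of "- q"]) (auto simp: rt_sym)
qed

text \<open>An extra short root element adds a multiple of column \<open>Zero\<close> to a column \<open>j\<close> whose entry is
  known.\<close>

lemma zero_column_extraction:
  assumes H: "normalised H" and s: "\<sigma> \<in> H" and i: "i \<noteq> Zero" and y: "y \<in> JD" and mq: "rt m q"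
  shows "\<sigma> $ i $ Zero * y \<in> colon H m q (pw 7)"
proof -
  let ?K = "colon H m q (pw 7)"
  obtain j where j: "rt i j" "j \<noteq> m" "j \<noteq> q" "m \<noteq> j" "q \<noteq> j" using ex_commuting_index[OF i mq] .
  obtain z where z: "(y, z) \<in> D" using y by (auto simp: JD_iff)
  define \<sigma>' where "\<sigma>' = ext (- j) (\<dotminus> (y, z)) ** \<sigma> ** ext (- j) (y, z)"
  have e: "\<sigma>' $ i $ j = \<sigma> $ i $ j + \<sigma> $ i $ (- j) * (cj z * wt F (- j)) - \<sigma> $ i $ Zero * (il * wt F (- j) * y)"
    using rtD[OF j(1)] unfolding \<sigma>'_def entry_mult3
    by (simp_all add: ext_vec axis_nth_if mv_linear matrix_vector_axis neg_iff del: heis_inv)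
  have "\<sigma>' $ i $ j \<in> ?K"
    unfolding \<sigma>'_def
    by (rule polarise_ext[where \<phi> = "\<lambda>\<sigma>. \<sigma> $ i $ j"])
      (use H s j mq rtD[OF j(1)] rtD[OF mq] z in \<open>auto intro: entry_extraction\<close>)
  moreover have "\<sigma> $ i $ j \<in> ?K" "\<sigma> $ i $ (- j) \<in> ?K"
    using j by (auto intro: entry_extraction[OF H s _ mq])
  ultimately have "\<sigma> $ i $ j + \<sigma> $ i $ (- j) * (cj z * wt F (- j)) - \<sigma>' $ i $ j \<in> ?K"
    by (intro colon_add[OF H mq] colon_diff[OF H mq] colon_mult[OF H mq])
  then have "(\<sigma> $ i $ Zero * y) * (il * wt F (- j)) \<in> ?K" unfolding e by (simp add: mult_ac)
  then show ?thesis
    by (rule colon_cancel[OF H mq _ wt_cancel(3)]) (use rtD[OF j(1)] in simp)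
qed

text \<open>The rows of the inverse are the columns of the matrix.\<close>

lemma zero_row_extraction:
  assumes H: "normalised H" and s: "\<sigma> \<in> H" and j: "j \<noteq> Zero" and y: "y \<in> JD" and mq: "rt m q"
  shows "cj y * mu F * \<sigma> $ Zero $ j \<in> colon H m q (pw 7)"
proof -
  have us: "unitary \<sigma>" using H s by (rule H_unitary)
  have "iv \<sigma> $ (- j) $ Zero * y \<in> colon H q m (pw 7)"
    by (rule zero_column_extraction[OF H H_iv[OF H s]]) (use j y mq in \<open>simp_all add: rt_sym\<close>)
  then have "cj (iv \<sigma> $ (- j) $ Zero * y) \<in> colon H m q (pw 7)" by (simp only: colon_swap_pw)
  then have "cj (iv \<sigma> $ (- j) $ Zero * y) * wt F (- j) \<in> colon H m q (pw 7)"
    by (rule colon_mult[OF H mq])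
  also have "cj (iv \<sigma> $ (- j) $ Zero * y) * wt F (- j) = cj y * (cj (iv \<sigma> $ (- j) $ Zero) * wt F (- j))"
    by (simp add: mult_ac)
  finally show ?thesis by (simp only: iv_entry[OF us] neg_neg_idx neg_Zero wt_simps mult.assoc)
qed

text \<open>An extra short root element changes the entry in row \<open>Zero\<close> and column \<open>l\<close> both by column
  operations, which bring in \<open>\<sigma>\<^sub>0\<^sub>0\<close>, and by row operations, which bring in \<open>\<sigma>\<^sub>l\<^sub>l\<close>.\<close>

lemma zero_diagonal_extraction:
  assumes H: "normalised H" and s: "\<sigma> \<in> H" and j: "j \<noteq> Zero" and y: "y \<in> JD" and z: "z \<in> JD" and mq: "rt m q"
  shows "cj y * mu F * (\<sigma> $ Zero $ Zero - \<sigma> $ j $ j) * z \<in> colon H m q (pw 7)"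
proof -
  let ?K = "colon H m q (pw 7)"
  obtain z' where z': "(z, z') \<in> D" using z by (auto simp: JD_iff)
  obtain l where l: "rt m l" "l \<noteq> m" "l \<noteq> q" "m \<noteq> l" "q \<noteq> l" using ex_commuting_index[OF rtD(1)[OF mq] mq] .
  define \<sigma>' where "\<sigma>' = ext (- l) (\<dotminus> (z, z')) ** \<sigma> ** ext (- l) (z, z')"
  define c where "c = cj z' * wt F (- l)"
  define \<kappa> where "\<kappa> = il * wt F (- l)"
  have e: "\<sigma>' $ Zero $ l = (\<sigma> $ Zero $ l + \<sigma> $ Zero $ (- l) * c - \<sigma> $ Zero $ Zero * (\<kappa> * z))
      + \<kappa> * z * (\<sigma> $ l $ l + \<sigma> $ l $ (- l) * c - \<sigma> $ l $ Zero * (\<kappa> * z))"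
    using rtD[OF l(1)] unfolding \<sigma>'_def entry_mult3 c_def \<kappa>_def
    by (simp add: ext_vec axis_nth_if mv_linear matrix_vector_axis neg_iff algebra_simps)
  have K0: "cj y * mu F * \<sigma>' $ Zero $ l \<in> ?K"
    unfolding \<sigma>'_def
    by (rule polarise_ext[where \<phi> = "\<lambda>\<sigma>. cj y * mu F * \<sigma> $ Zero $ l"])
      (use H s l mq rtD[OF l(1)] rtD[OF mq] z' y in \<open>auto intro: zero_row_extraction\<close>)
  have K1: "cj y * mu F * \<sigma> $ Zero $ l \<in> ?K" "cj y * mu F * \<sigma> $ Zero $ (- l) \<in> ?K"
    using rtD[OF l(1)] by (auto intro: zero_row_extraction[OF H s _ y mq])
  have K2: "\<sigma> $ l $ (- l) \<in> ?K" "\<sigma> $ l $ Zero * z \<in> ?K" "\<sigma> $ l $ l - \<sigma> $ j $ j \<in> ?K"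
    using rtD[OF l(1)] j z
    by (auto intro: opposite_entry_extraction[OF H s _ mq] zero_column_extraction[OF H s _ _ mq] diagonal_extraction[OF H s _ _ mq])
  have "cj y * mu F * \<sigma> $ Zero $ l + cj y * mu F * \<sigma> $ Zero $ (- l) * c - cj y * mu F * \<sigma>' $ Zero $ l
      + \<sigma> $ l $ (- l) * (cj y * mu F * \<kappa> * z * c) - (\<sigma> $ l $ Zero * z) * (cj y * mu F * \<kappa> * \<kappa> * z)
      + (\<sigma> $ l $ l - \<sigma> $ j $ j) * (cj y * mu F * \<kappa> * z) \<in> ?K"
    by (intro colon_add[OF H mq] colon_diff[OF H mq] colon_mult[OF H mq] K0 K1 K2)
  also have "cj y * mu F * \<sigma> $ Zero $ l + cj y * mu F * \<sigma> $ Zero $ (- l) * c - cj y * mu F * \<sigma>' $ Zero $ l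
      + \<sigma> $ l $ (- l) * (cj y * mu F * \<kappa> * z * c) - (\<sigma> $ l $ Zero * z) * (cj y * mu F * \<kappa> * \<kappa> * z)
      + (\<sigma> $ l $ l - \<sigma> $ j $ j) * (cj y * mu F * \<kappa> * z)
    = (cj y * mu F * (\<sigma> $ Zero $ Zero - \<sigma> $ j $ j) * z) * \<kappa>"
    unfolding e by (simp add: algebra_simps)
  finally show ?thesis unfolding \<kappa>_def
    by (rule colon_cancel[OF H mq _ wt_cancel(3)]) (use rtD[OF l(1)] in simp)
qed

lemma upper_ideal_sub: "ideal.subspace (upper_ideal F H)"
  by (simp add: upper_ideal_def)

text \<open>The ideal quotient is an ideal, and conjugate generators are handled by interchanging
  \<open>m\<close> and \<open>q\<close>.\<close>

lemma upper_ideal_extraction: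
  assumes H: "normalised H" and mq: "rt m q"
  shows "upper_ideal F H \<subseteq> colon H m q (pw 7)"
proof -
  have gens: "upper_gens F H \<subseteq> colon H m q (pw 7)" if mq: "rt m q" for m q
    unfolding upper_gens_def
    using off_diagonal_extraction[OF H _ _ _ _ mq] diagonal_extraction[OF H _ _ _ mq]
      zero_column_extraction[OF H _ _ _ mq] zero_row_extraction[OF H _ _ _ mq]
      zero_diagonal_extraction[OF H _ _ _ _ mq]
    by auto
  have "cj ` upper_gens F H \<subseteq> colon H m q (pw 7)"
    using gens[of q m] mq by (auto simp: colon_swap_pw rt_sym)
  with gens[OF mq] show ?thesis
    unfolding upper_ideal_def by (intro ideal.span_minimal colon_ideal[OF H mq pw_sub]) auto
qed

definition short_in :: "('a, 'n) matrix set \<Rightarrow> 'a set \<Rightarrow> bool" where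
  "short_in H A \<longleftrightarrow> (\<forall>m q. \<forall>x\<in>A. rt m q \<longrightarrow> sht m q x \<in> H)"

lemma short_inD: "short_in H A \<Longrightarrow> rt m q \<Longrightarrow> x \<in> A \<Longrightarrow> sht m q x \<in> H"
  by (simp add: short_in_def)

lemma short_in_upper: assumes H: "normalised H" shows "short_in H (ideal_mult (upper_ideal F H) (pw 7))"
  unfolding short_in_def
proof (intro allI ballI impI)
  fix m q :: "'n idx" and x assume x: "x \<in> ideal_mult (upper_ideal F H) (pw 7)" and mq: "rt m q"
  from x show "sht m q x \<in> H"
  proof (induction rule: ideal_mult_induct)
    case (mult c a b)
    have "a \<in> colon H m q (pw 7)" using upper_ideal_extraction[OF H mq] mult by blast
    moreover have "c * b \<in> pw 7" using mult ideal_mult_left[OF pw_sub] by blast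
    ultimately have "sht m q (a * (c * b)) \<in> H" by (rule colonD)
    then show ?case by (simp add: mult_ac)
  next
    case (add x y)
      from H_mult[OF H add] show ?case using mq by (simp add: sht_add)
  qed (use H_one[OF H] in simp)
qed

section \<open>Long and extra short root elements\<close>

text \<open>The commutator formula for a short and an extra short root element.\<close>

lemma sht_ext_conj:
  fixes x :: 'a
  assumes ik: "rt i k" and b: "\<beta> \<in> D"
  defines "t \<equiv> x * cj (wt F (- k))"
  shows "sht i (- k) x ** ext k \<beta> ** iv (sht i (- k) x)
    = ext k \<beta> ** ext i (act \<beta> t) ** sht i k (snd \<beta> * t)"
proof -
  obtain b1 b2 where b12: "\<beta> = (b1, b2)" by fastforce
  note idx = rtD[OF ik]
  define g where "g = sht i (- k) x"
  have ug: "unitary g" using ik by (simp add: g_def)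
  have gk: "g *v axis k 1 = axis k 1 + axis i (cj t)" "g *v axis Zero b1 = axis Zero b1"
    using idx by (simp_all add: g_def sht_vec axis_nth_if neg_iff t_def)
  have D: "cj b1 * mu F * b1 = - b2 - cj b2 * lm" using D_eq' b b12 by blast
  have c: "g ** ext k \<beta> ** iv g = tv (axis k 1 + axis i (cj t)) (axis Zero b1) (cj b2)"
    using tv_conj'[OF ug, of "axis k 1" "axis Zero b1" "cj b2"] by (simp add: ext_def b12 gk)
  show ?thesis
    unfolding g_def[symmetric] c
  proof (rule matrix_eqI)
    fix w
    have E: "ext i (act \<beta> t) *v w' = w' + axis i (cj (b1 * t) * mu F * w' $ Zero + t * cj b2 * cj t * wt F i * w' $ (- i))
      - axis Zero (il * wt F i * w' $ (- i) * (b1 * t))" for w'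
      by (simp add: ext_vec b12 mult_ac)
    have "(ext k \<beta> ** ext i (act \<beta> t) ** sht i k (snd \<beta> * t)) *v w
      = ext k \<beta> *v (ext i (act \<beta> t) *v (sht i k (snd \<beta> * t) *v w))"
      by (simp flip: matrix_vector_mul_assoc)
    also have "\<dots> = tv (axis k 1 + axis i (cj t)) (axis Zero b1) (cj b2) *v w"
    proof -
      have "cj b2 = il * (cj b2 * lm)" by (simp add: mult.left_commute)
      also have "cj b2 * lm = - b2 - cj b1 * mu F * b1" using D by simp
      finally have cb2: "cj b2 = - (il * b2) - il * (cj b1 * mu F * b1)" by (simp add: algebra_simps)
      show ?thesis
        using idx by (simp add: vec_eq_iff E ext_vec sht_vec tv_vec b12 axis_nth_if neg_iff cb2 algebra_simps)
    qed
    finally show "tv (axis k 1 + axis i (cj t)) (axis Zero b1) (cj b2) *v w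
      = (ext k \<beta> ** ext i (act \<beta> t) ** sht i k (snd \<beta> * t)) *v w" by simp
  qed
qed

lemma H_conj_cancel:
  assumes H: "normalised H" and "a ** b \<in> H" "b \<in> H" "unitary a"
  shows "a \<in> H"
proof -
  have "(a ** b) ** iv b \<in> H" by (rule H_mult[OF H assms(2) H_iv[OF H assms(3)]])
  then show ?thesis using H_unitary[OF H assms(3)] by (simp flip: matrix_mul_assoc)
qed

text \<open>This lemma and the next one produce extra short root elements of \<open>H\<close> from the preceding commutator
  formula: here the coefficient of the short root element comes from \<open>H\<close>, in the next lemma that of the extra short
  one.  In both cases the resulting short root element is already known to lie in \<open>H\<close>.\<close>

lemma ext_from_sht:
  assumes H: "normalised H" and A: "ideal.subspace A" "short_in H A" and i: "i \<noteq> Zero" and a: "\<alpha> \<in> D"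
    and x: "x \<in> A" and b: "b \<in> I"
  shows "ext i (act \<alpha> (b * x)) \<in> H"
proof -
  obtain k where k: "k \<noteq> Zero" "apart k i" using ex_apart_three[OF card_n, of i i i] by blast
  then have ik: "rt i k" using i by (simp add: rt_def apart_sym)
  define g where "g = sht i (- k) (x * wt F (- k))"
  define \<beta> where "\<beta> = act \<alpha> b"
  define e where "e = ext k \<beta>"
  have bD: "\<beta> \<in> D" unfolding \<beta>_def by (rule D_act[OF a])
  have eE: "e \<in> E" unfolding e_def \<beta>_def using k a b by (intro E_ext)
  have gH: "g \<in> H" unfolding g_def using A ik x by (intro short_inD[OF A(2)] ideal_mult_right) auto
  have u: "unitary e" "unitary g" using E_unitary[OF eE] H_unitary[OF H gH] .
  have w: "x * wt F (- k) * cj (wt F (- k)) = x" using wt_cancel(2)[of "- k"] k by (simp add: mult.assoc)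
  have c: "g ** e ** iv g = e ** ext i (act \<beta> x) ** sht i k (snd \<beta> * x)"
    using sht_ext_conj[OF ik bD, of "x * wt F (- k)"] unfolding g_def e_def w .
  have "iv e ** (g ** e ** iv g ** iv e) ** e \<in> H"
    by (intro H_conj'[OF H eE] H_comm'[OF H eE gH])
  also have "iv e ** (g ** e ** iv g ** iv e) ** e = iv e ** (g ** e ** iv g)"
    using u by (simp flip: matrix_mul_assoc)
  also have "\<dots> = ext i (act \<beta> x) ** sht i k (snd \<beta> * x)"
    unfolding c using u by (simp flip: matrix_mul_assoc)
  finally have "ext i (act \<beta> x) ** sht i k (snd \<beta> * x) \<in> H" .
  then have "ext i (act \<beta> x) \<in> H"
    by (rule H_conj_cancel[OF H]) (use A x ik i D_act[OF bD] in \<open>auto intro: short_inD ideal_mult_left\<close>)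
  then show ?thesis by (simp add: \<beta>_def heis_act_act)
qed

lemma ext_move:
  assumes H: "normalised H" and A: "ideal.subspace A" "short_in H A" and ik: "rt i k" and bD: "\<beta> \<in> D"
    and eH: "ext k \<beta> \<in> H" and b2: "snd \<beta> \<in> A" and x: "x \<in> I"
  shows "ext i (act \<beta> x) \<in> H"
proof -
  have k: "k \<noteq> Zero" "i \<noteq> Zero" using rtD[OF ik] by auto
  define g where "g = sht i (- k) (x * wt F (- k))"
  define e where "e = ext k \<beta>"
  have gE: "g \<in> E" unfolding g_def using ik x by (intro E_sht I_mult) auto
  have eH: "e \<in> H" using eH by (simp add: e_def)
  have u: "unitary e" "unitary g" using E_unitary[OF gE] H_unitary[OF H eH] by auto
  have w: "x * wt F (- k) * cj (wt F (- k)) = x" using wt_cancel(2)[of "- k"] k by (simp add: mult.assoc)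
  have c: "g ** e ** iv g = e ** ext i (act \<beta> x) ** sht i k (snd \<beta> * x)"
    using sht_ext_conj[OF ik bD, of "x * wt F (- k)"] unfolding g_def e_def w .
  have "iv e ** (g ** e ** iv g) \<in> H"
    by (intro H_mult[OF H] H_iv[OF H] H_conj[OF H gE] eH)
  also have "iv e ** (g ** e ** iv g) = ext i (act \<beta> x) ** sht i k (snd \<beta> * x)"
    unfolding c using u by (simp flip: matrix_mul_assoc)
  finally have "ext i (act \<beta> x) ** sht i k (snd \<beta> * x) \<in> H" .
  then show ?thesis
    by (rule H_conj_cancel[OF H]) (use A b2 ik k D_act[OF bD] in \<open>auto intro: short_inD ideal_mult_right\<close>)
qed

lemma ext_mult_H:
  assumes H: "normalised H" and "i \<noteq> Zero" "ext i \<alpha> \<in> H" "ext i \<beta> \<in> H"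
  shows "ext i (\<alpha> \<dotplus> \<beta>) \<in> H"
  using H_mult[OF H assms(4,3)] assms(2) by (simp add: ext_mult)

lemma ext_inv_H:
  assumes H: "normalised H" and "i \<noteq> Zero" "ext i \<alpha> \<in> H" "\<alpha> \<in> D"
  shows "ext i (\<dotminus> \<alpha>) \<in> H"
  using H_iv[OF H assms(3)] assms(2,4) by (simp add: ext_iv)

lemma ext_zero_H: "normalised H \<Longrightarrow> ext i (0, 0) \<in> H"
proof -
  have "ext i (0, 0) = mat 1"
    by (rule matrix_eqI) (simp add: ext_vec)
  then show "normalised H \<Longrightarrow> ext i (0, 0) \<in> H" by (simp add: H_one)
qed

text \<open>The commutator of short root elements in positions \<open>(i, j)\<close> and \<open>(i, - j)\<close> is a long root element.\<close>

lemma long_extraction: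
  assumes H: "normalised H" and A: "invariant_ideal F A" "short_in H A" and i: "i \<noteq> Zero"
    and z: "z \<in> ideal_mult A I"
  shows "ext i (trc z) \<in> H"
  using z
proof (induction rule: ideal_mult_induct)
  case (mult c a b)
  obtain j where j: "j \<noteq> Zero" "apart j i" using ex_apart_three[OF card_n, of i i i] by blast
  then have ij: "rt i j" using i by (simp add: rt_def apart_sym)
  define g where "g = sht i j (cj (c * a) * wt F j)"
  define e where "e = sht i (- j) b"
  have gH: "g \<in> H" unfolding g_def using mult A(1) ij
    by (intro short_inD[OF A(2)] ideal_mult_right inv_ideal_cj ideal_mult_left inv_ideal_sub)
  have eE: "e \<in> E" unfolding e_def using ij mult by (intro E_sht) auto
  have u: "unitary e" "unitary g" using E_unitary[OF eE] H_unitary[OF H gH] .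
  have w: "c * a * cj (wt F j) * wt F j * b = c * a * b" using wt_cancel(1)[OF j(1)] by (simp add: mult_ac)
  have g: "g *v axis i 1 = axis i 1" "g *v axis (- j) b = axis (- j) b + axis i (c * (a * b))"
    using rtD[OF ij] w by (simp_all add: g_def sht_vec axis_nth_if neg_iff) (simp add: mult_ac)
  have ge: "g ** e ** iv g = mat 1 + sk (axis i 1) (axis (- j) b + axis i (c * (a * b)))"
    using tv_conj'[OF u(2), of "axis i 1" "axis (- j) b" 0] by (simp add: e_def sht_def g)
  have ie: "iv e = mat 1 + sk (axis i 1) (axis (- j) (- b))"
    unfolding e_def using ij by simp (simp add: sht_def)
  have "g ** e ** iv g ** iv e \<in> H" by (rule H_comm'[OF H eE gH])
  also have "g ** e ** iv g ** iv e = mat 1 + sk (axis i 1) (axis i (c * (a * b)))"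
    unfolding ge ie using rtD[OF ij]
    by (simp add: matrix_mult_linear sk_sk_zero axis_nth_if sk_linear neg_iff flip: axis_uminus)
  finally show ?case by (simp add: long_sk)
next
  case (add x y)
  from ext_mult_H[OF H i add] show ?case by (simp add: algebra_simps)
qed (simp add: ext_zero_H[OF H])

text \<open>Products come from \<open>ext_from_sht\<close>; sums need a trace, which is supplied by \<open>long_extraction\<close>.\<close>

lemma Delta_extraction:
  assumes H: "normalised H" and A: "invariant_ideal F A" "short_in H A" and i: "i \<noteq> Zero" and a: "\<alpha> \<in> D"
    and z: "z \<in> ideal_mult A I"
  shows "ext i (act \<alpha> z) \<in> H"
proof -
  have "z \<in> ideal_mult A I \<and> ext i (act \<alpha> z) \<in> H"
    using z
  proof (induction rule: ideal_mult_induct)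
    case (mult c x b)
    have "ext i (act \<alpha> (b * (c * x))) \<in> H"
      using A mult by (intro ext_from_sht[OF H _ _ i a] ideal_mult_left inv_ideal_sub)
    moreover have "c * (x * b) \<in> ideal_mult A I"
      using mult by (intro ideal_mult_left[OF ideal_mult_subspace] ideal_mult_in)
    ultimately show ?case by (simp add: mult_ac)
  next
    case (add x y)
    have w: "cj y * x * snd \<alpha> \<in> ideal_mult A I"
      using add by (intro ideal_mult_right[OF ideal_mult_subspace] ideal_mult_left[OF ideal_mult_subspace]) auto
    have "ext i (act \<alpha> (x + y)) \<in> H"
      unfolding heis_act_add[OF a]
      using add by (intro ext_mult_H[OF H i] long_extraction[OF H A i w]) auto
    then show ?case using add by (auto intro: ideal.subspace_add[OF ideal_mult_subspace])
  next
    case zero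
    have "act \<alpha> 0 = (0, 0)" by (cases \<alpha>) simp
    then show ?case using ext_zero_H[OF H] ideal.subspace_0[OF ideal_mult_subspace] by simp
  qed
  then show ?thesis ..
qed

end

context hermitian_forms
begin

text \<open>The conditions that define the ideal of the upper level, for a single matrix.\<close>

definition ideal_level :: "'a set \<Rightarrow> ('a, 'n::finite) matrix \<Rightarrow> bool" where
  "ideal_level J \<sigma> \<longleftrightarrow>
     (\<forall>i j. i \<noteq> Zero \<longrightarrow> j \<noteq> Zero \<longrightarrow> i \<noteq> j \<longrightarrow> \<sigma> $ i $ j \<in> J \<and> \<sigma> $ i $ i - \<sigma> $ j $ j \<in> J) \<and>
     (\<forall>i. \<forall>y\<in>JD. i \<noteq> Zero \<longrightarrow> \<sigma> $ i $ Zero * y \<in> J \<and> cj y * mu F * \<sigma> $ Zero $ i \<in> J \<and>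
        (\<forall>z\<in>JD. cj y * mu F * (\<sigma> $ Zero $ Zero - \<sigma> $ i $ i) * z \<in> J))"

lemma upper_gens_level: "upper_gens F H \<subseteq> J \<longleftrightarrow> (\<forall>\<sigma>\<in>H. ideal_level J \<sigma>)"
proof
  assume s: "upper_gens F H \<subseteq> J"
  show "\<forall>\<sigma>\<in>H. ideal_level J \<sigma>"
    unfolding ideal_level_def by (intro ballI conjI allI impI; rule subsetD[OF s]; simp add: upper_gens_def; blast)
next
  assume "\<forall>\<sigma>\<in>H. ideal_level J \<sigma>"
  then show "upper_gens F H \<subseteq> J" unfolding upper_gens_def ideal_level_def by auto
qed

lemma upper_ideal_inv: "invariant_ideal F (upper_ideal F H)"
proof -
  have "cj x \<in> upper_ideal F H" if "x \<in> upper_ideal F H" for x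
    using that unfolding upper_ideal_def
  proof (induction rule: ideal.span_induct_alt)
    case base then show ?case using ideal.span_zero by simp
  next
    case (step c x y)
    then have "cj x \<in> upper_gens F H \<union> cj ` upper_gens F H" by auto
    then have "cj c * cj x \<in> ideal.span (upper_gens F H \<union> cj ` upper_gens F H)"
      by (intro ideal.span_scale ideal.span_base)
    with step show ?case by (auto intro: ideal.span_add)
  qed
  then show ?thesis by (simp add: invariant_ideal_def upper_ideal_def)
qed

lemma upper_ideal_level: "\<sigma> \<in> H \<Longrightarrow> ideal_level (upper_ideal F H) \<sigma>"
  using upper_gens_level[of H "upper_ideal F H"] ideal.span_superset[of "upper_gens F H \<union> cj ` upper_gens F H"]
  by (auto simp: upper_ideal_def)

lemma upper_ideal_minimal:
  assumes "invariant_ideal F J" "\<And>\<sigma>. \<sigma> \<in> H \<Longrightarrow> ideal_level J \<sigma>"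
  shows "upper_ideal F H \<subseteq> J"
proof -
  have "upper_gens F H \<subseteq> J" using assms(2) by (simp add: upper_gens_level)
  then show ?thesis unfolding upper_ideal_def
    using assms(1) by (intro ideal.span_minimal) (auto simp: invariant_ideal_def)
qed

lemma ideal_level_off: "ideal_level J \<sigma> \<Longrightarrow> i \<noteq> Zero \<Longrightarrow> j \<noteq> Zero \<Longrightarrow> i \<noteq> j \<Longrightarrow> \<sigma> $ i $ j \<in> J"
  and ideal_level_column: "ideal_level J \<sigma> \<Longrightarrow> i \<noteq> Zero \<Longrightarrow> y \<in> JD \<Longrightarrow> \<sigma> $ i $ Zero * y \<in> J"
  and ideal_level_row: "ideal_level J \<sigma> \<Longrightarrow> i \<noteq> Zero \<Longrightarrow> y \<in> JD \<Longrightarrow> cj y * mu F * \<sigma> $ Zero $ i \<in> J"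
  and ideal_level_zero: "ideal_level J \<sigma> \<Longrightarrow> i \<noteq> Zero \<Longrightarrow> y \<in> JD \<Longrightarrow> z \<in> JD \<Longrightarrow> cj y * mu F * (\<sigma> $ Zero $ Zero - \<sigma> $ i $ i) * z \<in> J"
  by (auto simp: ideal_level_def)

lemma ideal_level_diag: "ideal_level J \<sigma> \<Longrightarrow> ideal.subspace J \<Longrightarrow> i \<noteq> Zero \<Longrightarrow> j \<noteq> Zero \<Longrightarrow> \<sigma> $ i $ i - \<sigma> $ j $ j \<in> J"
  using ideal.subspace_0[of J] by (cases "i = j") (auto simp: ideal_level_def)

text \<open>The form takes a unit as value on the columns \<open>j\<close> and \<open>- j\<close>, and all summands except the one with
  the two diagonal entries lie in \<open>J\<close>.  The diagonal entries agree modulo \<open>J\<close>, so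
  this determines all products of a conjugate diagonal entry with another one.\<close>

lemma ideal_level_norm:
  assumes l: "ideal_level J \<sigma>" and J: "invariant_ideal F J" and u: "unitary \<sigma>" and j: "j \<noteq> Zero" and p: "p \<noteq> Zero"
  shows "cj (\<sigma> $ j $ j) * \<sigma> $ p $ p - 1 \<in> J"
proof -
  note Js = inv_ideal_sub[OF J]
  define T where "T = (\<lambda>k. cj (\<sigma> $ k $ j) * wt F k * \<sigma> $ (- k) $ (- j))"
  have "(\<Sum>k\<in>UNIV. T k) = B (\<sigma> *v axis j 1) (\<sigma> *v axis (- j) 1)"
    by (simp add: B_eq_sum T_def matrix_vector_axis)
  also have "\<dots> = wt F j" using u by (simp add: unitary_B axis_nth_if)
  finally have sum: "T j + (\<Sum>k\<in>UNIV - {j}. T k) = wt F j"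
    by (simp add: sum.remove[of UNIV j])
  have "T k \<in> J" if "k \<noteq> j" for k
  proof (cases "k = Zero")
    case True
    have "cj (\<sigma> $ Zero $ j) * mu F * \<sigma> $ Zero $ (- j) \<in> J"
      by (rule ideal_level_row[OF l]) (use j u unitary_JD in auto)
    then show ?thesis using True by (simp add: T_def)
  next
    case False
    have "cj (\<sigma> $ k $ j) \<in> J" using ideal_level_off[OF l False j that] J by (rule inv_ideal_cj[rotated])
    then show ?thesis unfolding T_def by (intro ideal_mult_right[OF Js])
  qed
  then have "(\<Sum>k\<in>UNIV - {j}. T k) \<in> J" by (intro ideal.subspace_sum[OF Js]) auto
  moreover have "T j - wt F j = - (\<Sum>k\<in>UNIV - {j}. T k)" using sum by (simp add: algebra_simps)
  ultimately have "T j - wt F j \<in> J" using ideal.subspace_neg[OF Js] by simp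
  then have "(T j - wt F j) * cj (wt F j) \<in> J" by (rule ideal_mult_right[OF Js])
  also have "(T j - wt F j) * cj (wt F j) = (cj (\<sigma> $ j $ j) * \<sigma> $ (- j) $ (- j) - 1) * (wt F j * cj (wt F j))"
    by (simp add: T_def algebra_simps)
  finally have 1: "cj (\<sigma> $ j $ j) * \<sigma> $ (- j) $ (- j) - 1 \<in> J" using j by simp
  have 2: "cj (\<sigma> $ j $ j) * (\<sigma> $ p $ p - \<sigma> $ (- j) $ (- j)) \<in> J"
    by (intro ideal_mult_left[OF Js] ideal_level_diag[OF l Js]) (use p j in auto)
  from ideal.subspace_add[OF Js 1 2] show ?thesis by (simp add: algebra_simps)
qed

text \<open>\<open>Q\<close> is a quadratic map with values in the Heisenberg group.\<close>

lemma Q_add: "Q (x + y) = Q x \<dotplus> Q y \<dotplus> (0, B x y + (pr x y - cj (pr x y) * lm))"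
  using B_pr[of x y] by (simp add: Q_eq pr_linear algebra_simps)

lemma Q_scale: "Q (c *s x) = act (Q x) c"
  by (simp add: Q_eq pr_linear algebra_simps)

lemma Q_unitary_D:
  assumes "unitary \<sigma>" "Q v = (0, 0)" shows "Q (\<sigma> *v v) \<in> D"
proof -
  have "heis_minus F (Q (\<sigma> *v v)) (Q v) = Q (\<sigma> *v v)"
    unfolding assms(2) by (cases "Q (\<sigma> *v v)") simp
  with unitary_Q[OF assms(1), of v] show ?thesis by simp
qed

lemma Q_axis: "i \<noteq> Zero \<Longrightarrow> Q (axis i x) = (0, 0)"
  by (simp add: Q_eq axis_nth_if)

lemma pr_ideal:
  assumes A: "invariant_ideal F A" and "(\<forall>i. i \<noteq> Zero \<longrightarrow> u $ i \<in> A) \<or> (\<forall>i. i \<noteq> Zero \<longrightarrow> v $ i \<in> A)"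
  shows "pr u v \<in> A"
proof -
  note As = inv_ideal_sub[OF A]
  have "cj (v $ i) * u $ (- i) \<in> A" if "i \<in> range Pos" for i
    using assms(2)
  proof
    assume "\<forall>i. i \<noteq> Zero \<longrightarrow> u $ i \<in> A"
    then have "u $ (- i) \<in> A" using that by auto
    then show ?thesis by (rule ideal_mult_left[OF As])
  next
    assume "\<forall>i. i \<noteq> Zero \<longrightarrow> v $ i \<in> A"
    then have "cj (v $ i) \<in> A" using that A by (auto intro: inv_ideal_cj)
    then show ?thesis by (rule ideal_mult_right[OF As])
  qed
  then show ?thesis unfolding pr_def by (intro ideal.subspace_sum[OF As])
qed

end

context relative_level
begin

lemma ideal_mult_power_Suc:
  assumes J: "ideal.subspace J"
  shows "ideal_mult J (pw (Suc k)) \<subseteq> ideal_mult (ideal_mult J (pw k)) I"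
proof
  fix x assume "x \<in> ideal_mult J (pw (Suc k))"
  then show "x \<in> ideal_mult (ideal_mult J (pw k)) I"
  proof (induction rule: ideal_mult_induct)
    case (mult c j y)
    from I_inv mult(2) show ?case
    proof (induction rule: ideal_power_Suc_induct)
      case (mult a z)
      have "c * ((j * z) * a) \<in> ideal_mult (ideal_mult J (pw k)) I"
        using mult \<open>j \<in> J\<close> by (intro ideal_mult_left[OF ideal_mult_subspace] ideal_mult_in)
      then show ?case by (simp add: mult_ac)
    qed (auto simp: distrib_left intro: ideal.subspace_add ideal.subspace_0 ideal_mult_subspace)
  qed (auto intro: ideal.subspace_add ideal.subspace_0 ideal_mult_subspace)
qed

section \<open>Columns as coefficients of extra short root elements\<close>

lemma ext_strip:
  assumes H: "normalised H" and i: "i \<noteq> Zero" and "ext i (\<alpha> \<dotplus> \<beta>) \<in> H" "ext i \<beta> \<in> H" "\<beta> \<in> D"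
  shows "ext i \<alpha> \<in> H"
proof -
  have "ext i ((\<alpha> \<dotplus> \<beta>) \<dotplus> \<dotminus> \<beta>) \<in> H"
    by (rule ext_mult_H[OF H i assms(3) ext_inv_H[OF H i assms(4,5)]])
  also have "(\<alpha> \<dotplus> \<beta>) \<dotplus> \<dotminus> \<beta> = \<alpha>"
    by (simp add: heis.m_assoc heis.r_inv del: heis_one)
  finally show ?thesis .
qed

text \<open>An element of the unipotent radical at the basis vector \<open>l\<close> whose hyperbolic coordinates are
  coefficients of root elements of \<open>H\<close> can be stripped of these coordinates one after the other.  Only its extra short
  part remains.\<close>

lemma radical_extraction:
  assumes H: "normalised H" and l: "l \<noteq> Zero" and A: "invariant_ideal F A" "short_in H A"
    and long: "\<And>z. z \<in> A \<Longrightarrow> ext l (trc z) \<in> H"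
    and h: "tv (axis l 1) v y \<in> H" and vl: "v $ (- l) = 0" and v: "\<And>q. q \<noteq> Zero \<Longrightarrow> v $ q \<in> A"
  shows "ext l (v $ Zero, pr v v + cj y) \<in> H"
proof -
  define f :: "('a, 'n) column" where "f = axis l 1"
  note As = inv_ideal_sub[OF A(1)]
  have "ext l (v $ Zero, pr v v + cj y) \<in> H"
    if "card {q. q \<noteq> Zero \<and> v $ q \<noteq> 0} = k" "tv f v y \<in> H" "v $ (- l) = 0" "\<And>q. q \<noteq> Zero \<Longrightarrow> v $ q \<in> A" for v y k
    using that
  proof (induction k arbitrary: v y)
    case 0
    then have "v = axis Zero (v $ Zero)" by (auto simp: vec_eq_iff axis_nth_if)
    then obtain x where v: "v = axis Zero x" by blast
    then show ?case using 0(2) by (simp add: ext_def f_def axis_nth_if)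
  next
    case (Suc k)
    then have "{q. q \<noteq> Zero \<and> v $ q \<noteq> 0} \<noteq> {}" by (metis card.empty nat.simps(3))
    then obtain q where q: "q \<noteq> Zero" "v $ q \<noteq> 0" by blast
    have ql: "q \<noteq> - l" using q Suc.prems(3) by auto
    have ff: "B f f = 0" "B f v = 0" "B f (axis q x) = 0" for x
      using l ql Suc.prems(3) by (auto simp: f_def axis_nth_if)
    define c where "c = axis q (- v $ q)"
    have vq: "- v $ q \<in> A" using Suc.prems(4)[OF q(1)] ideal.subspace_neg[OF As] by simp
    have "tv f c 0 \<in> H"
    proof (cases "q = l")
      case True
      then show ?thesis using long[OF vq] long_sk[of l 1 "- v $ q"] by (simp add: c_def f_def)
    next
      case False
      then have "rt l q" using ql l q by (auto simp: rt_def apart_def)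
      from short_inD[OF A(2) this vq] show ?thesis by (simp add: sht_def c_def f_def)
    qed
    with Suc.prems(2) have "tv f v y ** tv f c 0 \<in> H" by (rule H_mult[OF H])
    then have h': "tv f (v + c) (y - il * B v c) \<in> H"
      using ff unfolding c_def by (simp add: tv_mult del: tv_zero)
    have "{k. k \<noteq> Zero \<and> (v + c) $ k \<noteq> 0} = {k. k \<noteq> Zero \<and> v $ k \<noteq> 0} - {q}"
      by (auto simp: c_def axis_nth_if)
    then have "card {k. k \<noteq> Zero \<and> (v + c) $ k \<noteq> 0} = k" using Suc.prems(1) q by simp
    from Suc.IH[OF this h'] have IH: "ext l ((v + c) $ Zero, pr (v + c) (v + c) + cj (y - il * B v c)) \<in> H"
      using Suc.prems(3,4) q ql ideal.subspace_0[OF As] by (auto simp: c_def axis_nth_if)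
    define z where "z = - pr c v"
    have z: "z \<in> A"
      unfolding z_def c_def pr_axis_left
      using vq Suc.prems(4)[OF q(1)] by (auto intro!: ideal.subspace_neg[OF As] ideal_mult_left[OF As] ideal.subspace_0[OF As])
    have "lm * cj (B v c) = B c v" using B_swap[of c v] by simp
    then have "cj (il * B v c) = pr v c + lm * cj (pr c v)"
      using q B_pr[of c v] by (simp add: c_def axis_nth_if del: B_axis_left B_axis_right)
    then have e: "(v $ Zero, pr v v + cj y) = ((v + c) $ Zero, pr (v + c) (v + c) + cj (y - il * B v c)) \<dotplus> trc z"
      using q by (simp add: z_def pr_linear axis_nth_if c_def algebra_simps del: B_axis_left B_axis_right)
    show ?case unfolding e by (rule ext_mult_H[OF H l IH long[OF z]])
  qed
  then show ?thesis using h vl v by (auto simp: f_def)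
qed

context
  fixes H :: "('a, 'n) matrix set"
  assumes H: "normalised H"
begin

text \<open>The ideal \<open>J I\<^sup>7 I\<close> of coefficients for which short, long and extra short root elements of \<open>H\<close> are
  available, where \<open>J\<close> is the ideal of the upper level.\<close>

definition "known = ideal_mult (ideal_mult (upper_ideal F H) (pw 7)) I"

lemma known_inv: "invariant_ideal F known"
  unfolding known_def by (intro ideal_mult_inv upper_ideal_inv pw_inv I_inv)

lemma known_sub: "ideal.subspace known" using known_inv by (rule inv_ideal_sub)

lemma known_sub_upper: "known \<subseteq> ideal_mult (upper_ideal F H) (pw 7)"
  unfolding known_def by (rule ideal_mult_sub_left[OF ideal_mult_subspace])

lemma known_short_in: "short_in H known"
  using short_in_upper[OF H] known_sub_upper by (auto simp: short_in_def)

lemma known_long: "z \<in> known \<Longrightarrow> k \<noteq> Zero \<Longrightarrow> ext k (trc z) \<in> H"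
  unfolding known_def by (rule long_extraction[OF H _ short_in_upper[OF H]]) (intro ideal_mult_inv upper_ideal_inv pw_inv)

lemma known_Delta: "z \<in> known \<Longrightarrow> k \<noteq> Zero \<Longrightarrow> \<alpha> \<in> D \<Longrightarrow> ext k (act \<alpha> z) \<in> H"
  unfolding known_def by (rule Delta_extraction[OF H _ short_in_upper[OF H]]) (intro ideal_mult_inv upper_ideal_inv pw_inv)

lemma upper_known: assumes "x \<in> upper_ideal F H" "y \<in> pw k" "8 \<le> k" shows "x * y \<in> known" "y * x \<in> known"
proof -
  have "y \<in> pw (Suc 7)" using assms pw_mono[of 8 k] by auto
  then have "x * y \<in> ideal_mult (upper_ideal F H) (pw (Suc 7))" using assms(1) by (intro ideal_mult_in)
  then show "x * y \<in> known" "y * x \<in> known"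
    using ideal_mult_power_Suc[OF upper_ideal_sub, of H 7] by (auto simp: known_def mult.commute)
qed

text \<open>The elements of the form parameter that \<open>H\<close> realises at every index.\<close>

definition ext_in :: "('a \<times> 'a) set" where
  "ext_in = {\<alpha> \<in> D. \<forall>k. k \<noteq> Zero \<longrightarrow> ext k \<alpha> \<in> H}"

lemma ext_in_subgroup: "subgroup ext_in HG"
proof (rule heis.subgroupI)
  have "(0, 0) \<in> ext_in" using ext_zero_H[OF H] D_zero by (auto simp: ext_in_def)
  then show "ext_in \<noteq> {}" by blast
qed (auto simp: ext_in_def D_mult D_inv ext_mult_H[OF H] ext_inv_H[OF H] simp del: heis_mult heis_inv)

lemma ext_in_mult: "\<alpha> \<in> ext_in \<Longrightarrow> \<beta> \<in> ext_in \<Longrightarrow> \<alpha> \<dotplus> \<beta> \<in> ext_in"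
  by (rule subgroup.m_closed[OF ext_in_subgroup])

lemma ext_in_trc: "z \<in> known \<Longrightarrow> trc z \<in> ext_in"
  unfolding ext_in_def using known_long D_long by blast

lemma ext_in_Delta: "z \<in> known \<Longrightarrow> \<alpha> \<in> D \<Longrightarrow> act \<alpha> z \<in> ext_in"
  unfolding ext_in_def using known_Delta D_act by blast

end

text \<open>The basic extraction once more, with \<open>t'\<close> in position \<open>(- i, - j)\<close>.  The transvection \<open>t\<close> is now chosen
  with a coefficient \<open>a\<close> from \<open>I\<^sup>8\<close>, so that all its factors except \<open>t0\<close> lie in \<open>H\<close>, and \<open>t\<close> may be replaced by \<open>t0\<close> in the first
  factor of \<open>extract_conj\<close>.
  The resulting element \<open>h\<close> of \<open>H\<close> is a transvection in the direction \<open>f\<close> whose hyperbolic coordinates are known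
  coefficients; by \<open>radical_extraction\<close> its extra short part \<open>Q (- X)\<close> remains.  Here \<open>X\<close> differs from a basis vector by
  \<open>T (\<sigma> u)\<close> and a known term, and \<open>\<sigma> u\<close> is \<open>\<sigma>\<^sub>i\<^sub>i\<close> times column \<open>p\<close> up to a known multiple of another column.
  The coefficient \<open>a\<close> is chosen such that the resulting factor is \<open>a0 * b\<close> modulo known terms.\<close>

lemma column_extraction:
  assumes H: "normalised H" and s: "\<sigma> \<in> H" and ip: "rt i p" and a0: "a0 \<in> pw 8" and b: "b \<in> I"
  shows "ext (- i) (act (Q (\<sigma> *v axis p 1)) (a0 * b)) \<in> H"
proof -
  define J where "J = upper_ideal F H"
  define K where "K = known H"
  have Jinv: "invariant_ideal F J" unfolding J_def by (rule upper_ideal_inv)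
  have Kinv: "invariant_ideal F K" unfolding K_def by (rule known_inv[OF H])
  note Js = inv_ideal_sub[OF Jinv] and Ks = inv_ideal_sub[OF Kinv]
  have gK: "short_in H K" unfolding K_def by (rule known_short_in[OF H])
  have long: "ext l (trc z) \<in> H" if "z \<in> K" "l \<noteq> Zero" for z l
    using that known_long[OF H] by (simp add: K_def)
  have Delta: "ext l (act \<alpha> z) \<in> H" if "z \<in> K" "l \<noteq> Zero" "\<alpha> \<in> D" for \<alpha> z l
    using that known_Delta[OF H] by (simp add: K_def)
  have JA: "x * y \<in> K" "y * x \<in> K" if "x \<in> J" "y \<in> pw 8" for x y
    using that upper_known[OF H, of x y 8] by (simp_all add: J_def K_def)
  have l: "ideal_level J \<sigma>" unfolding J_def using s by (rule upper_ideal_level)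
  have us: "unitary \<sigma>" using H s by (rule H_unitary)
  obtain j where j: "j \<noteq> Zero" "apart j i" "apart j p"
    using ex_apart_three[OF card_n, of i p p] by blast
  have ij: "rt i j" and jp: "rt j p" using j ip by (auto simp: rt_def apart_sym)
  note idx = rtD[OF ij] rtD[OF ip] rtD[OF jp]
  note ev = axis_nth_if idx neg_iff
  define f :: "('a, 'n) column" where "f = axis (- i) 1"
  define sj where "sj = \<sigma> $ i $ j"
  define si where "si = \<sigma> $ i $ i"
  define sp where "sp = \<sigma> $ i $ p"
  \<comment> \<open>compensates the factor of column \<open>p\<close>, since diagonal entries have norm one modulo \<open>J\<close>\<close>
  define a where "a = cj (- a0 * \<sigma> $ j $ j * cj (wt F j))"
  have aP: "a \<in> pw 8" "cj a \<in> pw 8"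
    unfolding a_def using a0
    by (auto intro!: inv_ideal_cj[OF pw_inv] ideal_mult_right[OF pw_sub] ideal.subspace_neg[OF pw_sub] simp del: cj_mult cj_minus)
  have aI: "a \<in> I"
    using aP(1) ideal_mult_sub_left[OF I_sub] by (force simp: eval_nat_numeral)
  have sJ: "sj \<in> J" "sp \<in> J"
    unfolding sj_def sp_def using idx by (auto intro!: ideal_level_off[OF l])
  define u where "u = axis i (- sp) + axis p si"
  define v' where "v' = axis i (- sj) + axis j si"
  define v where "v = a *s v'"
  have v: "v = axis i (- (sj * a)) + axis j (si * a)"
    by (simp add: v_def v'_def vector_add_ldistrib axis_scale mult.commute)
  \<comment> \<open>the only factor of \<open>t\<close> without an off-diagonal entry of \<open>\<sigma>\<close>\<close>
  define t0 where "t0 = mat 1 + sk (axis p si) (axis j (si * a))"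
  define t1 where "t1 = (mat 1 + sk (axis i (- sp)) (axis i (- (sj * a)))) ** (mat 1 + sk (axis i (- sp)) (axis j (si * a)))
      ** (mat 1 + sk (axis p si) (axis i (- (sj * a))))"
  define t where "t = t0 ** t1"
  have t_eq: "t = mat 1 + sk u v"
    by (simp add: t_def t0_def t1_def u_def v sk_add_left sk_add_right matrix_mult_linear sk_sk_zero ev)
  have IN: "- (x * y) \<in> I" if "y \<in> I" for x y
    using that by (intro ideal.subspace_neg[OF I_sub] I_mult)
  have t0E: "t0 \<in> E" unfolding t0_def sht_sk using aI jp by (auto simp: rt_sym intro!: E_sht I_mult)
  have t1E: "t1 \<in> E"
    unfolding t1_def
  proof (intro E_mult)
    show "mat 1 + sk (axis i (- sp)) (axis i (- (sj * a))) \<in> E"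
      unfolding long_sk using aI by (intro E_long) (auto simp: idx intro!: I_mult)
    show "mat 1 + sk (axis i (- sp)) (axis j (si * a)) \<in> E" "mat 1 + sk (axis p si) (axis i (- (sj * a))) \<in> E"
      unfolding sht_sk using aI ij ip by (auto simp: rt_sym intro!: E_sht I_mult IN)
  qed
  have t1H: "t1 \<in> H"
    unfolding t1_def
  proof (intro H_mult[OF H])
    have 1: "cj (- sp) * - (sj * a) \<in> K"
      using JA(1)[OF sJ(1) aP(1)] by (simp add: ideal_mult_left[OF Ks])
    show "mat 1 + sk (axis i (- sp)) (axis i (- (sj * a))) \<in> H"
      unfolding long_sk by (intro long 1) (simp add: idx)
    have "cj (- sp) * (si * a) = (cj (- sp) * a) * si" by (simp add: mult_ac)
    also have "\<dots> \<in> K"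
      by (intro ideal_mult_right[OF Ks] JA(1) aP inv_ideal_cj[OF Jinv] ideal.subspace_neg[OF Js] sJ)
    finally show "mat 1 + sk (axis i (- sp)) (axis j (si * a)) \<in> H"
      unfolding sht_sk using ij by (intro short_inD[OF gK])
    have "cj si * - (sj * a) \<in> K"
      by (intro ideal_mult_left[OF Ks] ideal.subspace_neg[OF Ks] JA(1) sJ aP)
    then show "mat 1 + sk (axis p si) (axis i (- (sj * a))) \<in> H"
      unfolding sht_sk using ip by (intro short_inD[OF gK]) (simp_all add: rt_sym)
  qed
  have tE: "t \<in> E" unfolding t_def by (intro E_mult t0E t1E)
  define x :: "('a, 'n) column" where "x = axis (- j) b"
  define t' where "t' = sht (- i) (- j) b"
  have t'E: "t' \<in> E" unfolding t'_def using ij b by (intro E_sht) auto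
  note ut = E_unitary[OF tE] E_unitary[OF t'E] E_unitary[OF t0E] E_unitary[OF t1E]
  define \<xi> where "\<xi> = \<sigma> ** t ** iv \<sigma>"
  have ux: "unitary \<xi>" unfolding \<xi>_def using us ut by (simp add: unitary_mult)
  have ivt': "iv t' = tv f (- x) 0"
  proof -
    have "iv t' = sht (- i) (- j) (- b)"
      unfolding t'_def using ij by (intro sht_iv) simp
    then show ?thesis by (simp add: sht_def f_def x_def axis_uminus)
  qed
  have \<xi>_eq: "\<xi> = mat 1 + sk (\<sigma> *v u) (\<sigma> *v v)"
    unfolding \<xi>_def t_eq using us by (simp add: matrix_mult_linear sk_conj')
  define su where "su = \<sigma> *v u"
  define sv' where "sv' = \<sigma> *v v'"
  have sv: "\<sigma> *v v = a *s sv'" by (simp add: v_def sv'_def mv_linear)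
  have su_nth: "su $ k = si * \<sigma> $ k $ p - sp * \<sigma> $ k $ i" and sv'_nth: "sv' $ k = si * \<sigma> $ k $ j - sj * \<sigma> $ k $ i" for k
    by (simp_all add: su_def sv'_def u_def v'_def mv_linear matrix_vector_axis mult.commute)
  have xf: "\<xi> *v f = f"
    by (simp add: \<xi>_eq mv_linear sk_vec sv) (simp add: f_def su_nth sv'_nth sj_def sp_def si_def flip: su_def)
  \<comment> \<open>\<open>extract_conj\<close> with \<open>t\<close> replaced by \<open>t0\<close> in the first factor\<close>
  define h where "h = (t0 ** t' ** iv t0) ** (\<xi> ** iv t' ** iv \<xi>)"
  have hH: "h \<in> H"
  proof -
    have 1: "(t ** t' ** iv t) ** (\<xi> ** iv t' ** iv \<xi>) \<in> H"
      unfolding \<xi>_def by (rule extract_conj[OF H s tE t'E])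
    have 2: "t0 ** (t1 ** t' ** iv t1 ** iv t') ** iv t0 \<in> H"
      by (intro H_conj[OF H t0E] H_comm'[OF H t'E t1H])
    have "h = iv (t0 ** (t1 ** t' ** iv t1 ** iv t') ** iv t0) ** ((t ** t' ** iv t) ** (\<xi> ** iv t' ** iv \<xi>))"
      unfolding h_def t_def using ut ux by (simp add: iv_prod unitary_mult flip: matrix_mul_assoc)
    then show ?thesis using H_mult[OF H H_iv[OF H 2] 1] by simp
  qed
  define \<tau>1 where "\<tau>1 = cj (si * a) * wt F j * b"
  define x' where "x' = x + axis p (si * \<tau>1)"
  have t0v: "t0 *v f = f" "t0 *v x = x'"
    by (simp_all add: t0_def mv_linear sk_vec f_def x_def x'_def ev axis_scale \<tau>1_def mult_ac)
  define X where "X = \<xi> *v x"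
  define V where "V = x' - X"
  have ff: "B f f = 0" "B f x' = 0" "B f X = 0" "B x' x' = 0"
    using unitary_B[OF ux, of f x] by (simp_all add: f_def x'_def x_def ev X_def xf[unfolded f_def])
  have h_eq: "h = tv f V (il * B x' X)"
  proof -
    have "h = tv f x' 0 ** tv f (- X) 0"
      unfolding h_def ivt' using tv_conj'[OF ut(3), of f x 0] tv_conj'[OF ux, of f "- x" 0]
      by (simp add: t'_def sht_def t0v xf mv_linear X_def flip: f_def x_def)
    then show ?thesis using ff by (simp add: tv_mult V_def del: tv_zero)
  qed
  define T where "T = cj (sv' $ j) * wt F j * b * cj a"
  define T' where "T' = il * (cj (su $ j) * wt F j * b)"
  have X_eq: "X = x + T *s su - (a * T') *s sv'"
    by (simp add: X_def \<xi>_eq mv_linear sk_vec sv flip: su_def)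
      (simp add: x_def T_def T'_def mult_ac vec_eq_iff)
  have suj: "su $ k \<in> J" if "k \<noteq> Zero" "k \<noteq> p" for k
    unfolding su_nth using that idx sJ
    by (intro ideal.subspace_diff[OF Js] ideal_mult_left[OF Js] ideal_mult_right[OF Js] ideal_level_off[OF l]) auto
  have T'J: "T' \<in> J"
    unfolding T'_def using idx by (intro ideal_mult_left[OF Js] ideal_mult_right[OF Js] inv_ideal_cj[OF Jinv] suj) auto
  have TP: "T \<in> pw 8" unfolding T_def by (intro ideal_mult_left[OF pw_sub] aP)
  have aT': "a * T' \<in> K" by (intro JA aP T'J)
  \<comment> \<open>modulo known coefficients, \<open>T\<close> is the conjugate diagonal entry times \<open>cj a\<close>\<close>
  have T_mod: "cj si * cj (\<sigma> $ j $ j) * wt F j * b * cj a - T \<in> K"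
  proof -
    have "cj si * cj (\<sigma> $ j $ j) * wt F j * b * cj a - T = (cj sj * (cj (\<sigma> $ j $ i) * wt F j * b)) * cj a"
      unfolding T_def sv'_nth by (simp add: algebra_simps)
    also have "\<dots> \<in> K" by (intro JA aP ideal_mult_right[OF Js] inv_ideal_cj[OF Jinv] sJ)
    finally show ?thesis .
  qed
  have VK: "V $ q \<in> K" if q: "q \<noteq> Zero" for q
  proof -
    have V: "V $ q = (if q = p then si * \<tau>1 else 0) - T * su $ q + (a * T') * sv' $ q"
      unfolding V_def X_eq x'_def by (simp add: axis_nth_if)
    have 1: "(if q = p then si * \<tau>1 else 0) - T * su $ q \<in> K"
    proof (cases "q = p")
      case False
      then show ?thesis using JA(2)[OF suj[OF q False] TP] ideal.subspace_neg[OF Ks] by auto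
    next
      case True
      define d where "d = 1 - cj (\<sigma> $ j $ j) * \<sigma> $ p $ p"
      have dJ: "d \<in> J"
        using ideal.subspace_neg[OF Js ideal_level_norm[OF l Jinv us, of j p]] idx by (simp add: d_def)
      have "si * \<tau>1 - T * su $ p = d * (cj a * (si * cj si * wt F j * b))
          + si * \<sigma> $ p $ p * (cj si * cj (\<sigma> $ j $ j) * wt F j * b * cj a - T) + (sp * T) * \<sigma> $ p $ i"
        unfolding \<tau>1_def su_nth d_def by (simp add: algebra_simps)
      also have "\<dots> \<in> K"
        by (intro ideal.subspace_add[OF Ks] JA(1) dJ ideal_mult_left[OF Ks] T_mod ideal_mult_right[OF Ks]
            ideal_mult_right[OF pw_sub] aP sJ TP)
      finally show ?thesis using True by simp
    qed
    show ?thesis unfolding V by (intro ideal.subspace_add[OF Ks] 1 ideal_mult_right[OF Ks] aT')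
  qed
  have i0: "- i \<noteq> Zero" using idx by simp
  have Vi: "V $ (- (- i)) = 0"
  proof -
    have "B f V = 0" using ff by (simp add: V_def)
    then have "cj (wt F (- i)) * (wt F (- i) * V $ (- (- i))) = 0" by (simp add: f_def)
    then show ?thesis using wt_cancel(1)[OF i0] by (simp flip: mult.assoc)
  qed
  have \<kappa>: "ext (- i) (V $ Zero, pr V V + cj (il * B x' X)) \<in> H"
    by (rule radical_extraction[OF H i0 Kinv gK long[OF _ i0] _ Vi VK])
      (use hH h_eq in \<open>simp_all add: f_def\<close>)
  note strip = ext_strip[OF H i0] and longi = long[OF _ i0]
  have tr: "z \<in> K \<Longrightarrow> ext (- i) (trc z) \<in> H \<and> trc z \<in> D" for z
    using longi D_long by blast
  define w where "w = pr V x'"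
  have wK: "w \<in> K" unfolding w_def by (rule pr_ideal[OF Kinv]) (use VK in blast)
  have x'0: "x' $ Zero = 0" "pr x' x' = 0"
    using idx by (auto simp: x'_def x_def axis_nth_if pr_linear pr_axis_left pr_axis_right neg_iff)
  have "lm * cj (B x' X) = pr x' X + lm * cj (pr X x')"
    using B_swap[of X x'] B_pr[of X x'] x'0 by simp
  then have "(V $ Zero, pr V V + cj (il * B x' X)) = Q (- X) \<dotplus> trc w"
    using x'0 by (simp add: Q_eq w_def V_def pr_linear algebra_simps)
  with \<kappa> have QX: "ext (- i) (Q (- X)) \<in> H" using strip tr[OF wK] by metis
  define y1 where "y1 = (- T) *s su"
  define y2 where "y2 = (a * T') *s sv'"
  define z where "z = T * cj T' + pr (- x) y1 + pr (- x + y1) y2"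
  have susv: "B su sv' = 0"
    unfolding su_def sv'_def unitary_B[OF us] by (simp add: u_def v'_def ev)
  have Bsu: "B x su = cj T'"
    using B_swap[of x su] by (simp add: T'_def x_def mult_ac)
  have Bsv: "a * B x sv' = lm * cj T"
    using B_swap[of x sv'] by (simp add: T_def x_def mult_ac)
  have zK: "z \<in> K"
  proof -
    have "y1 $ j \<in> K"
      unfolding y1_def using JA(2)[OF suj[of j] TP] idx ideal.subspace_neg[OF Ks] by auto
    then have "cj (y1 $ j) * b \<in> K" by (intro ideal_mult_right[OF Ks] inv_ideal_cj[OF Kinv])
    then have "pr x y1 \<in> K"
      unfolding x_def pr_axis_left using ideal.subspace_0[OF Ks] by simp
    then have "pr (- x) y1 \<in> K"
      unfolding pr_minus_left by (rule ideal.subspace_neg[OF Ks])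
    moreover have "pr (- x + y1) y2 \<in> K"
      by (rule pr_ideal[OF Kinv]) (auto simp: y2_def intro!: ideal_mult_right[OF Ks] aT')
    moreover have "T * cj T' \<in> K" by (intro JA TP inv_ideal_cj[OF Jinv] T'J)
    ultimately show ?thesis unfolding z_def by (intro ideal.subspace_add[OF Ks])
  qed
  have "Q (- X) = (Q y1 \<dotplus> Q y2) \<dotplus> trc z"
  proof -
    have e1: "- X = (- x + y1) + y2" by (simp add: X_eq y1_def y2_def vec_eq_iff)
    have e2: "Q (- x) = (0, 0)" using idx by (simp add: x_def axis_uminus Q_axis)
    have e3: "B (- x) y1 = T * cj T'" using Bsu by (simp add: y1_def)
    have e4: "B (- x + y1) y2 = - (T' * (lm * cj T))"
      using Bsv susv by (simp add: y1_def y2_def mult_ac)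
    obtain p1 q1 p2 q2 where q: "Q y1 = (p1, q1)" "Q y2 = (p2, q2)" by fastforce
    show ?thesis
      unfolding e1 Q_add[of "- x + y1" y2] Q_add[of "- x" y1] e2 e3 e4 q z_def
      by (simp add: algebra_simps)
  qed
  with QX have "ext (- i) (Q y1 \<dotplus> Q y2) \<in> H" using strip tr[OF zK] by metis
  moreover have "Q sv' \<in> D"
    unfolding sv'_def
    by (rule Q_unitary_D[OF us]) (use idx in \<open>simp add: v'_def Q_add Q_axis pr_axis_left axis_nth_if neg_iff\<close>)
  then have "ext (- i) (Q y2) \<in> H" "Q y2 \<in> D"
    unfolding y2_def Q_scale using Delta[OF aT' i0] D_act by auto
  ultimately have Qy1: "ext (- i) (Q y1) \<in> H" by (rule strip)
  define P where "P = \<sigma> *v axis p 1"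
  define N where "N = \<sigma> *v axis i 1"
  have PD: "Q P \<in> D" "Q N \<in> D" unfolding P_def N_def using idx by (auto intro!: Q_unitary_D[OF us] Q_axis)
  have TspA: "T * sp \<in> K" by (intro JA sJ TP)
  define z2 where "z2 = pr ((- T * si) *s P) ((T * sp) *s N)"
  have z2K: "z2 \<in> K" unfolding z2_def
    by (rule pr_ideal[OF Kinv]) (auto intro!: ideal_mult_right[OF Ks] TspA)
  have "y1 = (- T * si) *s P + (T * sp) *s N"
    by (simp add: y1_def vec_eq_iff su_nth P_def N_def matrix_vector_axis algebra_simps)
  moreover have "B P N = 0" unfolding P_def N_def unitary_B[OF us] using idx by (simp add: ev)
  ultimately have "Q y1 = act (Q P) (- T * si) \<dotplus> act (Q N) (T * sp) \<dotplus> trc z2"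
    by (simp only: Q_add B_scale_left B_scale_right z2_def) (simp add: Q_scale)
  with Qy1 have "ext (- i) (act (Q P) (- T * si) \<dotplus> act (Q N) (T * sp)) \<in> H"
    using strip tr[OF z2K] by metis
  then have QP: "ext (- i) (act (Q P) (- T * si)) \<in> H"
    by (rule strip) (use Delta[OF TspA i0 PD(2)] D_act[OF PD(2)] in auto)
  define e where "e = - T * si - a0 * b"
  have eK: "e \<in> K"
  proof -
    define r where "r = cj si * cj (\<sigma> $ j $ j) * wt F j * b * cj a - T"
    define d1 where "d1 = cj si * si - 1"
    define d2 where "d2 = cj (\<sigma> $ j $ j) * \<sigma> $ j $ j - 1"
    have d: "d1 \<in> J" "d2 \<in> J" unfolding d1_def d2_def si_def using idx ideal_level_norm[OF l Jinv us] by auto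
    have "T * si = si * cj si * cj (\<sigma> $ j $ j) * wt F j * b * cj a - r * si"
      by (simp add: r_def algebra_simps)
    also have "si * cj si * cj (\<sigma> $ j $ j) * wt F j * b * cj a
      = - (a0 * b * (cj si * si) * (cj (\<sigma> $ j $ j) * \<sigma> $ j $ j) * (wt F j * cj (wt F j)))"
      by (simp add: a_def mult_ac)
    also have "\<dots> = - (a0 * b * (d1 + 1) * (d2 + 1))" using idx by (simp add: d1_def d2_def)
    finally have Tsi: "T * si = - (a0 * b * (d1 + 1) * (d2 + 1)) - r * si" .
    have "e = r * si + (d1 * a0) * (b * (d2 + 1)) + (d2 * a0) * b"
      unfolding e_def mult_minus_left Tsi by (simp add: algebra_simps)
    also have "\<dots> \<in> K"
      by (intro ideal.subspace_add[OF Ks] ideal_mult_right[OF Ks] JA d a0) (simp add: r_def T_mod)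
    finally show ?thesis .
  qed
  define z3 where "z3 = cj e * (a0 * b) * snd (Q P)"
  have z3: "z3 \<in> K" unfolding z3_def by (intro ideal_mult_right[OF Ks] inv_ideal_cj[OF Kinv] eK)
  have "- T * si = a0 * b + e" by (simp add: e_def)
  with QP have "ext (- i) (act (Q P) (a0 * b) \<dotplus> act (Q P) e \<dotplus> trc z3) \<in> H"
    using heis_act_add[OF PD(1), of "a0 * b" e] by (simp add: z3_def)
  then have "ext (- i) (act (Q P) (a0 * b) \<dotplus> act (Q P) e) \<in> H"
    by (rule strip) (use tr[OF z3] in auto)
  then have "ext (- i) (act (Q P) (a0 * b)) \<in> H"
    by (rule strip) (use Delta[OF eK i0 PD(1)] D_act[OF PD(1)] in auto)
  then show ?thesis by (simp add: P_def)
qed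

end

context hermitian_forms
begin

lemma act_trc: "act (trc z) c = trc (cj c * c * z)"
  by (simp add: algebra_simps)

text \<open>Each summand has a factor other than \<open>v\<^sub>p\<close>.\<close>

lemma pr_self_ideal:
  assumes A: "invariant_ideal F A" and v: "\<And>i. i \<noteq> Zero \<Longrightarrow> i \<noteq> p \<Longrightarrow> v $ i \<in> A" and p: "p \<noteq> Zero"
  shows "pr v v \<in> A"
proof -
  note As = inv_ideal_sub[OF A]
  have "cj (v $ i) * v $ (- i) \<in> A" if i: "i \<in> range Pos" for i
  proof (cases "i = p")
    case True
    then have "v $ (- i) \<in> A" using p by (intro v) auto
    then show ?thesis by (rule ideal_mult_left[OF As])
  next
    case False
    then have "v $ i \<in> A" using i by (intro v) auto
    then show ?thesis by (intro ideal_mult_right[OF As] inv_ideal_cj[OF A])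
  qed
  then show ?thesis unfolding pr_def by (intro ideal.subspace_sum[OF As])
qed

lemma pr_ideal_Pos:
  assumes A: "invariant_ideal F A" and v: "\<And>i. i \<in> range Pos \<Longrightarrow> v $ i \<in> A"
  shows "pr u v \<in> A"
proof -
  note As = inv_ideal_sub[OF A]
  show ?thesis unfolding pr_def
    by (intro ideal.subspace_sum[OF As] ideal_mult_right[OF As] inv_ideal_cj[OF A] v)
qed

section \<open>Generators of the second kind\<close>

text \<open>The second kind of generators of the form parameter of the upper level, with the subtraction of \<open>(1, 0)\<close>
  carried out.\<close>

definition mixed :: "('a, 'n::finite) matrix \<Rightarrow> 'n idx \<Rightarrow> 'a \<Rightarrow> 'a \<Rightarrow> 'a \<times> 'a" where
  "mixed \<sigma> i y z = act (Q (\<sigma> *v axis Zero 1)) y \<dotplus> (0, z)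
     \<dotplus> \<dotminus> (act (y, z) (\<sigma> $ i $ i))"

lemma column_eq: "column j \<sigma> = \<sigma> *v axis j (1::'a)"
  by (simp add: vec_eq_iff column_def matrix_vector_axis)

lemma mixed_eq:
  "heis_minus F (act (heis_minus F (Q (column Zero \<sigma>)) (1, 0)) y \<dotplus> (y, z)) (act (y, z) (\<sigma> $ i $ i))
   = mixed \<sigma> i y z"
proof -
  obtain a b where "Q (\<sigma> *v axis Zero 1) = (a, b)" by fastforce
  then show ?thesis by (simp add: mixed_def column_eq algebra_simps)
qed

lemma upper_form_gens_eq:
  "upper_form_gens F H = {Q (\<sigma> *v axis j 1) | \<sigma> j. \<sigma> \<in> H \<and> j \<noteq> Zero} \<union>
     {mixed \<sigma> i y z | \<sigma> i y z. \<sigma> \<in> H \<and> i \<noteq> Zero \<and> (y, z) \<in> D}"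
  unfolding upper_form_gens_def mixed_eq by (simp add: column_eq)

lemma D_minus: "\<alpha> \<in> D \<Longrightarrow> \<beta> \<in> D \<Longrightarrow> heis_minus F \<alpha> \<beta> \<in> D"
  unfolding heis_minus_def by (intro D_mult D_inv)

lemma mixed_D:
  assumes "unitary \<sigma>" "(y, z) \<in> D" shows "mixed \<sigma> i y z \<in> D"
proof -
  have "heis_minus F (Q (\<sigma> *v axis Zero 1)) (1, 0) \<in> D"
    using unitary_Q[OF assms(1), of "axis Zero 1"] by (simp add: Q_eq axis_nth_if)
  then show ?thesis
    unfolding mixed_eq[symmetric] column_eq
    using assms(2) by (intro D_minus[OF D_mult[OF D_act]] D_act)
qed

lemma upper_form_gens_D: "H \<subseteq> carrier U \<Longrightarrow> upper_form_gens F H \<subseteq> D"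
  unfolding upper_form_gens_eq by (auto intro!: mixed_D Q_unitary_D Q_axis)

text \<open>Replacing one diagonal entry by another changes the generator by the action of their difference, up to
  a trace.\<close>

lemma mixed_change:
  assumes "(y, z) \<in> D"
  shows "mixed \<sigma> i y z = mixed \<sigma> j y z \<dotplus> act (y, z) (\<sigma> $ j $ j - \<sigma> $ i $ i)
    \<dotplus> trc (cj (\<sigma> $ i $ i) * (\<sigma> $ j $ j - \<sigma> $ i $ i) * z)"
proof -
  obtain a b where Q: "Q (\<sigma> *v axis Zero 1) = (a, b)" by fastforce
  have D: "cj y * (mu F * y) = - z - cj z * lm" using D_eq'[OF assms] by (simp add: mult.assoc)
  have Dx: "cj y * (mu F * (y * x)) = (- z - cj z * lm) * x" "cj y * (y * (mu F * x)) = (- z - cj z * lm) * x"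
    "y * (cj y * (mu F * x)) = (- z - cj z * lm) * x" "mu F * (cj y * (y * x)) = (- z - cj z * lm) * x" for x
    unfolding D[symmetric] by (simp_all add: mult_ac)
  have "act (y, z) (\<sigma> $ j $ j) = act (y, z) (\<sigma> $ j $ j - \<sigma> $ i $ i) \<dotplus> act (y, z) (\<sigma> $ i $ i)
    \<dotplus> trc (cj (\<sigma> $ i $ i) * (\<sigma> $ j $ j - \<sigma> $ i $ i) * z)"
    using heis_act_add[OF assms, of "\<sigma> $ j $ j - \<sigma> $ i $ i" "\<sigma> $ i $ i"] by simp
  then have "\<dotminus> (act (y, z) (\<sigma> $ j $ j)) \<dotplus> act (y, z) (\<sigma> $ j $ j - \<sigma> $ i $ i)
    \<dotplus> trc (cj (\<sigma> $ i $ i) * (\<sigma> $ j $ j - \<sigma> $ i $ i) * z) = \<dotminus> (act (y, z) (\<sigma> $ i $ i))"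
    unfolding \<open>act (y, z) (\<sigma> $ j $ j) = _\<close>
    by (simp add: algebra_simps)
  then show ?thesis
    unfolding mixed_def by (simp only: heis.m_assoc heis_carrier UNIV_I)
qed

text \<open>Traces and, more generally, elements with first component zero are central.  In the application \<open>m\<close>
  is \<open>cj y * mu * y\<close>, whose trace vanishes.\<close>

lemma heis_rearrange:
  assumes "m - cj m * lm = 0"
  shows "((a \<dotplus> b \<dotplus> (0, cj z * lm + (z1 - cj z1 * lm))) \<dotplus> n \<dotplus> trc z2)
      \<dotplus> (s \<dotplus> e \<dotplus> trc r) \<dotplus> trc p
    = a \<dotplus> b \<dotplus> (n \<dotplus> (0, z) \<dotplus> s) \<dotplus> e \<dotplus> trc (z1 + z2 + r + (p - z - m))"
  using assms by (cases a; cases b; cases n; cases s; cases e) (simp add: algebra_simps)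

text \<open>Conjugation by the extra short root element \<open>g\<close> adds column \<open>Zero\<close>, multiplied by \<open>y\<close>, to
  column \<open>j\<close> and then subtracts \<open>(y, z) \<circ> \<sigma>\<^sub>j\<^sub>j\<close> from \<open>Q\<close> of the result.  Hence a column of the conjugate is a generator of
  the second kind, up to columns of \<open>\<sigma>\<close> and terms that are small for the level.  A positive index \<open>j\<close> keeps the second
  component of \<open>Q\<close> free of units.\<close>

lemma mixed_column:
  fixes \<sigma> :: "('a, 'n::finite) matrix" and n0 :: 'n
  assumes us: "unitary \<sigma>" and l: "ideal_level J \<sigma>" and J: "invariant_ideal F J" and yz: "(y, z) \<in> D"
  defines "j \<equiv> Pos n0"
  defines "g \<equiv> ext (- j) (y, cj z * lm)"
  shows "\<exists>Z\<in>J. Q ((g ** \<sigma> ** iv g) *v axis j 1) = Q (\<sigma> *v axis j 1)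
    \<dotplus> act (Q (\<sigma> *v axis (- j) 1)) (cj z * lm)
    \<dotplus> mixed \<sigma> j y z
    \<dotplus> \<dotminus> (act (y, z) (\<sigma> $ j $ (- j) * (cj z * lm) + \<sigma> $ j $ Zero * y)) \<dotplus> trc Z"
proof -
  note Js = inv_ideal_sub[OF J]
  have j0: "j \<noteq> Zero" "j \<noteq> - j" "- j \<noteq> j" "- j \<noteq> Zero" "wt F j = 1" "wt F (- j) = lm"
    by (simp_all add: j_def)
  have yJ: "y \<in> JD" using yz by (auto simp: JD_iff)
  have yz': "(y, cj z * lm) \<in> D" "\<dotminus> (y, cj z * lm) = (- y, z)"
  proof -
    have "\<dotminus> (y, z) = (- y, cj z * lm)" using D_eq'[OF yz] by simp
    then show "(y, cj z * lm) \<in> D" using D_neg_fst[of "- y" "cj z * lm"] D_inv[OF yz] by simp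
    from D_eq'[OF this] show "\<dotminus> (y, cj z * lm) = (- y, z)" by (simp add: mult.assoc)
  qed
  have ug: "unitary g" unfolding g_def using j0 yz' by (intro ext_unitary) auto
  have ivg: "iv g = ext (- j) (- y, z)"
    unfolding g_def using ext_iv[of "- j" "(y, cj z * lm)"] j0 yz' by simp
  define t where "t = cj z * lm"
  define s where "s = \<sigma> $ j $ j"
  define e where "e = \<sigma> $ j $ (- j) * t + \<sigma> $ j $ Zero * y"
  define w1 where "w1 = \<sigma> *v axis j 1 + t *s (\<sigma> *v axis (- j) 1)"
  define w2 where "w2 = y *s (\<sigma> *v axis Zero 1)"
  define w where "w = w1 + w2"
  have "iv g *v axis j 1 = axis j 1 + t *s axis (- j) 1 + y *s axis Zero 1"
    unfolding ivg using j0 by (simp add: ext_vec axis_nth_if t_def axis_scale axis_uminus[symmetric])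
  then have gw: "(g ** \<sigma> ** iv g) *v axis j 1 = g *v w"
    by (simp add: w_def w1_def w2_def mv_linear flip: matrix_vector_mul_assoc)
  have wj: "w $ j = e + s" by (simp add: w_def w1_def w2_def e_def s_def matrix_vector_axis mult_ac)
  define \<eta> where "\<eta> = cj y * mu F * w $ Zero + z * w $ j"
  have gv: "g *v w = w + axis (- j) \<eta> - axis Zero (y * w $ j)"
    unfolding g_def using j0 by (simp add: ext_vec \<eta>_def mult_ac)
  have pgw: "pr (g *v w) (g *v w) = pr w w + cj (w $ j) * \<eta>"
  proof -
    have "(Zero :: 'n idx) \<notin> range Pos" "(Zero :: 'n idx) \<notin> range Neg" "Neg n0 \<notin> range Pos" by auto
    then show ?thesis unfolding gv by (simp add: pr_linear pr_axis_left pr_axis_right j_def axis_nth_if)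
  qed
  define P where "P = cj (w $ j) * cj y * mu F * w $ Zero + w $ j * cj (w $ j) * z"
  have 1: "Q (g *v w) = Q w \<dotplus> \<dotminus> (act (y, z) (w $ j)) \<dotplus> trc P"
  proof -
    have "cj y * mu F * y + z + cj z * lm = 0" by (rule D_eq[OF yz])
    then have "cj (w $ j) * w $ j * (cj y * mu F * y + z + cj z * lm) = 0" by simp
    then show ?thesis
      unfolding Q_eq pgw using j0 by (simp add: gv axis_nth_if P_def \<eta>_def algebra_simps)
  qed
  define r where "r = - (cj s * e * z)"
  have 2: "\<dotminus> (act (y, z) (w $ j))
    = \<dotminus> (act (y, z) s) \<dotplus> \<dotminus> (act (y, z) e) \<dotplus> trc r"
  proof -
    have "\<dotminus> (\<alpha> \<dotplus> \<beta> \<dotplus> trc x) = \<dotminus> \<beta> \<dotplus> \<dotminus> \<alpha> \<dotplus> trc (- x)" for \<alpha> \<beta> x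
      by (cases \<alpha>; cases \<beta>) (simp add: algebra_simps)
    then show ?thesis unfolding wj heis_act_add[OF yz] r_def snd_conv .
  qed
  define z1 where "z1 = pr (\<sigma> *v axis j 1) (t *s (\<sigma> *v axis (- j) 1))"
  define z2 where "z2 = pr w1 w2"
  have 3: "Q w1 = Q (\<sigma> *v axis j 1) \<dotplus> act (Q (\<sigma> *v axis (- j) 1)) t \<dotplus> (0, cj z * lm + (z1 - cj z1 * lm))"
  proof -
    have "B (\<sigma> *v axis j 1) (t *s (\<sigma> *v axis (- j) 1)) = cj z * lm"
      unfolding B_scale_right unitary_B[OF us] using j0 by (simp add: axis_nth_if t_def)
    then show ?thesis unfolding w1_def Q_add z1_def by (simp only: Q_scale)
  qed
  have 4: "Q w = Q w1 \<dotplus> act (Q (\<sigma> *v axis Zero 1)) y \<dotplus> trc z2"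
  proof -
    have "B w1 w2 = 0"
      unfolding w1_def w2_def B_scale_right B_add_left B_scale_left unitary_B[OF us] using j0 by (simp add: axis_nth_if)
    then show ?thesis unfolding w_def Q_add z2_def by (simp add: w2_def Q_scale)
  qed
  define m where "m = cj y * mu F * y"
  have m0: "m - cj m * lm = 0" by (simp add: m_def mult_ac)
  have mx: "mixed \<sigma> j y z = act (Q (\<sigma> *v axis Zero 1)) y \<dotplus> (0, z) \<dotplus> \<dotminus> (act (y, z) s)"
    by (simp only: mixed_def s_def)
  define Z where "Z = z1 + z2 + r + (P - z - m)"
  have "Q ((g ** \<sigma> ** iv g) *v axis j 1) = Q (\<sigma> *v axis j 1)
    \<dotplus> act (Q (\<sigma> *v axis (- j) 1)) t \<dotplus> mixed \<sigma> j y z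
    \<dotplus> \<dotminus> (act (y, z) e) \<dotplus> trc Z"
    unfolding gw 1 2 4 3 mx Z_def by (rule heis_rearrange[OF m0])
  moreover have "Z \<in> J"
  proof -
    have eJ: "e \<in> J"
      unfolding e_def using j0 yJ
      by (intro ideal.subspace_add[OF Js] ideal_mult_right[OF Js] ideal_level_off[OF l] ideal_level_column[OF l]) auto
    have n: "cj s * s - 1 \<in> J" unfolding s_def by (rule ideal_level_norm[OF l J us]) (use j0 in auto)
    have z1: "z1 \<in> J" unfolding z1_def
    proof (rule pr_ideal_Pos[OF J])
      fix i :: "'n idx" assume "i \<in> range Pos"
      then have "\<sigma> $ i $ (- j) \<in> J" by (intro ideal_level_off[OF l]) (auto simp: j_def)
      then show "(t *s (\<sigma> *v axis (- j) 1)) $ i \<in> J" by (simp add: matrix_vector_axis ideal_mult_left[OF Js])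
    qed
    have z2: "z2 \<in> J" unfolding z2_def
    proof (rule pr_ideal_Pos[OF J])
      fix i :: "'n idx" assume "i \<in> range Pos"
      then have "\<sigma> $ i $ Zero * y \<in> J" by (intro ideal_level_column[OF l _ yJ]) auto
      then show "w2 $ i \<in> J" by (simp add: w2_def matrix_vector_axis mult.commute)
    qed
    have r: "r \<in> J" unfolding r_def
      by (intro ideal.subspace_neg[OF Js] ideal_mult_right[OF Js] ideal_mult_left[OF Js] eJ)
    define R where "R = cj y * mu F * \<sigma> $ Zero $ j + cj y * mu F * \<sigma> $ Zero $ (- j) * t + cj y * mu F * (\<sigma> $ Zero $ Zero - s) * y"
    have RJ: "R \<in> J" unfolding R_def s_def using j0 yJ
      by (intro ideal.subspace_add[OF Js] ideal_mult_right[OF Js] ideal_level_row[OF l] ideal_level_zero[OF l]) auto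
    have cR: "cj y * mu F * w $ Zero = R + s * m"
      by (simp add: R_def m_def w_def w1_def w2_def matrix_vector_axis algebra_simps)
    have "P = cj (w $ j) * (cj y * mu F * w $ Zero) + w $ j * cj (w $ j) * z" by (simp add: P_def mult.assoc)
    also have "\<dots> - z - m = R * cj (e + s) + (cj s * s - 1) * m + cj e * (s * m)
        + (cj s * s - 1) * z + e * ((cj e + cj s) * z) + cj e * (s * z)"
      unfolding cR wj by (simp add: algebra_simps)
    also have "\<dots> \<in> J"
      by (intro ideal.subspace_add[OF Js] ideal_mult_right[OF Js] n eJ inv_ideal_cj[OF J] RJ)
    finally have "P - z - m \<in> J" .
    then show ?thesis unfolding Z_def by (intro ideal.subspace_add[OF Js] z1 z2 r)
  qed
  ultimately show ?thesis unfolding t_def e_def by blast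
qed

end

context relative_level
begin

section \<open>The form parameter of the upper level\<close>

text \<open>Column extraction reaches all positions except those of \<open>p\<close> and \<open>- p\<close>, with coefficients from \<open>I\<^sup>9\<close>;
  these two are reached with one more factor from \<open>I\<close>.  Since the action is additive only up to traces, sums in
  \<open>I\<^sup>1\<^sup>0\<close> need traces of known elements, which exist because the second component of \<open>Q\<close> of a column lies in
  the ideal of the upper level.\<close>

lemma column_ext_in:
  assumes H: "normalised H" and s: "\<sigma> \<in> H" and p: "p \<noteq> Zero" and c: "c \<in> pw 10"
  shows "act (Q (\<sigma> *v axis p 1)) c \<in> ext_in H"
proof -
  define P where "P = \<sigma> *v axis p 1"
  have us: "unitary \<sigma>" using H s by (rule H_unitary)
  have PD: "Q P \<in> D" unfolding P_def by (rule Q_unitary_D[OF us Q_axis[OF p]])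
  have l: "ideal_level (upper_ideal F H) \<sigma>" using s by (rule upper_ideal_level)
  have PJ: "snd (Q P) \<in> upper_ideal F H"
    unfolding Q_eq snd_conv
    by (rule pr_self_ideal[OF upper_ideal_inv _ p]) (use p in \<open>auto simp: P_def matrix_vector_axis intro!: ideal_level_off[OF l]\<close>)
  have 1: "ext k (act (Q P) (a0 * (b * x))) \<in> H"
    if k: "k \<noteq> Zero" and a0: "a0 \<in> pw 8" and b: "b \<in> I" "x \<in> I" for k a0 b x
  proof (cases "apart k p")
    case True
    then have "rt (- k) p" using k p by (simp add: rt_def)
    from column_extraction[OF H s this a0 I_mult(1)[OF b(1)]] show ?thesis by (simp add: P_def)
  next
    case False
    obtain i where i: "i \<noteq> Zero" "apart i p" using ex_apart_three[OF card_n, of p p p] by blast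
    have ip: "rt (- i) p" using i p by (simp add: rt_def)
    have ki: "rt k i" using False k i by (auto simp: rt_def apart_def)
    define \<beta> where "\<beta> = act (Q P) (a0 * b)"
    have "ext i \<beta> \<in> H" using column_extraction[OF H s ip a0 b(1)] by (simp add: P_def \<beta>_def)
    moreover have "snd \<beta> \<in> known H"
    proof -
      have "snd \<beta> = (snd (Q P) * a0) * (b * cj (a0 * b))"
        unfolding \<beta>_def by (cases "Q P") (simp add: mult_ac)
      also have "\<dots> \<in> known H" by (intro ideal_mult_right[OF known_sub[OF H]] upper_known(1)[OF H PJ a0]) simp
      finally show ?thesis .
    qed
    ultimately have "ext k (act \<beta> x) \<in> H"
      using D_act[OF PD] b(2) by (intro ext_move[OF H known_sub[OF H] known_short_in[OF H] ki]) (auto simp: \<beta>_def)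
    then show ?thesis by (simp add: \<beta>_def heis_act_act mult.assoc)
  qed
  define R where "R = (\<lambda>c. c \<in> pw 8 \<and> act (Q P) c \<in> ext_in H)"
  have Radd: "R (x + y)" if "R x" "R y" for x y
  proof -
    have "cj y * x * snd (Q P) \<in> known H"
    proof -
      have "(snd (Q P) * x) * cj y \<in> known H"
        using that by (intro ideal_mult_right[OF known_sub[OF H]] upper_known(1)[OF H PJ, of _ 8]) (auto simp: R_def)
      then show ?thesis by (simp add: mult_ac)
    qed
    from ext_in_mult[OF H ext_in_mult[OF H] ext_in_trc[OF H this]] show ?thesis
      using that unfolding R_def heis_act_add[OF PD]
      by (blast intro: ideal.subspace_add[OF pw_sub])
  qed
  have act0: "act \<alpha> 0 = (0, 0)" for \<alpha> by (cases \<alpha>) simp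
  have R0: "R 0"
    unfolding R_def act0 using subgroup.one_closed[OF ext_in_subgroup[OF H]] ideal.subspace_0[OF pw_sub] by simp
  have in8: "z \<in> pw 8 \<Longrightarrow> y * z \<in> pw 8" for y z by (rule ideal_mult_left[OF pw_sub])
  have "R c" if "c \<in> pw (Suc (Suc 8))" for c
    using I_inv that
  proof (induction rule: ideal_power_Suc_induct)
    case (mult a z)
    from I_inv mult(2) show ?case
    proof (induction rule: ideal_power_Suc_induct)
      case (mult b z)
      have "act (Q P) (z * (a * b)) \<in> ext_in H"
        unfolding ext_in_def[OF H] using 1[OF _ mult(2) \<open>a \<in> I\<close> mult(1)] D_act[OF PD] by blast
      then show ?case using in8[OF mult(2), of "a * b"] unfolding R_def by (simp add: mult_ac)
    qed (use Radd R0 in \<open>auto simp: distrib_left\<close>)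
  qed (use Radd R0 in auto)
  from this[of c] c show ?thesis by (simp add: R_def P_def)
qed

text \<open>By \<open>mixed_column\<close> the generator is a column of a conjugate of \<open>H\<close>, up to known terms.  The index \<open>j\<close>
  avoids \<open>k\<close>, so that the conjugating matrix moves \<open>ext k \<beta>\<close> only by a short root element with known coefficient.  Other
  indices \<open>i\<close> follow from \<open>mixed_change\<close>.\<close>

lemma mixed_ext_in:
  assumes H: "normalised H" and s: "\<sigma> \<in> H" and i: "i \<noteq> Zero" and yz: "(y, z) \<in> D" and c: "c \<in> pw 10"
  shows "act (mixed \<sigma> i y z) c \<in> ext_in H"
proof -
  let ?J = "upper_ideal F H"
  note Ks = known_sub[OF H]
  have us: "unitary \<sigma>" using H s by (rule H_unitary)
  have l: "ideal_level ?J \<sigma>" using s by (rule upper_ideal_level)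
  note Jinv = upper_ideal_inv[of H] and Js = inv_ideal_sub[OF upper_ideal_inv[of H]]
  have MD: "mixed \<sigma> i y z \<in> D" for i by (rule mixed_D[OF us yz])
  have JA: "x * y \<in> known H" "y * x \<in> known H" if "x \<in> ?J" "y \<in> pw 10" for x y
    using upper_known[OF H that] by simp_all
  have "ext k (act (mixed \<sigma> i y z) c) \<in> H" if k: "k \<noteq> Zero" for k
  proof -
    obtain n0 where j: "apart (Pos n0) k"
    proof -
      obtain l where "l \<noteq> Zero" "apart l k" using ex_apart_three[OF card_n, of k k k] by blast
      then show thesis using that apart_neg(1)[of "Pos _" k] by (cases l) auto
    qed
    define j where "j = Pos n0"
    have jk: "rt k j" "j \<noteq> Zero" using j k by (auto simp: j_def rt_def apart_sym)
    define g where "g = ext (- j) (y, cj z * lm)"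
    have yz': "(y, cj z * lm) \<in> D"
    proof -
      have "\<dotminus> (y, z) = (- y, cj z * lm)" using D_eq'[OF yz] by simp
      then show ?thesis using D_neg_fst[of "- y" "cj z * lm"] D_inv[OF yz] by simp
    qed
    have gEL: "g \<in> EL" unfolding g_def using jk yz' by (intro ext_EL) auto
    have ug: "unitary g" using gEL by (rule EL_unitary)
    define H' where "H' = cnjg g H"
    have H': "normalised H'" unfolding H'_def by (rule normalised_cnjg[OF H gEL])
    define \<sigma>' where "\<sigma>' = g ** \<sigma> ** iv g"
    have s': "\<sigma>' \<in> H'" using s by (auto simp: H'_def cnjg_def \<sigma>'_def)
    define \<beta> where "\<beta> = act (Q (\<sigma>' *v axis j 1)) c"
    have "\<beta> \<in> ext_in H'" unfolding \<beta>_def by (rule column_ext_in[OF H' s' jk(2) c])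
    then have bD: "\<beta> \<in> D" and bH': "ext k \<beta> \<in> H'" using k by (auto simp: ext_in_def[OF H'])
    have bH: "ext k \<beta> \<in> H"
    proof -
      define x where "x = - (cj y * mu F * fst \<beta>)"
      have pull: "iv g ** h ** g \<in> H" if "h \<in> H'" for h
        using that ug by (auto simp: H'_def cnjg_def simp flip: matrix_mul_assoc)
      have ivg: "iv g = ext (- j) (- y, z)"
      proof -
        have "iv g = ext (- j) (\<dotminus> (y, cj z * lm))" unfolding g_def by (rule ext_iv) (use jk yz' in auto)
        also have "\<dotminus> (y, cj z * lm) = (- y, z)" using D_eq'[OF yz'] by (simp add: mult.assoc)
        finally show ?thesis .
      qed
      have uig: "unitary (iv g)" using ug by simp
      have v: "iv g *v axis k 1 = axis k 1" "iv g *v axis Zero b = axis Zero b + axis (- j) (- (cj y * mu F * b))"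
        "iv g *v axis (- j) b = axis (- j) b" for b
        unfolding ivg using rtD[OF jk(1)] by (simp_all add: ext_vec axis_nth_if neg_iff)
      have "x \<in> ideal_mult (upper_ideal F H') (pw 7)"
      proof -
        have "cj y * mu F * \<sigma>' $ Zero $ j \<in> upper_ideal F H'"
          using jk yz by (intro ideal_level_row[OF upper_ideal_level[OF s']]) (auto simp: JD_iff)
        moreover have "c \<in> pw 7" using c pw_mono[of 7 10] by auto
        ultimately have "cj y * mu F * \<sigma>' $ Zero $ j * c \<in> ideal_mult (upper_ideal F H') (pw 7)"
          by (rule ideal_mult_in)
        then have "- (cj y * mu F * \<sigma>' $ Zero $ j * c) \<in> ideal_mult (upper_ideal F H') (pw 7)"
          by (rule ideal.subspace_neg[OF ideal_mult_subspace])
        then show ?thesis by (simp add: x_def \<beta>_def Q_eq matrix_vector_axis mult.assoc)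
      qed
      then have "sht k (- j) x \<in> H'" using jk by (intro short_inD[OF short_in_upper[OF H']]) auto
      then have sH: "sht k (- j) x \<in> H"
        using pull[of "sht k (- j) x"] tv_conj'[OF uig, of "axis k 1" "axis (- j) x" 0] ug by (simp add: sht_def v)
      have "iv g ** ext k \<beta> ** g = tv (axis k 1) (axis Zero (fst \<beta>) + axis (- j) x) (cj (snd \<beta>))"
        using tv_conj'[OF uig, of "axis k 1" "axis Zero (fst \<beta>)" "cj (snd \<beta>)"] ug by (simp add: ext_def v x_def)
      also have "\<dots> = ext k \<beta> ** sht k (- j) x"
        unfolding ext_def sht_def using rtD[OF jk(1)]
        by (subst tv_mult) (simp_all add: axis_nth_if neg_iff del: tv_zero)
      finally have "ext k \<beta> ** sht k (- j) x \<in> H" using pull[OF bH'] by simp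
      then show ?thesis by (rule H_conj_cancel[OF H _ sH]) (use k bD in simp)
    qed
    define e where "e = \<sigma> $ j $ (- j) * (cj z * lm) + \<sigma> $ j $ Zero * y"
    have eJ: "e \<in> ?J"
      unfolding e_def using jk yz
      by (intro ideal.subspace_add[OF Js] ideal_mult_right[OF Js] ideal_level_off[OF l] ideal_level_column[OF l]) (auto simp: JD_iff)
    obtain Z where Z: "Z \<in> ?J" and E: "Q (\<sigma>' *v axis j 1) = Q (\<sigma> *v axis j 1)
        \<dotplus> act (Q (\<sigma> *v axis (- j) 1)) (cj z * lm)
        \<dotplus> mixed \<sigma> j y z \<dotplus> \<dotminus> (act (y, z) e) \<dotplus> trc Z"
      using mixed_column[OF us l Jinv yz, of n0] unfolding \<sigma>'_def g_def j_def e_def by blast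
    let ?a = "act (Q (\<sigma> *v axis j 1)) c"
    let ?b = "act (Q (\<sigma> *v axis (- j) 1)) (cj z * lm * c)"
    have b: "\<beta> = ?a \<dotplus> ?b \<dotplus> act (mixed \<sigma> j y z) c
        \<dotplus> \<dotminus> (act (y, z) (e * c)) \<dotplus> trc (cj c * c * Z)"
      unfolding \<beta>_def E by (simp only: heis_act_mult heis_act_inv heis_act_act act_trc)
    have 1: "trc (cj c * c * Z) \<in> ext_in H"
      by (rule ext_in_trc[OF H]) (use JA(2)[OF Z c] ideal_mult_left[OF Ks] in \<open>simp add: mult.assoc\<close>)
    have 2: "act (y, z) (e * c) \<in> ext_in H" by (rule ext_in_Delta[OF H JA(1)[OF eJ c] yz])
    have 3: "?a \<in> ext_in H" by (rule column_ext_in[OF H s jk(2) c])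
    have 4: "?b \<in> ext_in H"
      by (rule column_ext_in[OF H s]) (use jk ideal_mult_left[OF pw_sub c] in simp_all)
    have G: "ext k \<alpha> \<in> H" "\<alpha> \<in> D" "ext k (\<dotminus> \<alpha>) \<in> H" "\<dotminus> \<alpha> \<in> D" if "\<alpha> \<in> ext_in H" for \<alpha>
      using that k D_inv ext_inv_H[OF H k] by (auto simp: ext_in_def[OF H] simp del: heis_inv)
    from bH have "ext k (?a \<dotplus> ?b \<dotplus> act (mixed \<sigma> j y z) c
        \<dotplus> \<dotminus> (act (y, z) (e * c))) \<in> H"
      unfolding b by (rule ext_strip[OF H k _ G(1,2)[OF 1]])
    then have "ext k (?a \<dotplus> ?b \<dotplus> act (mixed \<sigma> j y z) c) \<in> H"
      by (rule ext_strip[OF H k _ G(3,4)[OF 2]])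
    then have "ext k (\<dotminus> (?a \<dotplus> ?b) \<dotplus> (?a \<dotplus> ?b \<dotplus> act (mixed \<sigma> j y z) c)) \<in> H"
      by (rule ext_mult_H[OF H k G(3)[OF ext_in_mult[OF H 3 4]]])
    also have "\<dotminus> (?a \<dotplus> ?b) \<dotplus> (?a \<dotplus> ?b \<dotplus> act (mixed \<sigma> j y z) c)
      = act (mixed \<sigma> j y z) c"
      using heis.l_inv[of "?a \<dotplus> ?b"] by (simp only: heis_carrier UNIV_I flip: heis.m_assoc) (simp only: heis.l_one heis_carrier UNIV_I)
    finally have mj: "ext k (act (mixed \<sigma> j y z) c) \<in> H" .
    define d where "d = \<sigma> $ j $ j - \<sigma> $ i $ i"
    have dJ: "d \<in> ?J" unfolding d_def by (rule ideal_level_diag[OF l Js]) (use jk i in auto)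
    have "act (mixed \<sigma> i y z) c = act (mixed \<sigma> j y z) c \<dotplus> act (y, z) (d * c)
        \<dotplus> trc (cj c * c * (cj (\<sigma> $ i $ i) * d * z))"
      unfolding mixed_change[OF yz, of \<sigma> i j] d_def by (simp only: heis_act_mult heis_act_act act_trc)
    moreover have "trc (cj c * c * (cj (\<sigma> $ i $ i) * d * z)) \<in> ext_in H"
    proof (rule ext_in_trc[OF H])
      have "cj c * c * (cj (\<sigma> $ i $ i) * d * z) = (d * c) * (cj c * cj (\<sigma> $ i $ i) * z)" by (simp add: mult_ac)
      also have "\<dots> \<in> known H" by (intro ideal_mult_right[OF Ks] JA dJ c)
      finally show "cj c * c * (cj (\<sigma> $ i $ i) * d * z) \<in> known H" .
    qed
    moreover have "act (y, z) (d * c) \<in> ext_in H" by (rule ext_in_Delta[OF H JA(1)[OF dJ c] yz])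
    ultimately show ?thesis using mj G by (metis ext_mult_H[OF H k])
  qed
  then show ?thesis using D_act[OF MD] by (simp add: ext_in_def[OF H])
qed

end

context hermitian_forms
begin

section \<open>Submodules of the Heisenberg group\<close>

lemma heis_assoc: "\<alpha> \<dotplus> \<beta> \<dotplus> \<gamma> = \<alpha> \<dotplus> (\<beta> \<dotplus> \<gamma>)"
  by (simp only: heis.m_assoc heis_carrier UNIV_I)

lemma heis_cancel:
  "\<dotminus> \<alpha> \<dotplus> (\<alpha> \<dotplus> \<beta>) = \<beta>" "\<alpha> \<dotplus> (\<dotminus> \<alpha> \<dotplus> \<beta>) = \<beta>"
  by (simp_all only: heis.m_assoc[symmetric] heis.l_inv heis.r_inv heis.l_one heis_carrier UNIV_I)

lemma heis_inv_mult: "\<dotminus> (\<alpha> \<dotplus> \<beta>) = \<dotminus> \<beta> \<dotplus> \<dotminus> \<alpha>"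
  by (rule heis.inv_mult_group) simp_all

lemma heis_inv_inv: "\<dotminus> (\<dotminus> \<alpha>) = \<alpha>"
  by (rule heis.inv_inv) simp

lemma heis_one_mult: "(0, 0) \<dotplus> \<alpha> = \<alpha>" "\<alpha> \<dotplus> (0, 0) = \<alpha>"
  by (cases \<alpha>; simp)+

text \<open>Commutators in the Heisenberg group are traces.\<close>

lemma heis_commute: "\<beta> \<dotplus> \<alpha> = \<alpha> \<dotplus> \<beta> \<dotplus> trc (cj (fst \<alpha>) * mu F * fst \<beta>)"
  by (cases \<alpha>; cases \<beta>) (simp add: algebra_simps)

lemma trc_commute: "\<alpha> \<dotplus> (0, c) = (0, c) \<dotplus> \<alpha>"
  by (cases \<alpha>) (simp add: algebra_simps)

lemma trc_add: "trc x \<dotplus> trc y = trc (x + y)"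
  by (simp add: algebra_simps)

lemma trc_inv: "\<dotminus> (trc x) = trc (- x)"
  by simp

lemma fst_mult: "fst (\<alpha> \<dotplus> \<beta>) = fst \<alpha> + fst \<beta>"
  by (cases \<alpha>; cases \<beta>) simp

lemma fst_inv: "fst (\<dotminus> \<alpha>) = - fst \<alpha>"
  by (cases \<alpha>) simp

lemma fst_act: "fst (act \<alpha> a) = fst \<alpha> * a"
  by (cases \<alpha>) simp

lemma heis_span_subgroup: "subgroup (heis_span F X K) HG"
  unfolding heis_span_def by (rule heis.generate_is_subgroup) simp

lemma heis_span_in: "\<alpha> \<in> X \<Longrightarrow> b \<in> K \<Longrightarrow> act \<alpha> b \<in> heis_span F X K"
  unfolding heis_span_def by (rule generate.incl) blast

lemma heis_span_minimal:
  assumes "subgroup S HG" "\<And>\<alpha> b. \<alpha> \<in> X \<Longrightarrow> b \<in> K \<Longrightarrow> act \<alpha> b \<in> S"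
  shows "heis_span F X K \<subseteq> S"
  unfolding heis_span_def by (rule heis.generate_subgroup_incl[OF _ assms(1)]) (use assms(2) in auto)

lemma heis_span_act:
  assumes K: "\<And>a b. a \<in> K \<Longrightarrow> a * b \<in> K" and "\<alpha> \<in> heis_span F X K"
  shows "act \<alpha> c \<in> heis_span F X K"
proof -
  have "subgroup {\<alpha>. act \<alpha> c \<in> heis_span F X K} HG"
    using subgroup.one_closed[OF heis_span_subgroup[of X K]] subgroup.m_closed[OF heis_span_subgroup[of X K]]
      subgroup.m_inv_closed[OF heis_span_subgroup[of X K]]
    by (intro heis.subgroupI) (auto simp: heis_act_mult heis_act_inv simp del: heis_mult heis_inv intro!: exI[of _ 0])
  then have "heis_span F X K \<subseteq> {\<alpha>. act \<alpha> c \<in> heis_span F X K}"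
    by (rule heis_span_minimal) (simp only: heis_act_act mem_Collect_eq, intro heis_span_in K)
  then show ?thesis using assms(2) by blast
qed

text \<open>Interchanging two factors costs a commutator, which the first factor absorbs.\<close>

lemma set_mult_subgroup:
  assumes X: "subgroup X HG" and Y: "subgroup Y HG"
    and c: "\<And>\<alpha> \<beta>. \<alpha> \<in> X \<Longrightarrow> \<beta> \<in> Y \<Longrightarrow> trc (cj (fst \<alpha>) * mu F * fst \<beta>) \<in> X"
  shows "subgroup (X <#>\<^bsub>HG\<^esub> Y) HG"
proof (rule heis.subgroupI)
  note Xm = subgroup.m_closed[OF X] and Ym = subgroup.m_closed[OF Y]
    and Xi = subgroup.m_inv_closed[OF X] and Yi = subgroup.m_inv_closed[OF Y]
  show "X <#>\<^bsub>HG\<^esub> Y \<noteq> {}"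
    using subgroup.one_closed[OF X] subgroup.one_closed[OF Y] unfolding set_mult_def by blast
  have in_prod: "\<alpha> \<dotplus> \<beta> \<in> X <#>\<^bsub>HG\<^esub> Y" if "\<alpha> \<in> X" "\<beta> \<in> Y" for \<alpha> \<beta>
    using that unfolding set_mult_def by blast
  show "\<dotminus> a \<in> X <#>\<^bsub>HG\<^esub> Y" if "a \<in> X <#>\<^bsub>HG\<^esub> Y" for a
  proof -
    from that obtain x y where xy: "x \<in> X" "y \<in> Y" "a = x \<dotplus> y" unfolding set_mult_def by blast
    define k where "k = trc (cj (fst (\<dotminus> x)) * mu F * fst (\<dotminus> y))"
    have "\<dotminus> a = (\<dotminus> x \<dotplus> k) \<dotplus> \<dotminus> y"
      unfolding xy(3) heis_inv_mult heis_commute[of "\<dotminus> y"] k_def by (simp only: heis_assoc trc_commute)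
    moreover have "k \<in> X" unfolding k_def by (intro c Xi Yi xy)
    ultimately show ?thesis by (metis in_prod Xm Xi Yi xy(1,2))
  qed
  show "a \<dotplus> b \<in> X <#>\<^bsub>HG\<^esub> Y" if "a \<in> X <#>\<^bsub>HG\<^esub> Y" "b \<in> X <#>\<^bsub>HG\<^esub> Y" for a b
  proof -
    from that obtain x y x' y' where xy: "x \<in> X" "y \<in> Y" "a = x \<dotplus> y" "x' \<in> X" "y' \<in> Y" "b = x' \<dotplus> y'"
      unfolding set_mult_def by blast
    define k where "k = trc (cj (fst x') * mu F * fst y)"
    have kc: "y \<dotplus> (k \<dotplus> z) = k \<dotplus> (y \<dotplus> z)" for z
      unfolding k_def heis_assoc[symmetric] trc_commute ..
    have "a \<dotplus> b = x \<dotplus> ((y \<dotplus> x') \<dotplus> y')" unfolding xy by (simp only: heis_assoc)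
    also have "\<dots> = (x \<dotplus> x' \<dotplus> k) \<dotplus> (y \<dotplus> y')"
      unfolding heis_commute[of y x'] k_def[symmetric] by (simp only: heis_assoc kc)
    finally have "a \<dotplus> b = (x \<dotplus> x' \<dotplus> k) \<dotplus> (y \<dotplus> y')" .
    moreover have "k \<in> X" unfolding k_def by (intro c xy)
    ultimately show ?thesis by (metis in_prod Xm Ym xy(1,2,4,5))
  qed
qed simp

lemma set_mult_left: "subgroup Y HG \<Longrightarrow> \<alpha> \<in> X \<Longrightarrow> \<alpha> \<in> X <#>\<^bsub>HG\<^esub> Y"
  using subgroup.one_closed[of Y HG] heis_one_mult(2)[of \<alpha>] unfolding set_mult_def by (metis (mono_tags, lifting) UN_iff heis_one insert_iff)

lemma set_mult_right: "subgroup X HG \<Longrightarrow> \<alpha> \<in> Y \<Longrightarrow> \<alpha> \<in> X <#>\<^bsub>HG\<^esub> Y"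
  using subgroup.one_closed[of X HG] heis_one_mult(1)[of \<alpha>] unfolding set_mult_def by (metis (mono_tags, lifting) UN_iff heis_one insert_iff)

lemma set_mult_minimal: "subgroup S HG \<Longrightarrow> X \<subseteq> S \<Longrightarrow> Y \<subseteq> S \<Longrightarrow> X <#>\<^bsub>HG\<^esub> Y \<subseteq> S"
  using subgroup.m_closed[of S HG] unfolding set_mult_def by blast

lemma set_mult_act:
  assumes "\<And>\<alpha>. \<alpha> \<in> X \<Longrightarrow> act \<alpha> c \<in> X" "\<And>\<alpha>. \<alpha> \<in> Y \<Longrightarrow> act \<alpha> c \<in> Y" "\<alpha> \<in> X <#>\<^bsub>HG\<^esub> Y"
  shows "act \<alpha> c \<in> X <#>\<^bsub>HG\<^esub> Y"
proof -
  from assms(3) obtain x y where "x \<in> X" "y \<in> Y" "\<alpha> = x \<dotplus> y" unfolding set_mult_def by blast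
  then show ?thesis using assms(1)[of x] assms(2)[of y] heis_act_mult[of x y c] unfolding set_mult_def by blast
qed

text \<open>The second components of the upper level and of the product of a form ideal with an ideal are the
  submodules \<open>\<Omega>\<^sup>A\<^sub>m\<^sub>i\<^sub>n \<dotplus> Z \<circ> K\<close>.\<close>

definition form_span :: "'a set \<Rightarrow> ('a \<times> 'a) set \<Rightarrow> 'a set \<Rightarrow> ('a \<times> 'a) set" where
  "form_span A Z K = Omega_min F A <#>\<^bsub>HG\<^esub> heis_span F Z K"

lemma trc_subgroup: "ideal.subspace A \<Longrightarrow> subgroup {trc x | x. x \<in> A} HG"
proof (rule heis.subgroupI)
  assume A: "ideal.subspace A"
  show "{trc x | x. x \<in> A} \<noteq> {}" using ideal.subspace_0[OF A] by blast
  show "\<dotminus> a \<in> {trc x | x. x \<in> A}" if "a \<in> {trc x | x. x \<in> A}" for a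
    using that ideal.subspace_neg[OF A] trc_inv by blast
  show "a \<dotplus> b \<in> {trc x | x. x \<in> A}" if "a \<in> {trc x | x. x \<in> A}" "b \<in> {trc x | x. x \<in> A}" for a b
    using that ideal.subspace_add[OF A] trc_add by blast
qed simp

lemma Omega_min_subgroup:
  assumes A: "ideal.subspace A" shows "subgroup (Omega_min F A) HG"
  unfolding Omega_min_def
proof (rule set_mult_subgroup[OF trc_subgroup[OF A] heis_span_subgroup])
  show "trc (cj (fst \<alpha>) * mu F * fst \<beta>) \<in> {trc x |x. x \<in> A}" if "\<alpha> \<in> {trc x |x. x \<in> A}" for \<alpha> \<beta>
  proof -
    have "fst \<alpha> = 0" using that by auto
    then have "trc (cj (fst \<alpha>) * mu F * fst \<beta>) = trc 0" by simp
    then show ?thesis using ideal.subspace_0[OF A] by blast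
  qed
qed

lemma Omega_min_trc: "z \<in> A \<Longrightarrow> trc z \<in> Omega_min F A"
  unfolding Omega_min_def by (rule set_mult_left[OF heis_span_subgroup]) blast

lemma Omega_min_Delta: "ideal.subspace A \<Longrightarrow> \<alpha> \<in> D \<Longrightarrow> a \<in> A \<Longrightarrow> act \<alpha> a \<in> Omega_min F A"
  unfolding Omega_min_def by (intro set_mult_right[OF trc_subgroup] heis_span_in)

lemma Omega_min_minimal:
  assumes "subgroup S HG" "\<And>z. z \<in> A \<Longrightarrow> trc z \<in> S" "\<And>\<alpha> a. \<alpha> \<in> D \<Longrightarrow> a \<in> A \<Longrightarrow> act \<alpha> a \<in> S"
  shows "Omega_min F A \<subseteq> S"
  unfolding Omega_min_def
  by (rule set_mult_minimal[OF assms(1) _ heis_span_minimal[OF assms(1,3)]]) (use assms(2) in auto)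

lemma fst_subgroup: "ideal.subspace A \<Longrightarrow> subgroup {\<alpha>. fst \<alpha> \<in> A} HG"
  by (rule heis.subgroupI)
    (auto simp: fst_mult fst_inv ideal.subspace_add ideal.subspace_neg intro!: exI[of _ 0] ideal.subspace_0 simp del: heis_mult heis_inv)

lemma Omega_min_fst: assumes "ideal.subspace A" "\<alpha> \<in> Omega_min F A" shows "fst \<alpha> \<in> A"
  using Omega_min_minimal[OF fst_subgroup[OF assms(1)], of A] assms ideal_mult_left ideal.subspace_0
  by (fastforce simp: fst_act)

lemma form_span_subgroup:
  assumes A: "invariant_ideal F A" shows "subgroup (form_span A Z K) HG"
  unfolding form_span_def
proof (rule set_mult_subgroup[OF Omega_min_subgroup[OF inv_ideal_sub[OF A]] heis_span_subgroup])
  fix \<alpha> \<beta> assume "\<alpha> \<in> Omega_min F A"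
  then have "cj (fst \<alpha>) \<in> A" using A by (intro inv_ideal_cj Omega_min_fst inv_ideal_sub)
  then show "trc (cj (fst \<alpha>) * mu F * fst \<beta>) \<in> Omega_min F A"
    by (intro Omega_min_trc ideal_mult_right[OF inv_ideal_sub[OF A]])
qed

lemma form_span_act:
  assumes A: "invariant_ideal F A" and K: "\<And>a b. a \<in> K \<Longrightarrow> a * b \<in> K" and a: "\<alpha> \<in> form_span A Z K"
  shows "act \<alpha> c \<in> form_span A Z K"
  unfolding form_span_def
proof (rule set_mult_act[OF _ heis_span_act[OF K] a[unfolded form_span_def]])
  note As = inv_ideal_sub[OF A]
  show "act \<alpha> c \<in> Omega_min F A" if "\<alpha> \<in> Omega_min F A" for \<alpha>
    using that unfolding Omega_min_def
  proof (rule set_mult_act[rotated 2])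
    show "act \<alpha> c \<in> {trc x |x. x \<in> A}" if "\<alpha> \<in> {trc x |x. x \<in> A}" for \<alpha>
    proof -
      from that obtain x where "x \<in> A" "\<alpha> = trc x" by blast
      then have "act \<alpha> c = trc (cj c * c * x)" "cj c * c * x \<in> A"
        using act_trc[of x c] ideal_mult_left[OF As] by simp_all
      then show ?thesis by blast
    qed
    show "act \<alpha> c \<in> heis_span F D A" if "\<alpha> \<in> heis_span F D A" for \<alpha>
      by (rule heis_span_act[OF ideal_mult_right[OF As] that])
  qed
qed

lemma form_span_submodule:
  assumes A: "invariant_ideal F A" and K: "\<And>a b. a \<in> K \<Longrightarrow> a * b \<in> K"
  shows "R_submodule F (form_span A Z K)"
  unfolding R_submodule_def using form_span_subgroup[OF A] form_span_act[OF A K] by blast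

lemma form_span_trc: "z \<in> A \<Longrightarrow> trc z \<in> form_span A Z K"
  unfolding form_span_def by (intro set_mult_left[OF heis_span_subgroup] Omega_min_trc)

lemma form_span_Delta: "ideal.subspace A \<Longrightarrow> \<alpha> \<in> D \<Longrightarrow> a \<in> A \<Longrightarrow> act \<alpha> a \<in> form_span A Z K"
  unfolding form_span_def by (intro set_mult_left[OF heis_span_subgroup] Omega_min_Delta)

lemma form_span_in: "ideal.subspace A \<Longrightarrow> \<alpha> \<in> Z \<Longrightarrow> b \<in> K \<Longrightarrow> act \<alpha> b \<in> form_span A Z K"
  unfolding form_span_def by (intro set_mult_right[OF Omega_min_subgroup] heis_span_in)

lemma form_span_minimal:
  assumes "subgroup S HG" "\<And>z. z \<in> A \<Longrightarrow> trc z \<in> S" "\<And>\<alpha> a. \<alpha> \<in> D \<Longrightarrow> a \<in> A \<Longrightarrow> act \<alpha> a \<in> S"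
    "\<And>\<alpha> b. \<alpha> \<in> Z \<Longrightarrow> b \<in> K \<Longrightarrow> act \<alpha> b \<in> S"
  shows "form_span A Z K \<subseteq> S"
  unfolding form_span_def
  by (rule set_mult_minimal[OF assms(1) Omega_min_minimal[OF assms(1-3)] heis_span_minimal[OF assms(1,4)]])

lemma form_span_D: "Z \<subseteq> D \<Longrightarrow> form_span A Z K \<subseteq> D"
  by (rule form_span_minimal[OF D_subgroup D_long D_act]) (auto intro: D_act simp del: heis_act)

lemma upper_level_eq: "upper_level F H = (upper_ideal F H, form_span (upper_ideal F H) (upper_form_gens F H) UNIV)"
  by (simp add: upper_level_def form_span_def)

lemma form_ideal_prod_eq: "form_ideal_prod F (J, \<Sigma>) K = (ideal_mult J K, form_span (ideal_mult J K) \<Sigma> K)"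
  by (simp add: form_ideal_prod_def form_span_def)

end

section \<open>Congruence subgroups\<close>

text \<open>An odd form ideal, with \<open>\<Omega>\<^sup>J\<^sub>m\<^sub>i\<^sub>n \<subseteq> S\<close> and \<open>S \<subseteq> \<Omega>\<^sup>J\<^sub>m\<^sub>a\<^sub>x\<close> spelled out on
  generators and components.\<close>

locale form_level = hermitian_forms F
  for F :: "'a::comm_ring_1 form_ring" +
  fixes J :: "'a set" and S :: "('a \<times> 'a) set"
  assumes J_inv: "invariant_ideal F J"
    and S_sub: "R_submodule F S"
    and S_D: "S \<subseteq> Delta F"
    and S_trc: "\<And>z. z \<in> J \<Longrightarrow> trc z \<in> S"
    and S_Delta: "\<And>\<alpha> a. \<alpha> \<in> Delta F \<Longrightarrow> a \<in> J \<Longrightarrow> act \<alpha> a \<in> S"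
    and S_fst: "\<And>\<alpha> y. \<alpha> \<in> S \<Longrightarrow> y \<in> J_Delta F \<Longrightarrow> bar F y * mu F * fst \<alpha> \<in> J"
begin

lemma Js: "ideal.subspace J" using J_inv by (rule inv_ideal_sub)

lemma J_add: "x \<in> J \<Longrightarrow> y \<in> J \<Longrightarrow> x + y \<in> J" by (rule ideal.subspace_add[OF Js])
lemma J_diff: "x \<in> J \<Longrightarrow> y \<in> J \<Longrightarrow> x - y \<in> J" by (rule ideal.subspace_diff[OF Js])
lemma J_neg: "x \<in> J \<Longrightarrow> - x \<in> J" by (rule ideal.subspace_neg[OF Js])
lemma J_zero: "0 \<in> J" by (rule ideal.subspace_0[OF Js])
lemma J_left: "x \<in> J \<Longrightarrow> c * x \<in> J" by (rule ideal_mult_left[OF Js])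
lemma J_right: "x \<in> J \<Longrightarrow> x * c \<in> J" by (rule ideal_mult_right[OF Js])
lemma J_cj: "x \<in> J \<Longrightarrow> cj x \<in> J" by (rule inv_ideal_cj[OF J_inv])

lemma S_subgroup: "subgroup S HG" using S_sub by (rule submodule_subgroup)
lemma S_mult: "\<alpha> \<in> S \<Longrightarrow> \<beta> \<in> S \<Longrightarrow> \<alpha> \<dotplus> \<beta> \<in> S" by (rule subgroup.m_closed[OF S_subgroup])
lemma S_inv: "\<alpha> \<in> S \<Longrightarrow> \<dotminus> \<alpha> \<in> S" by (rule subgroup.m_inv_closed[OF S_subgroup])
lemma S_zero: "(0, 0) \<in> S" using subgroup.one_closed[OF S_subgroup] by simp
lemma S_act: "\<alpha> \<in> S \<Longrightarrow> act \<alpha> a \<in> S" using S_sub by (rule submodule_act)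

text \<open>The ideal written \<open>J\<close> with a tilde.\<close>

definition Jt :: "'a set" where "Jt = {x. \<forall>y\<in>JD. cj y * mu F * x \<in> J}"

lemma S_Jt: "\<alpha> \<in> S \<Longrightarrow> fst \<alpha> \<in> Jt"
  using S_fst by (simp add: Jt_def)

lemma S_JD: "\<alpha> \<in> S \<Longrightarrow> fst \<alpha> \<in> JD"
  using S_D by (cases \<alpha>) (auto simp: JD_iff)

lemma Jt_add: "x \<in> Jt \<Longrightarrow> y \<in> Jt \<Longrightarrow> x + y \<in> Jt"
  unfolding Jt_def by (auto simp: distrib_left intro: J_add)

lemma Jt_pair: "x \<in> Jt \<Longrightarrow> y \<in> JD \<Longrightarrow> cj x * mu F * y \<in> J" "x \<in> Jt \<Longrightarrow> y \<in> JD \<Longrightarrow> cj y * mu F * x \<in> J"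
proof -
  assume x: "x \<in> Jt" and y: "y \<in> JD"
  then show 1: "cj y * mu F * x \<in> J" by (simp add: Jt_def)
  have "lm * cj (cj y * mu F * x) \<in> J" by (intro J_left J_cj 1)
  then show "cj x * mu F * y \<in> J" by (simp add: mult_ac)
qed

text \<open>The commutator is a trace whose coefficient is in \<open>J\<close>, by the pairing of \<open>Jt\<close> with \<open>J(\<Delta>)\<close>.\<close>

lemma S_normal:
  assumes "\<alpha> \<in> S" "fst \<beta> \<in> JD"
  shows "\<beta> \<dotplus> \<alpha> \<dotplus> \<dotminus> \<beta> \<in> S"
proof -
  define k where "k = trc (cj (fst \<alpha>) * mu F * fst \<beta>)"
  have "k \<in> S" unfolding k_def by (intro S_trc Jt_pair S_Jt assms)
  have "\<beta> \<dotplus> \<alpha> \<dotplus> \<dotminus> \<beta> = \<alpha> \<dotplus> ((\<beta> \<dotplus> k) \<dotplus> \<dotminus> \<beta>)"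
    unfolding heis_commute[of \<beta> \<alpha>] k_def by (simp only: heis_assoc)
  also have "\<beta> \<dotplus> k = k \<dotplus> \<beta>" unfolding k_def by (rule trc_commute)
  also have "(k \<dotplus> \<beta>) \<dotplus> \<dotminus> \<beta> = k"
    by (cases k; cases \<beta>) (simp add: algebra_simps)
  finally show ?thesis using S_mult[OF assms(1) \<open>k \<in> S\<close>] by simp
qed

text \<open>The displacement of \<open>Q\<close>.  It is a crossed homomorphism in the matrix (\<open>displ_mult\<close>) and, up to traces,
  additive in the vector (\<open>displ_add\<close>).\<close>

definition displ :: "('a, 'n::finite) matrix \<Rightarrow> ('a, 'n) column \<Rightarrow> 'a \<times> 'a" where
  "displ \<sigma> v = heis_minus F (Q (\<sigma> *v v)) (Q v)"

lemma displ_Q: "Q (\<sigma> *v v) = displ \<sigma> v \<dotplus> Q v"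
  unfolding displ_def heis_minus_def
  by (simp only: heis_assoc heis.l_inv heis_carrier UNIV_I heis_one heis_one_mult)

lemma displ_D: "unitary \<sigma> \<Longrightarrow> displ \<sigma> v \<in> D"
  unfolding displ_def by (rule unitary_Q)

lemma displ_fst: "fst (displ \<sigma> v) = (\<sigma> *v v) $ Zero - v $ Zero"
  by (simp add: displ_def Q_eq)

lemma displ_mult: "displ (\<sigma> ** \<tau>) v = displ \<sigma> (\<tau> *v v) \<dotplus> displ \<tau> v"
  unfolding displ_def heis_minus_trans by (simp flip: matrix_vector_mul_assoc)

lemma displ_scale: "displ \<sigma> (c *s v) = act (displ \<sigma> v) c"
  unfolding displ_def heis_minus_def heis_act_mult heis_act_inv by (simp add: mv_linear Q_scale)

lemma displ_add:
  assumes "unitary \<sigma>"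
  shows "displ \<sigma> (u + v) = displ \<sigma> u \<dotplus> displ \<sigma> v
    \<dotplus> trc (cj ((\<sigma> *v v) $ Zero - v $ Zero) * mu F * u $ Zero + (pr (\<sigma> *v u) (\<sigma> *v v) - pr u v))"
proof -
  obtain a0 a1 b0 b1 c0 c1 d0 d1 where q: "Q (\<sigma> *v u) = (a0, a1)" "Q (\<sigma> *v v) = (b0, b1)" "Q u = (c0, c1)" "Q v = (d0, d1)"
    by (metis surj_pair)
  then have f: "(\<sigma> *v v) $ Zero = b0" "v $ Zero = d0" "u $ Zero = c0" by (simp_all add: Q_eq)
  show ?thesis
    unfolding displ_def mv_linear Q_add unitary_B[OF assms] q f by (simp add: algebra_simps)
qed

lemma unitary_JD_vec: "unitary \<sigma> \<Longrightarrow> v $ Zero \<in> JD \<Longrightarrow> (\<sigma> *v v) $ Zero \<in> JD"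
proof -
  assume "unitary \<sigma>" "v $ Zero \<in> JD"
  moreover have "fst (displ \<sigma> v) \<in> JD" using displ_D[OF \<open>unitary \<sigma>\<close>, of v] by (cases "displ \<sigma> v") (auto simp: JD_iff)
  ultimately have "((\<sigma> *v v) $ Zero - v $ Zero) + v $ Zero \<in> JD" unfolding displ_fst by (intro JD_add)
  then show ?thesis by simp
qed

lemma U_rel_iff: "\<sigma> \<in> U_rel F (J, S) \<longleftrightarrow> unitary \<sigma> \<and>
    (\<forall>i j. i \<noteq> Zero \<longrightarrow> j \<noteq> Zero \<longrightarrow> \<sigma> $ i $ j - mat 1 $ i $ j \<in> J) \<and>
    (\<forall>u. u $ Zero \<in> JD \<longrightarrow> displ \<sigma> u \<in> S)"
  by (auto simp: U_rel_def heis_cong_def displ_def)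

lemma U_rel_displ: "\<sigma> \<in> U_rel F (J, S) \<Longrightarrow> u $ Zero \<in> JD \<Longrightarrow> displ \<sigma> u \<in> S"
  and U_rel_unitary: "\<sigma> \<in> U_rel F (J, S) \<Longrightarrow> unitary \<sigma>"
  and U_rel_entry: "\<sigma> \<in> U_rel F (J, S) \<Longrightarrow> i \<noteq> Zero \<Longrightarrow> j \<noteq> Zero \<Longrightarrow> \<sigma> $ i $ j - mat 1 $ i $ j \<in> J"
  by (auto simp: U_rel_iff)

text \<open>The columns \<open>Zero\<close>, multiplied by \<open>y\<close>, and \<open>- i\<close> are orthogonal.  All summands of the form except the one
  with the entry in question lie in \<open>J\<close>, and the cofactor of this one is a unit modulo \<open>J\<close>.\<close>

lemma U_rel_column:
  fixes \<sigma> :: "('a, 'n::finite) matrix"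
  assumes s: "\<sigma> \<in> U_rel F (J, S)" and i: "i \<noteq> Zero" and y: "y \<in> JD"
  shows "\<sigma> $ i $ Zero * y \<in> J"
proof -
  have us: "unitary \<sigma>" using s by (rule U_rel_unitary)
  define T where "T = (\<lambda>k. cj (\<sigma> $ k $ Zero * y) * wt F k * \<sigma> $ (- k) $ (- i))"
  have "(\<Sum>k\<in>UNIV. T k) = B (\<sigma> *v axis Zero y) (\<sigma> *v axis (- i) 1)"
    by (simp add: B_eq_sum T_def matrix_vector_axis)
  also have "\<dots> = 0" using us i by (simp add: unitary_B axis_nth_if)
  finally have sum: "T i + (\<Sum>k\<in>UNIV - {i}. T k) = 0"
    by (simp add: sum.remove[of UNIV i])
  have "T k \<in> J" if "k \<noteq> i" for k
  proof (cases "k = Zero")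
    case True
    have "fst (displ \<sigma> (axis (- i) 1)) \<in> Jt"
      using i JD_zero by (intro S_Jt U_rel_displ[OF s]) (simp add: axis_nth_if)
    then have "\<sigma> $ Zero $ (- i) \<in> Jt" using i by (simp add: displ_fst matrix_vector_axis axis_nth_if)
    moreover have "\<sigma> $ Zero $ Zero * y \<in> JD" using y by (rule JD_mult)
    ultimately have "cj (\<sigma> $ Zero $ Zero * y) * mu F * \<sigma> $ Zero $ (- i) \<in> J" by (rule Jt_pair(2))
    then show ?thesis using True by (simp add: T_def)
  next
    case False
    have "\<sigma> $ (- k) $ (- i) - mat 1 $ (- k) $ (- i) \<in> J" by (rule U_rel_entry[OF s]) (use False i in auto)
    then have "\<sigma> $ (- k) $ (- i) \<in> J" using that by (simp add: mat_def)
    then show ?thesis unfolding T_def by (rule J_left)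
  qed
  then have "(\<Sum>k\<in>UNIV - {i}. T k) \<in> J" by (intro ideal.subspace_sum[OF Js]) auto
  then have "- (\<Sum>k\<in>UNIV - {i}. T k) \<in> J" by (rule J_neg)
  also have "- (\<Sum>k\<in>UNIV - {i}. T k) = T i" using minus_unique[of "\<Sum>k\<in>UNIV - {i}. T k" "T i"] sum by (simp add: add.commute)
  finally have "T i \<in> J" .
  moreover have "\<sigma> $ (- i) $ (- i) - 1 \<in> J" using U_rel_entry[OF s, of "- i" "- i"] i by (simp add: mat_def)
  ultimately have "T i - cj (\<sigma> $ i $ Zero * y) * wt F i * (\<sigma> $ (- i) $ (- i) - 1) \<in> J"
    by (rule J_diff[OF _ J_left])
  then have "cj (\<sigma> $ i $ Zero * y) * wt F i \<in> J" by (simp add: T_def algebra_simps)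
  then have "cj (cj (\<sigma> $ i $ Zero * y) * wt F i) * wt F i \<in> J" by (rule J_right[OF J_cj])
  also have "cj (cj (\<sigma> $ i $ Zero * y) * wt F i) * wt F i = \<sigma> $ i $ Zero * y * (wt F i * cj (wt F i))"
    by (simp add: mult_ac)
  finally show ?thesis using i by simp
qed

lemma U_rel_vec:
  assumes s: "\<sigma> \<in> U_rel F (J, S)" and i: "i \<noteq> Zero" and v: "v $ Zero \<in> JD"
  shows "(\<sigma> *v v) $ i - v $ i \<in> J"
proof -
  have "(\<sigma> *v v) $ i - v $ i = (\<Sum>k\<in>UNIV. (\<sigma> $ i $ k - mat 1 $ i $ k) * v $ k)"
  proof -
    have "(\<Sum>k\<in>UNIV. mat 1 $ i $ k * v $ k) = v $ i"
      using matrix_vector_mul_lid[of v] by (simp add: matrix_vector_mult_def vec_eq_iff)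
    then show ?thesis by (simp add: matrix_vector_mult_def left_diff_distrib sum_subtractf)
  qed
  also have "\<dots> \<in> J"
  proof (rule ideal.subspace_sum[OF Js])
    fix k show "(\<sigma> $ i $ k - mat 1 $ i $ k) * v $ k \<in> J"
    proof (cases "k = Zero")
      case True then show ?thesis using U_rel_column[OF s i v] i by (simp add: mat_def)
    next
      case False show ?thesis by (rule J_right[OF U_rel_entry[OF s i False]])
    qed
  qed
  finally show ?thesis .
qed

lemma U_rel_I:
  assumes "unitary \<sigma>" and v: "\<And>v i. v $ Zero \<in> JD \<Longrightarrow> i \<noteq> Zero \<Longrightarrow> (\<sigma> *v v) $ i - v $ i \<in> J"
    and "\<And>v. v $ Zero \<in> JD \<Longrightarrow> displ \<sigma> v \<in> S"
  shows "\<sigma> \<in> U_rel F (J, S)"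
proof -
  have "\<sigma> $ i $ j - mat 1 $ i $ j \<in> J" if "i \<noteq> Zero" "j \<noteq> Zero" for i j
    using v[of "axis j 1" i] that JD_zero by (simp add: matrix_vector_axis axis_nth_if mat_def)
  then show ?thesis using assms by (simp add: U_rel_iff)
qed

lemma U_rel_subgroup: "subgroup (U_rel F (J, S)) (unitary_group F :: ('a, 'n::finite) matrix monoid)"
proof (rule U.subgroupI)
  let ?UR = "U_rel F (J, S) :: ('a, 'n) matrix set"
  show "?UR \<subseteq> carrier U" using U_rel_unitary by auto
  have "displ (mat 1) v = (0, 0)" for v :: "('a, 'n) column"
    unfolding displ_def by (cases "Q v") (simp add: algebra_simps)
  then have "mat 1 \<in> ?UR" by (intro U_rel_I) (simp_all add: J_zero S_zero)
  then show "?UR \<noteq> {}" by blast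
  show "\<sigma> \<otimes>\<^bsub>U\<^esub> \<tau> \<in> ?UR" if s: "\<sigma> \<in> ?UR" and t: "\<tau> \<in> ?UR" for \<sigma> \<tau>
    unfolding mult_U
  proof (rule U_rel_I)
    note u = U_rel_unitary[OF s] U_rel_unitary[OF t]
    show "unitary (\<sigma> ** \<tau>)" using u by (rule unitary_mult)
    fix v :: "('a, 'n) column" assume v: "v $ Zero \<in> JD"
    then have tv: "(\<tau> *v v) $ Zero \<in> JD" by (rule unitary_JD_vec[OF u(2)])
    show "displ (\<sigma> ** \<tau>) v \<in> S" unfolding displ_mult by (intro S_mult U_rel_displ[OF s tv] U_rel_displ[OF t v])
    fix i :: "'n idx" assume i: "i \<noteq> Zero"
    have "((\<sigma> *v (\<tau> *v v)) $ i - (\<tau> *v v) $ i) + ((\<tau> *v v) $ i - v $ i) \<in> J"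
      by (intro J_add U_rel_vec[OF s i tv] U_rel_vec[OF t i v])
    then show "((\<sigma> ** \<tau>) *v v) $ i - v $ i \<in> J" by (simp flip: matrix_vector_mul_assoc)
  qed
  show "iv \<sigma> \<in> ?UR" if s: "\<sigma> \<in> ?UR" for \<sigma>
  proof (rule U_rel_I)
    note u = U_rel_unitary[OF s]
    show ui: "unitary (iv \<sigma>)" using u by simp
    fix v :: "('a, 'n) column" assume v: "v $ Zero \<in> JD"
    then have tv: "(iv \<sigma> *v v) $ Zero \<in> JD" by (rule unitary_JD_vec[OF ui])
    have "displ (iv \<sigma>) v = \<dotminus> (displ \<sigma> (iv \<sigma> *v v))"
      unfolding displ_def heis_minus_inv using u by simp
    then show "displ (iv \<sigma>) v \<in> S" using S_inv[OF U_rel_displ[OF s tv]] by simp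
    fix i :: "'n idx" assume i: "i \<noteq> Zero"
    from J_neg[OF U_rel_vec[OF s i tv]] show "(iv \<sigma> *v v) $ i - v $ i \<in> J" using u by simp
  qed
qed

section \<open>Matrices of a given level\<close>

text \<open>The generators that the matrix contributes to the upper level lie in \<open>(J, S)\<close>.\<close>

definition in_level :: "('a, 'n::finite) matrix \<Rightarrow> bool" where
  "in_level \<sigma> \<longleftrightarrow> unitary \<sigma> \<and> ideal_level J \<sigma> \<and> (\<forall>j. j \<noteq> Zero \<longrightarrow> Q (\<sigma> *v axis j 1) \<in> S) \<and>
     (\<forall>i y z. i \<noteq> Zero \<longrightarrow> (y, z) \<in> D \<longrightarrow> mixed \<sigma> i y z \<in> S)"

lemma in_levelD:
  assumes "in_level \<sigma>"
  shows "unitary \<sigma>" "ideal_level J \<sigma>" "\<And>j. j \<noteq> Zero \<Longrightarrow> Q (\<sigma> *v axis j 1) \<in> S"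
    "\<And>i y z. i \<noteq> Zero \<Longrightarrow> (y, z) \<in> D \<Longrightarrow> mixed \<sigma> i y z \<in> S"
  using assms by (auto simp: in_level_def)

text \<open>Modulo the level such a matrix acts as a scalar, any of its diagonal entries.  This is the statement
  for hyperbolic coordinates, the next one for the coordinate \<open>Zero\<close>, and \<open>in_level_displ\<close> that for \<open>Q\<close>.\<close>

lemma in_level_vec:
  assumes c: "in_level \<sigma>" and i: "i \<noteq> Zero" and k: "k \<noteq> Zero" and v: "v $ Zero \<in> JD"
  shows "(\<sigma> *v v) $ i - v $ i * \<sigma> $ k $ k \<in> J"
proof -
  note l = in_levelD(2)[OF c]
  have "v $ i * \<sigma> $ k $ k = (\<Sum>m\<in>UNIV. if m = i then v $ m * \<sigma> $ k $ k else 0)" by simp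
  then have "(\<sigma> *v v) $ i - v $ i * \<sigma> $ k $ k = (\<Sum>m\<in>UNIV. \<sigma> $ i $ m * v $ m - (if m = i then v $ m * \<sigma> $ k $ k else 0))"
    by (simp only: sum_subtractf matrix_vector_mult_def vec_lambda_beta)
  also have "\<dots> \<in> J"
  proof (rule ideal.subspace_sum[OF Js])
    fix m show "\<sigma> $ i $ m * v $ m - (if m = i then v $ m * \<sigma> $ k $ k else 0) \<in> J"
    proof (cases "m = i")
      case True
      have "(\<sigma> $ i $ i - \<sigma> $ k $ k) * v $ i \<in> J" by (intro J_right ideal_level_diag[OF l Js i k])
      then show ?thesis using True by (simp add: algebra_simps)
    next
      case False
      then show ?thesis using ideal_level_column[OF l i v] ideal_level_off[OF l i, of m] J_right by (cases "m = Zero") auto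
    qed
  qed
  finally show ?thesis .
qed

lemma in_level_Zero:
  assumes c: "in_level \<sigma>" and k: "k \<noteq> Zero" and v: "v $ Zero \<in> JD"
  shows "(\<sigma> *v v) $ Zero - \<sigma> $ k $ k * v $ Zero \<in> Jt"
  unfolding Jt_def
proof (intro CollectI ballI)
  fix y assume y: "y \<in> JD"
  note l = in_levelD(2)[OF c]
  have "cj y * mu F * ((\<sigma> *v v) $ Zero - \<sigma> $ k $ k * v $ Zero)
    = (\<Sum>m\<in>UNIV. cj y * mu F * (\<sigma> $ Zero $ m - (if m = Zero then \<sigma> $ k $ k else 0)) * v $ m)"
  proof -
    have "\<sigma> $ k $ k * v $ Zero = (\<Sum>m\<in>UNIV. (if m = Zero then \<sigma> $ k $ k else 0) * v $ m)"
      by (simp add: if_distrib[of "\<lambda>x. x * _"] cong: if_cong)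
    then show ?thesis
      by (simp only: matrix_vector_mult_def vec_lambda_beta mult.assoc sum_distrib_left[symmetric]
          left_diff_distrib sum_subtractf)
  qed
  also have "\<dots> \<in> J"
  proof (rule ideal.subspace_sum[OF Js])
    fix m show "cj y * mu F * (\<sigma> $ Zero $ m - (if m = Zero then \<sigma> $ k $ k else 0)) * v $ m \<in> J"
      using ideal_level_zero[OF l k y v] J_right[OF ideal_level_row[OF l _ y, of m], of "v $ m"] by (cases "m = Zero") auto
  qed
  finally show "cj y * mu F * ((\<sigma> *v v) $ Zero - \<sigma> $ k $ k * v $ Zero) \<in> J" .
qed

lemma pr_cong:
  assumes s: "cj s * s - 1 \<in> J" and u: "\<And>i. i \<noteq> Zero \<Longrightarrow> u' $ i - u $ i * s \<in> J" and v: "\<And>i. i \<noteq> Zero \<Longrightarrow> v' $ i - v $ i * s \<in> J"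
  shows "pr u' v' - pr u v \<in> J"
proof -
  have "pr (u' - s *s u) v' \<in> J" by (rule pr_ideal[OF J_inv]) (use u in \<open>simp add: mult.commute\<close>)
  moreover have "pr (s *s u) (v' - s *s v) \<in> J" by (rule pr_ideal[OF J_inv]) (use v in \<open>simp add: mult.commute\<close>)
  moreover have "(cj s * s - 1) * pr u v \<in> J" using s by (rule J_right)
  ultimately have "pr (u' - s *s u) v' + pr (s *s u) (v' - s *s v) + (cj s * s - 1) * pr u v \<in> J"
    by (intro J_add)
  then show ?thesis by (simp add: pr_linear algebra_simps)
qed

lemma displ_axis: "j \<noteq> Zero \<Longrightarrow> displ \<sigma> (axis j a) = act (Q (\<sigma> *v axis j 1)) a"
proof -
  assume "j \<noteq> Zero"
  then have "displ \<sigma> (axis j 1) = Q (\<sigma> *v axis j 1)"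
    unfolding displ_def by (cases "Q (\<sigma> *v axis j 1)") (simp add: Q_axis)
  then show ?thesis using displ_scale[of \<sigma> a "axis j 1"] by (simp add: axis_scale)
qed

text \<open>For quadratic statements, which are additive up to a correction, on vectors without coordinate
  \<open>Zero\<close>.\<close>

lemma hb_induct:
  fixes v :: "('a, 'n::finite) column"
  assumes "v $ Zero = 0" and v: "\<And>i. i \<noteq> Zero \<Longrightarrow> v $ i \<in> A" and A: "ideal.subspace A"
    and zero: "P 0" and ax: "\<And>i a. i \<noteq> Zero \<Longrightarrow> a \<in> A \<Longrightarrow> P (axis i a)"
    and add: "\<And>u v. u $ Zero = 0 \<Longrightarrow> v $ Zero = 0 \<Longrightarrow> (\<And>i. i \<noteq> Zero \<Longrightarrow> u $ i \<in> A) \<Longrightarrow> (\<And>i. i \<noteq> Zero \<Longrightarrow> v $ i \<in> A)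
      \<Longrightarrow> P u \<Longrightarrow> P v \<Longrightarrow> P (u + v)"
  shows "P v"
proof -
  have "P (\<Sum>i\<in>X. axis i (v $ i))" if "X \<subseteq> UNIV - {Zero}" for X
    using finite[of X] that
  proof (induction X rule: finite_induct)
    case empty then show ?case using zero by simp
  next
    case (insert i X)
    have X: "(\<Sum>i\<in>X. axis i (v $ i)) $ k = (if k \<in> X then v $ k else 0)" for k
      by (simp add: axis_nth_if)
    have "P (axis i (v $ i) + (\<Sum>i\<in>X. axis i (v $ i)))"
      using insert v ideal.subspace_0[OF A]
      by (intro add ax) (auto simp: X axis_nth_if simp del: sum_component)
    then show ?case using insert by simp
  qed
  from this[of "UNIV - {Zero}"] have "P (\<Sum>i\<in>UNIV - {Zero}. axis i (v $ i))" by simp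
  moreover have "(\<Sum>i\<in>UNIV - {Zero}. axis i (v $ i)) = v"
    using assms(1) by (auto simp: vec_eq_iff axis_nth_if)
  ultimately show ?thesis by simp
qed

lemma in_level_displ_hb:
  fixes \<sigma> :: "('a, 'n::finite) matrix"
  assumes c: "in_level \<sigma>" and v: "v $ Zero = 0"
  shows "displ \<sigma> v \<in> S"
proof (rule hb_induct[where A = UNIV and P = "\<lambda>v. displ \<sigma> v \<in> S", OF v _ ideal.subspace_UNIV])
  note us = in_levelD(1)[OF c]
  obtain k :: "'n idx" where k: "k \<noteq> Zero" by (metis idx.distinct(1))
  have "displ \<sigma> 0 = (0, 0)" by (simp add: displ_def Q_eq pr_def)
  then show "displ \<sigma> 0 \<in> S" by (simp add: S_zero)
  show "displ \<sigma> (axis i a) \<in> S" if "i \<noteq> Zero" for i a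
    unfolding displ_axis[OF that] by (intro S_act in_levelD(3)[OF c] that)
  show "displ \<sigma> (u + w) \<in> S" if u0: "u $ Zero = 0" "w $ Zero = 0" and "displ \<sigma> u \<in> S" "displ \<sigma> w \<in> S" for u w
  proof -
    have "pr (\<sigma> *v u) (\<sigma> *v w) - pr u w \<in> J"
      by (rule pr_cong[OF ideal_level_norm[OF in_levelD(2)[OF c] J_inv us k k]]) (use in_level_vec[OF c _ k] u0 JD_zero in auto)
    then show ?thesis
      unfolding displ_add[OF us] using that by (intro S_mult S_trc) (simp_all add: J_zero)
  qed
qed auto

text \<open>The displacement caused by the scalar \<open>s\<close> on a vector whose coordinate \<open>Zero\<close> is the first component of
  \<open>\<alpha>\<close>.\<close>

definition twist :: "'a \<Rightarrow> 'a \<times> 'a \<Rightarrow> 'a \<times> 'a" where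
  "twist s \<alpha> = act \<alpha> s \<dotplus> \<dotminus> \<alpha>"

text \<open>The key to the second inclusion.  On hyperbolic vectors the displacement is in \<open>S\<close> because the columns
  are; on the basis vector \<open>Zero\<close> it is a generator of the second kind times a twist, by the definition of these
  generators; and both parts are combined by \<open>displ_add\<close>.\<close>

lemma in_level_displ:
  fixes \<sigma> :: "('a, 'n::finite) matrix"
  assumes c: "in_level \<sigma>" and k: "k \<noteq> Zero" and a: "\<alpha> \<in> D" and v: "fst \<alpha> = v $ Zero"
  shows "\<exists>m\<in>S. displ \<sigma> v = m \<dotplus> twist (\<sigma> $ k $ k) \<alpha>"
proof -
  note us = in_levelD(1)[OF c]
  obtain y z where yz: "\<alpha> = (y, z)" by fastforce
  have y: "y \<in> JD" "v $ Zero = y" using a v yz by (auto simp: JD_iff)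
  define v0 :: "('a, 'n) column" where "v0 = axis Zero y"
  have v0Z: "v0 $ Zero = y" by (simp add: v0_def axis_nth_if)
  define v1 where "v1 = v - v0"
  have v1: "v1 $ Zero = 0" "v = v0 + v1" using y by (simp_all add: v1_def v0_def axis_nth_if)
  define s where "s = \<sigma> $ k $ k"
  define G where "G = twist s \<alpha>"
  define p where "p = cj ((\<sigma> *v v1) $ Zero - v1 $ Zero) * mu F * v0 $ Zero + (pr (\<sigma> *v v0) (\<sigma> *v v1) - pr v0 v1)"
  have "displ \<sigma> v0 = mixed \<sigma> k y z \<dotplus> G"
  proof -
    have "Q (\<sigma> *v v0) = act (Q (\<sigma> *v axis Zero 1)) y"
      using Q_scale[of y "\<sigma> *v axis Zero 1"] matrix_vector_scale_right[of \<sigma> y "axis Zero 1"] by (simp add: axis_scale v0_def)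
    moreover have "Q v0 = (y, 0)" by (simp add: v0_def Q_eq axis_nth_if)
    moreover obtain a b where "Q (\<sigma> *v axis Zero 1) = (a, b)" by fastforce
    ultimately show ?thesis
      unfolding displ_def mixed_def G_def twist_def yz s_def by (simp add: algebra_simps)
  qed
  then have "displ \<sigma> v = mixed \<sigma> k y z \<dotplus> G \<dotplus> displ \<sigma> v1 \<dotplus> trc p"
    unfolding v1(2) displ_add[OF us] p_def by simp
  also have "\<dots> = (mixed \<sigma> k y z \<dotplus> trc p \<dotplus> (G \<dotplus> displ \<sigma> v1 \<dotplus> \<dotminus> G)) \<dotplus> G"
    by (cases "mixed \<sigma> k y z"; cases G; cases "displ \<sigma> v1") (simp add: algebra_simps)
  finally have "displ \<sigma> v = (mixed \<sigma> k y z \<dotplus> trc p \<dotplus> (G \<dotplus> displ \<sigma> v1 \<dotplus> \<dotminus> G)) \<dotplus> G" .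
  moreover have "trc p \<in> S"
  proof (rule S_trc)
    have "(\<sigma> *v v1) $ Zero - v1 $ Zero \<in> Jt"
      using in_level_Zero[OF c k, of v1] v1(1) JD_zero by simp
    then have "cj ((\<sigma> *v v1) $ Zero - v1 $ Zero) * mu F * v0 $ Zero \<in> J"
      using y by (intro Jt_pair) (simp_all add: v0_def axis_nth_if)
    moreover have "pr (\<sigma> *v v0) (\<sigma> *v v1) - pr v0 v1 \<in> J"
      by (rule pr_cong[OF ideal_level_norm[OF in_levelD(2)[OF c] J_inv us k k]])
        (auto intro!: in_level_vec[OF c _ k] simp: v0Z v1(1) y JD_zero)
    ultimately show "p \<in> J" unfolding p_def by (rule J_add)
  qed
  moreover have "G \<dotplus> displ \<sigma> v1 \<dotplus> \<dotminus> G \<in> S"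
  proof (rule S_normal[OF in_level_displ_hb[OF c v1(1)]])
    have "fst G = y * s - y" unfolding G_def twist_def fst_mult fst_inv fst_act yz by simp
    then show "fst G \<in> JD" using y by (simp add: JD_diff JD_mult)
  qed
  moreover have "mixed \<sigma> k y z \<in> S" using in_levelD(4)[OF c k] a yz by simp
  ultimately show ?thesis using S_mult unfolding G_def s_def by metis
qed

text \<open>By \<open>in_level_displ\<close> the displacements of \<open>v\<close> and of its image under \<open>\<rho>\<close> are twists modulo \<open>S\<close>.  The
  latter twist may be computed with \<open>displ \<rho> v\<close> times the element used for \<open>v\<close>; then everything cancels except elements
  of \<open>S\<close>.\<close>

lemma in_level_conj:
  fixes \<sigma> :: "('a, 'n::finite) matrix"
  assumes c: "in_level \<sigma>" and r: "\<rho> \<in> U_rel F (J, S)"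
  shows "\<sigma> ** \<rho> ** iv \<sigma> \<in> U_rel F (J, S)"
proof (rule U_rel_I)
  note us = in_levelD(1)[OF c] and ur = U_rel_unitary[OF r]
  obtain k :: "'n idx" where k: "k \<noteq> Zero" by (metis idx.distinct(1))
  show "unitary (\<sigma> ** \<rho> ** iv \<sigma>)" using us ur by (simp add: unitary_mult)
  fix u :: "('a, 'n) column" assume u: "u $ Zero \<in> JD"
  define v where "v = iv \<sigma> *v u"
  have v: "v $ Zero \<in> JD" unfolding v_def using us u by (intro unitary_JD_vec) auto
  have uv: "u = \<sigma> *v v" using us by (simp add: v_def)
  have e: "(\<sigma> ** \<rho> ** iv \<sigma>) *v u = \<sigma> *v (\<rho> *v v)" by (simp add: v_def flip: matrix_vector_mul_assoc)
  have rv: "(\<rho> *v v) $ Zero \<in> JD" by (rule unitary_JD_vec[OF ur v])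
  have R: "displ \<rho> v \<in> S" by (rule U_rel_displ[OF r v])
  obtain z where z: "(v $ Zero, z) \<in> D" using v by (auto simp: JD_iff)
  define A where "A = displ \<rho> v"
  define D0 where "D0 = (v $ Zero, z)"
  have AD: "A \<dotplus> D0 \<in> D" using R S_D z by (auto simp: A_def D0_def intro!: D_mult simp del: heis_mult)
  have fAD: "fst (A \<dotplus> D0) = (\<rho> *v v) $ Zero" by (simp only: fst_mult) (simp add: A_def D0_def displ_fst)
  obtain m1 where m1: "m1 \<in> S" "displ \<sigma> (\<rho> *v v) = m1 \<dotplus> twist (\<sigma> $ k $ k) (A \<dotplus> D0)"
    using in_level_displ[OF c k AD fAD] by blast
  obtain m2 where m2: "m2 \<in> S" "displ \<sigma> v = m2 \<dotplus> twist (\<sigma> $ k $ k) D0"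
    using in_level_displ[OF c k z, of v] by (auto simp: D0_def)
  have "displ (\<sigma> ** \<rho> ** iv \<sigma>) u = displ \<sigma> (\<rho> *v v) \<dotplus> displ \<rho> v \<dotplus> \<dotminus> (displ \<sigma> v)"
    unfolding displ_def[of "\<sigma> ** \<rho> ** iv \<sigma>"] displ_def[of \<sigma>] displ_def[of \<rho>] e heis_minus_inv heis_minus_trans uv[symmetric] ..
  also have "\<dots> = m1 \<dotplus> act A (\<sigma> $ k $ k) \<dotplus> \<dotminus> m2"
    unfolding m1 m2 A_def[symmetric] twist_def heis_act_mult
    by (simp only: heis_assoc heis_inv_mult heis_cancel heis_inv_inv)
  finally show "displ (\<sigma> ** \<rho> ** iv \<sigma>) u \<in> S" using m1(1) m2(1) R by (simp only: S_mult S_inv S_act A_def)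
  fix i :: "'n idx" assume i: "i \<noteq> Zero"
  let ?s = "\<sigma> $ k $ k"
  have "((\<sigma> *v (\<rho> *v v)) $ i - (\<rho> *v v) $ i * ?s) + ((\<rho> *v v) $ i - v $ i) * ?s - ((\<sigma> *v v) $ i - v $ i * ?s) \<in> J"
    by (intro J_diff[OF J_add] J_right in_level_vec[OF c i k] U_rel_vec[OF r i v] v rv)
  also have "((\<sigma> *v (\<rho> *v v)) $ i - (\<rho> *v v) $ i * ?s) + ((\<rho> *v v) $ i - v $ i) * ?s - ((\<sigma> *v v) $ i - v $ i * ?s)
    = (\<sigma> *v (\<rho> *v v)) $ i - (\<sigma> *v v) $ i" by (simp add: algebra_simps)
  finally show "((\<sigma> ** \<rho> ** iv \<sigma>) *v u) $ i - u $ i \<in> J" unfolding e by (simp only: uv)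
qed

text \<open>Multiplication by \<open>\<rho>\<close> changes all generators by displacements of \<open>\<rho>\<close>, by entries of \<open>\<rho> - 1\<close> times
  entries of \<open>\<sigma>\<close>, or by elements of \<open>S\<close> that stem from the change of the diagonal entry.\<close>

lemma in_level_U_rel_mult:
  fixes \<sigma> :: "('a, 'n::finite) matrix"
  assumes r: "\<rho> \<in> U_rel F (J, S)" and c: "in_level \<sigma>"
  shows "in_level (\<rho> ** \<sigma>)"
  unfolding in_level_def
proof (intro conjI allI impI)
  note us = in_levelD(1)[OF c] and ur = U_rel_unitary[OF r] and l = in_levelD(2)[OF c]
  show "unitary (\<rho> ** \<sigma>)" using ur us by (rule unitary_mult)
  have entry: "(\<rho> ** \<sigma>) $ i $ j - \<sigma> $ i $ j \<in> J" if "i \<noteq> Zero" "j \<noteq> Zero" for i j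
    using U_rel_vec[OF r that(1), of "\<sigma> *v axis j 1"] unitary_JD[OF us that(2)]
    by (simp add: matrix_vector_axis matrix_vector_mul_assoc)
  have column: "(\<rho> ** \<sigma>) $ i $ Zero * y - \<sigma> $ i $ Zero * y \<in> J" if "i \<noteq> Zero" "y \<in> JD" for i y
    using U_rel_vec[OF r that(1), of "\<sigma> *v axis Zero y"] unitary_JD_vec[OF us, of "axis Zero y"] that(2)
    by (simp add: matrix_vector_axis matrix_vector_mul_assoc axis_nth_if)
  have row: "(\<rho> ** \<sigma>) $ Zero $ j * a - \<sigma> $ Zero $ j * a \<in> Jt" if "axis j a $ Zero \<in> JD" for j a
  proof -
    have "(\<sigma> *v axis j a) $ Zero \<in> JD" by (rule unitary_JD_vec[OF us that])
    from S_Jt[OF U_rel_displ[OF r this]] show ?thesis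
      by (simp add: displ_fst matrix_vector_axis matrix_vector_mul_assoc)
  qed
  show "ideal_level J (\<rho> ** \<sigma>)"
    unfolding ideal_level_def
  proof (intro conjI allI impI ballI)
    fix i j :: "'n idx" assume ij: "i \<noteq> Zero" "j \<noteq> Zero" "i \<noteq> j"
    show "(\<rho> ** \<sigma>) $ i $ j \<in> J" using J_add[OF entry[OF ij(1,2)] ideal_level_off[OF l ij]] by simp
    have "((\<rho> ** \<sigma>) $ i $ i - \<sigma> $ i $ i) - ((\<rho> ** \<sigma>) $ j $ j - \<sigma> $ j $ j) + (\<sigma> $ i $ i - \<sigma> $ j $ j) \<in> J"
      by (intro J_add J_diff entry ideal_level_diag[OF l Js] ij)
    then show "(\<rho> ** \<sigma>) $ i $ i - (\<rho> ** \<sigma>) $ j $ j \<in> J" by simp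
  next
    fix i :: "'n idx" and y assume i: "i \<noteq> Zero" and y: "y \<in> JD"
    show "(\<rho> ** \<sigma>) $ i $ Zero * y \<in> J" using J_add[OF column[OF i y] ideal_level_column[OF l i y]] by simp
    have "(\<rho> ** \<sigma>) $ Zero $ i * 1 - \<sigma> $ Zero $ i * 1 \<in> Jt" using i JD_zero by (intro row) (simp add: axis_nth_if)
    from J_add[OF Jt_pair(2)[OF this y] ideal_level_row[OF l i y]] show "cj y * mu F * (\<rho> ** \<sigma>) $ Zero $ i \<in> J"
      by (simp add: algebra_simps)
    fix z assume z: "z \<in> JD"
    have "(\<rho> ** \<sigma>) $ Zero $ Zero * z - \<sigma> $ Zero $ Zero * z \<in> Jt" using z by (intro row) (simp add: axis_nth_if)
    from Jt_pair(2)[OF this y] have "cj y * mu F * ((\<rho> ** \<sigma>) $ Zero $ Zero * z - \<sigma> $ Zero $ Zero * z)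
      + cj y * mu F * (\<sigma> $ Zero $ Zero - \<sigma> $ i $ i) * z - ((\<rho> ** \<sigma>) $ i $ i - \<sigma> $ i $ i) * (cj y * mu F * z) \<in> J"
      by (intro J_diff[OF J_add] J_right[OF entry] ideal_level_zero[OF l] i y z)
    then show "cj y * mu F * ((\<rho> ** \<sigma>) $ Zero $ Zero - (\<rho> ** \<sigma>) $ i $ i) * z \<in> J" by (simp add: algebra_simps)
  qed
  fix j :: "'n idx" assume j: "j \<noteq> Zero"
  have "Q ((\<rho> ** \<sigma>) *v axis j 1) = displ \<rho> (\<sigma> *v axis j 1) \<dotplus> Q (\<sigma> *v axis j 1)"
    using displ_Q[of \<rho> "\<sigma> *v axis j 1"] by (simp add: matrix_vector_mul_assoc)
  moreover have "displ \<rho> (\<sigma> *v axis j 1) \<in> S"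
    by (rule U_rel_displ[OF r]) (simp add: matrix_vector_axis unitary_JD[OF us j])
  ultimately show "Q ((\<rho> ** \<sigma>) *v axis j 1) \<in> S"
    using S_mult in_levelD(3)[OF c j] by simp
next
  note us = in_levelD(1)[OF c] and ur = U_rel_unitary[OF r] and l = in_levelD(2)[OF c]
  fix i :: "'n idx" and y z assume i: "i \<noteq> Zero" and yz: "(y, z) \<in> D"
  have y: "y \<in> JD" using yz by (auto simp: JD_iff)
  define d where "d = \<sigma> $ i $ i - (\<rho> ** \<sigma>) $ i $ i"
  have d: "d \<in> J"
    using J_neg[OF U_rel_vec[OF r i, of "\<sigma> *v axis i 1"]] unitary_JD[OF us i]
    by (simp add: d_def matrix_vector_axis matrix_vector_mul_assoc)
  define p where "p = cj ((\<rho> ** \<sigma>) $ i $ i) * d * z"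
  have "act (Q ((\<rho> ** \<sigma>) *v axis Zero 1)) y = Q (\<rho> *v (\<sigma> *v axis Zero y))"
    "act (Q (\<sigma> *v axis Zero 1)) y = Q (\<sigma> *v axis Zero y)"
    using Q_scale[of y "(\<rho> ** \<sigma>) *v axis Zero 1"] Q_scale[of y "\<sigma> *v axis Zero 1"]
    by (simp_all add: axis_scale matrix_vector_mul_assoc flip: matrix_vector_scale_right)
  moreover have "\<dotminus> (act (y, z) ((\<rho> ** \<sigma>) $ i $ i)) = \<dotminus> (act (y, z) (\<sigma> $ i $ i))
    \<dotplus> act (y, z) d \<dotplus> trc p"
  proof -
    define e where "e = (\<rho> ** \<sigma>) $ i $ i"
    have si: "\<sigma> $ i $ i = d + e" by (simp add: d_def e_def)
    have cancel: "\<dotminus> (\<alpha> \<dotplus> \<beta> \<dotplus> trc x) \<dotplus> \<alpha> \<dotplus> trc x = \<dotminus> \<beta>" for \<alpha> \<beta> x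
      by (cases \<alpha>; cases \<beta>) (simp add: algebra_simps)
    show ?thesis
      unfolding p_def e_def[symmetric] si heis_act_add[OF yz, of d e] snd_conv cancel ..
  qed
  ultimately have "mixed (\<rho> ** \<sigma>) i y z = displ \<rho> (\<sigma> *v axis Zero y) \<dotplus> mixed \<sigma> i y z
    \<dotplus> act (y, z) d \<dotplus> trc p"
    unfolding mixed_def by (simp only: displ_Q[of \<rho>] heis_assoc)
  moreover have "displ \<rho> (\<sigma> *v axis Zero y) \<in> S"
    using y by (intro U_rel_displ[OF r] unitary_JD_vec[OF us]) (simp add: axis_nth_if)
  moreover have "trc p \<in> S" unfolding p_def by (intro S_trc J_left J_right d)
  ultimately show "mixed (\<rho> ** \<sigma>) i y z \<in> S"
    using in_levelD(4)[OF c i yz] S_Delta[OF yz d] by (simp only: S_mult)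
qed

text \<open>In the commutator of \<open>\<sigma>\<close> with an elementary matrix \<open>\<tau>\<close>, the matrix \<open>\<tau>\<close> is applied to \<open>\<sigma> v - s v\<close>,
  which is a vector of the following kind, and elementary matrices act on such vectors as elements of the congruence
  subgroup would.\<close>

definition small :: "('a, 'n::finite) column \<Rightarrow> bool" where
  "small v \<longleftrightarrow> v $ Zero \<in> Jt \<and> v $ Zero \<in> JD \<and> (\<forall>i. i \<noteq> Zero \<longrightarrow> v $ i \<in> J)"

definition preserves_small :: "('a, 'n::finite) matrix \<Rightarrow> bool" where
  "preserves_small \<tau> \<longleftrightarrow> unitary \<tau> \<and> (\<forall>v. small v \<longrightarrow> displ \<tau> v \<in> S \<and> (\<forall>i. i \<noteq> Zero \<longrightarrow> (\<tau> *v v) $ i \<in> J))"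

lemma preserves_small_image: "preserves_small \<tau> \<Longrightarrow> small v \<Longrightarrow> small (\<tau> *v v)"
proof -
  assume t: "preserves_small \<tau>" and v: "small v"
  then have "displ \<tau> v \<in> S" by (simp add: preserves_small_def)
  from S_Jt[OF this] S_JD[OF this] have "(\<tau> *v v) $ Zero - v $ Zero \<in> Jt" "(\<tau> *v v) $ Zero - v $ Zero \<in> JD"
    by (simp_all add: displ_fst)
  with v have "((\<tau> *v v) $ Zero - v $ Zero) + v $ Zero \<in> Jt" "((\<tau> *v v) $ Zero - v $ Zero) + v $ Zero \<in> JD"
    unfolding small_def by (auto simp only: intro: Jt_add JD_add)
  then show ?thesis using t v by (simp add: small_def preserves_small_def)
qed

lemma preserves_small_mult:
  fixes \<tau> \<tau>' :: "('a, 'n::finite) matrix"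
  assumes "preserves_small \<tau>" "preserves_small \<tau>'" shows "preserves_small (\<tau> ** \<tau>')"
  unfolding preserves_small_def
proof (intro conjI allI impI)
  show "unitary (\<tau> ** \<tau>')" using assms by (simp add: preserves_small_def unitary_mult)
  fix v :: "('a, 'n) column" assume v: "small v"
  note v' = preserves_small_image[OF assms(2) v]
  have "displ \<tau> (\<tau>' *v v) \<in> S" "displ \<tau>' v \<in> S" using assms v v' by (auto simp: preserves_small_def)
  then show "displ (\<tau> ** \<tau>') v \<in> S" unfolding displ_mult by (rule S_mult)
  show "((\<tau> ** \<tau>') *v v) $ i \<in> J" if "i \<noteq> Zero" for i
    using assms(1) v' that by (simp add: preserves_small_def flip: matrix_vector_mul_assoc)
qed

lemma preserves_small_tv:
  fixes v :: "('a, 'n::finite) column"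
  assumes i: "i \<noteq> Zero" and vi: "v $ (- i) = 0" and d: "(v $ Zero, pr v v + cj y) \<in> D"
  shows "preserves_small (tv (axis i 1) v y)"
  unfolding preserves_small_def
proof (intro conjI allI impI)
  define f :: "('a, 'n) column" where "f = axis i 1"
  show "unitary (tv (axis i 1) v y)" using assms by (rule tv_unitary)
  fix w :: "('a, 'n) column" assume w: "small w"
  have v0: "v $ Zero \<in> JD" using d by (auto simp: JD_iff)
  define t where "t = il * B f w"
  define s where "s = B v w + y * B f w"
  have tJ: "t \<in> J" using w i by (auto simp: t_def f_def small_def intro!: J_left)
  have "B v w \<in> J"
    unfolding B_eq_sum
  proof (rule ideal.subspace_sum[OF Js])
    fix k show "cj (v $ k) * wt F k * w $ (- k) \<in> J"
      using w Jt_pair(2)[OF _ v0, of "w $ Zero"] by (cases "k = Zero") (auto simp: small_def intro: J_left)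
  qed
  moreover have "B f w \<in> J" using w i by (auto simp: f_def small_def intro!: J_left)
  ultimately have sJ: "s \<in> J" unfolding s_def by (intro J_add J_left)
  have E: "tv f v y *v w = w + s *s f - t *s v" by (simp add: tv_vec t_def s_def)
  show "(tv (axis i 1) v y *v w) $ k \<in> J" if "k \<noteq> Zero" for k
    using E w that sJ tJ unfolding f_def[symmetric] by (auto simp: small_def intro!: J_add J_diff J_right)
  define z where "z = s * pr f w - t * pr v w - cj t * s * pr f v - cj t * s - cj t * t * cj y"
  have "z \<in> J" unfolding z_def using sJ tJ by (intro J_diff J_right J_cj) auto
  moreover have "displ (tv f v y) w = act (v $ Zero, pr v v + cj y) (- t) \<dotplus> trc z"
    unfolding displ_def z_def s_def t_def f_def by (rule tv_displ[OF i vi])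
  ultimately show "displ (tv (axis i 1) v y) w \<in> S"
    using S_Delta[OF d J_neg[OF tJ]] unfolding f_def by (simp only: S_mult S_trc)
qed

lemma preserves_small_EL:
  fixes \<tau> :: "('a, 'n::finite) matrix"
  shows "\<tau> \<in> EL \<Longrightarrow> preserves_small \<tau>"
proof (induction rule: EL_induct)
  case one
  have "displ (mat 1) v = (0, 0)" for v :: "('a, 'n) column"
    unfolding displ_def by (cases "Q v") (simp add: algebra_simps)
  then show ?case by (simp add: preserves_small_def small_def S_zero)
next
  case (sht i j x)
  then show ?case unfolding sht_def by (intro preserves_small_tv) (auto dest: rtD simp: axis_nth_if)
next
  case (ext i \<alpha>)
  then show ?case unfolding ext_def by (intro preserves_small_tv) (auto simp: axis_nth_if)
qed (rule preserves_small_mult)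

text \<open>With \<open>v = (\<tau>\<sigma>)\<^sup>-\<^sup>1 u\<close> the displacement of the commutator is
  \<open>\<phi>\<^sub>\<sigma>(\<tau> v) \<dotplus> \<phi>\<^sub>\<tau>(v)\<close> minus \<open>\<phi>\<^sub>\<tau>(\<sigma> v) \<dotplus> \<phi>\<^sub>\<sigma>(v)\<close>, where \<open>\<phi>\<close> is \<open>displ\<close>.  The displacements under
  \<open>\<sigma>\<close> are twists modulo \<open>S\<close>; the one of \<open>\<sigma> v = s v + \<delta>\<close> under \<open>\<tau>\<close> is \<open>\<phi>\<^sub>\<tau>(v) \<circ> s\<close> modulo \<open>S\<close>, because \<open>\<delta>\<close>
  is small.  The twist of \<open>\<tau> v\<close> is computed with \<open>\<phi>\<^sub>\<tau>(v) \<dotplus> (v\<^sub>0, z)\<close>, whereupon everything cancels.\<close>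

lemma in_level_commutator:
  fixes \<sigma> :: "('a, 'n::finite) matrix"
  assumes c: "in_level \<sigma>" and t: "\<tau> \<in> EL"
  shows "\<sigma> ** \<tau> ** iv \<sigma> ** iv \<tau> \<in> U_rel F (J, S)"
proof (rule U_rel_I)
  note us = in_levelD(1)[OF c] and ut = EL_unitary[OF t] and nt = preserves_small_EL[OF t]
  obtain k :: "'n idx" where k: "k \<noteq> Zero" by (metis idx.distinct(1))
  define s where "s = \<sigma> $ k $ k"
  show "unitary (\<sigma> ** \<tau> ** iv \<sigma> ** iv \<tau>)" using us ut by (simp add: unitary_mult)
  fix u :: "('a, 'n) column" assume u: "u $ Zero \<in> JD"
  define v where "v = iv \<sigma> *v (iv \<tau> *v u)"
  have v: "v $ Zero \<in> JD" unfolding v_def using us ut u by (intro unitary_JD_vec) auto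
  have uv: "u = \<tau> *v (\<sigma> *v v)" using us ut by (simp add: v_def)
  have e: "(\<sigma> ** \<tau> ** iv \<sigma> ** iv \<tau>) *v u = \<sigma> *v (\<tau> *v v)" by (simp add: v_def flip: matrix_vector_mul_assoc)
  have tv: "(\<tau> *v v) $ Zero \<in> JD" by (rule unitary_JD_vec[OF ut v])
  define \<delta> where "\<delta> = \<sigma> *v v - s *s v"
  have sv: "\<sigma> *v v = s *s v + \<delta>" by (simp add: \<delta>_def)
  have d: "small \<delta>"
    unfolding small_def
  proof (intro conjI allI impI)
    show "\<delta> $ Zero \<in> Jt" using in_level_Zero[OF c k v] by (simp add: \<delta>_def s_def)
    have "(\<sigma> *v v) $ Zero - v $ Zero * s \<in> JD" by (intro JD_diff JD_mult unitary_JD_vec[OF us] v)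
    then show "\<delta> $ Zero \<in> JD" by (simp add: \<delta>_def mult.commute)
    show "\<delta> $ i \<in> J" if "i \<noteq> Zero" for i
      using in_level_vec[OF c that k v] by (simp add: \<delta>_def s_def mult.commute)
  qed
  have td: "displ \<tau> \<delta> \<in> S" "\<And>i. i \<noteq> Zero \<Longrightarrow> (\<tau> *v \<delta>) $ i \<in> J" using nt d by (auto simp: preserves_small_def)
  obtain z where z: "(v $ Zero, z) \<in> D" using v by (auto simp: JD_iff)
  define A where "A = displ \<tau> v"
  define D0 where "D0 = (v $ Zero, z)"
  have AD: "A \<dotplus> D0 \<in> D" using displ_D[OF ut] z unfolding A_def D0_def by (rule D_mult)
  have fAD: "fst (A \<dotplus> D0) = (\<tau> *v v) $ Zero" by (simp only: fst_mult) (simp add: A_def D0_def displ_fst)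
  obtain m1 where m1: "m1 \<in> S" "displ \<sigma> (\<tau> *v v) = m1 \<dotplus> twist s (A \<dotplus> D0)"
    using in_level_displ[OF c k AD fAD] by (auto simp: s_def)
  obtain m2 where m2: "m2 \<in> S" "displ \<sigma> v = m2 \<dotplus> twist s D0"
    using in_level_displ[OF c k z, of v] by (auto simp: D0_def s_def)
  define p where "p = cj ((\<tau> *v \<delta>) $ Zero - \<delta> $ Zero) * mu F * (s *s v) $ Zero + (pr (\<tau> *v (s *s v)) (\<tau> *v \<delta>) - pr (s *s v) \<delta>)"
  define m3 where "m3 = displ \<tau> \<delta> \<dotplus> trc p"
  have m3: "displ \<tau> (\<sigma> *v v) = act A s \<dotplus> m3"
    unfolding sv displ_add[OF ut] displ_scale A_def m3_def p_def heis_assoc ..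
  have "p \<in> J"
  proof -
    have "(\<tau> *v \<delta>) $ Zero - \<delta> $ Zero \<in> Jt" using S_Jt[OF td(1)] by (simp add: displ_fst)
    then have 1: "cj ((\<tau> *v \<delta>) $ Zero - \<delta> $ Zero) * mu F * (s *s v) $ Zero \<in> J"
      by (rule Jt_pair(1)) (simp add: v JD_mult)
    have 2: "pr (\<tau> *v (s *s v)) (\<tau> *v \<delta>) \<in> J" "pr (s *s v) \<delta> \<in> J"
      using td(2) d by (auto intro!: pr_ideal[OF J_inv] simp: small_def)
    show ?thesis unfolding p_def by (intro J_add J_diff 1 2)
  qed
  then have m3S: "m3 \<in> S" unfolding m3_def by (intro S_mult S_trc td)
  have "displ (\<sigma> ** \<tau> ** iv \<sigma> ** iv \<tau>) u = (displ \<sigma> (\<tau> *v v) \<dotplus> displ \<tau> v) \<dotplus> \<dotminus> (displ \<tau> (\<sigma> *v v) \<dotplus> displ \<sigma> v)"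
    unfolding displ_def[of "\<sigma> ** \<tau> ** iv \<sigma> ** iv \<tau>"] displ_def[of \<sigma>] displ_def[of \<tau>] e heis_minus_trans heis_minus_inv uv[symmetric] ..
  also have "\<dots> = m1 \<dotplus> (act A s \<dotplus> \<dotminus> (m3 \<dotplus> m2) \<dotplus> \<dotminus> (act A s))"
    unfolding m1 m2 m3 A_def[symmetric] twist_def heis_act_mult
    by (simp only: heis_assoc heis_inv_mult heis_cancel heis_inv_inv heis.l_inv heis_carrier UNIV_I heis_one heis_one_mult)
  also have "\<dots> \<in> S"
  proof (rule S_mult[OF m1(1) S_normal[OF S_inv[OF S_mult[OF m3S m2(1)]]]])
    have "fst A \<in> JD" using displ_D[OF ut, of v] by (cases A) (auto simp: A_def JD_iff)
    then show "fst (act A s) \<in> JD" by (simp add: fst_act JD_mult)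
  qed
  finally show "displ (\<sigma> ** \<tau> ** iv \<sigma> ** iv \<tau>) u \<in> S" .
  fix i :: "'n idx" assume i: "i \<noteq> Zero"
  have "((\<sigma> *v (\<tau> *v v)) $ i - (\<tau> *v v) $ i * s) - (\<tau> *v \<delta>) $ i \<in> J"
    unfolding s_def by (intro J_diff in_level_vec[OF c i k tv] td i)
  also have "((\<sigma> *v (\<tau> *v v)) $ i - (\<tau> *v v) $ i * s) - (\<tau> *v \<delta>) $ i = (\<sigma> *v (\<tau> *v v)) $ i - (\<tau> *v (\<sigma> *v v)) $ i"
    by (simp add: \<delta>_def mv_linear mult.commute)
  finally show "((\<sigma> ** \<tau> ** iv \<sigma> ** iv \<tau>) *v u) $ i - u $ i \<in> J" unfolding e by (simp only: uv)
qed

text \<open>\<open>\<tau>\<sigma>\<tau>\<^sup>-\<^sup>1\<close> is the inverse of the commutator, times \<open>\<sigma>\<close>.\<close>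

lemma in_level_EL_conj:
  assumes c: "in_level \<sigma>" and t: "\<tau> \<in> EL"
  shows "in_level (\<tau> ** \<sigma> ** iv \<tau>)"
proof -
  note u = in_levelD(1)[OF c] EL_unitary[OF t]
  have "iv (\<sigma> ** \<tau> ** iv \<sigma> ** iv \<tau>) \<in> U_rel F (J, S)"
    using subgroup.m_inv_closed[OF U_rel_subgroup in_level_commutator[OF c t]] by simp
  from in_level_U_rel_mult[OF this c] show ?thesis
    using u by (simp add: iv_prod unitary_mult flip: matrix_mul_assoc)
qed

end

context hermitian_forms
begin

section \<open>Conjugation invariance of the upper level\<close>

definition upper_form :: "('a, 'n::finite) matrix set \<Rightarrow> ('a \<times> 'a) set" where
  "upper_form H = form_span (upper_ideal F H) (upper_form_gens F H) UNIV"

lemma upper_level_pair: "upper_level F H = (upper_ideal F H, upper_form H)"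
  by (simp add: upper_level_eq upper_form_def)

lemma upper_form_contains_gens: "\<alpha> \<in> upper_form_gens F H \<Longrightarrow> \<alpha> \<in> upper_form H"
  using form_span_in[OF inv_ideal_sub[OF upper_ideal_inv], of \<alpha> "upper_form_gens F H" 1 UNIV H]
  by (cases \<alpha>) (simp add: upper_form_def)

lemma upper_form_gens_fst:
  assumes "\<alpha> \<in> upper_form_gens F H" and y: "y \<in> JD"
  shows "cj y * mu F * fst \<alpha> \<in> upper_ideal F H"
proof -
  have l: "ideal_level (upper_ideal F H) \<sigma>" if "\<sigma> \<in> H" for \<sigma> using that by (rule upper_ideal_level)
  from assms(1) consider \<sigma> j where "\<sigma> \<in> H" "j \<noteq> Zero" "\<alpha> = Q (\<sigma> *v axis j 1)"
    | \<sigma> i y z where "\<sigma> \<in> H" "i \<noteq> Zero" "(y, z) \<in> D" "\<alpha> = mixed \<sigma> i y z"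
    unfolding upper_form_gens_eq by blast
  then show ?thesis
  proof cases
    case 1
    then show ?thesis using ideal_level_row[OF l _ y, of \<sigma> j] by (simp add: Q_eq matrix_vector_axis)
  next
    case (2 \<sigma> i y' z)
    then have "y' \<in> JD" by (auto simp: JD_iff)
    moreover have "fst \<alpha> = (\<sigma> $ Zero $ Zero - \<sigma> $ i $ i) * y'"
      unfolding 2 mixed_def fst_mult fst_inv fst_act by (simp add: Q_eq matrix_vector_axis algebra_simps)
    ultimately show ?thesis using ideal_level_zero[OF l _ y, of \<sigma> i y'] 2 by (simp add: mult.assoc)
  qed
qed

text \<open>First components are controlled on generators, and \<open>J\<close> with a tilde is an ideal.\<close>

lemma upper_form_level:
  assumes H: "H \<subseteq> carrier U"
  shows "form_level F (upper_ideal F H) (upper_form H)"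
proof unfold_locales
  let ?J = "upper_ideal F H"
  have Js: "ideal.subspace ?J" by (rule inv_ideal_sub[OF upper_ideal_inv])
  show "invariant_ideal F ?J" by (rule upper_ideal_inv)
  show "R_submodule F (upper_form H)" unfolding upper_form_def by (rule form_span_submodule[OF upper_ideal_inv]) simp
  show "upper_form H \<subseteq> D" unfolding upper_form_def by (rule form_span_D[OF upper_form_gens_D[OF H]])
  show "trc z \<in> upper_form H" if "z \<in> ?J" for z unfolding upper_form_def by (rule form_span_trc[OF that])
  show "act \<alpha> a \<in> upper_form H" if "\<alpha> \<in> D" "a \<in> ?J" for \<alpha> a
    unfolding upper_form_def by (rule form_span_Delta[OF Js that])
  fix \<alpha> y assume a: "\<alpha> \<in> upper_form H" and y: "y \<in> JD"
  define T where "T = {x. cj y * mu F * x \<in> ?J}"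
  have Ts: "ideal.subspace T"
    by (rule ideal.subspaceI)
      (auto simp: T_def distrib_left mult.left_commute[of "cj y * mu F"] intro: ideal.subspace_0 Js ideal.subspace_add ideal_mult_left)
  have "upper_form H \<subseteq> {\<alpha>. fst \<alpha> \<in> T}"
    unfolding upper_form_def
  proof (rule form_span_minimal[OF fst_subgroup[OF Ts]])
    show "trc z \<in> {\<alpha>. fst \<alpha> \<in> T}" for z using ideal.subspace_0[OF Ts] by simp
    show "act \<alpha> a \<in> {\<alpha>. fst \<alpha> \<in> T}" if "a \<in> ?J" for \<alpha> a
      using that ideal_mult_left[OF Js, of a "cj y * mu F * fst \<alpha>"] by (simp add: fst_act T_def mult.assoc)
    show "act \<alpha> b \<in> {\<alpha>. fst \<alpha> \<in> T}" if "\<alpha> \<in> upper_form_gens F H" for \<alpha> b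
      using upper_form_gens_fst[OF that y] ideal_mult_right[OF Ts, of "fst \<alpha>" b] by (simp add: fst_act T_def)
  qed
  then show "cj y * mu F * fst \<alpha> \<in> ?J" using a by (auto simp: T_def)
qed

lemma upper_in_level:
  assumes H: "H \<subseteq> carrier U" and s: "\<sigma> \<in> H"
  shows "form_level.in_level F (upper_ideal F H) (upper_form H) \<sigma>"
proof -
  interpret L: form_level F "upper_ideal F H" "upper_form H" by (rule upper_form_level[OF H])
  show ?thesis
    unfolding L.in_level_def
  proof (intro conjI allI impI upper_form_contains_gens)
    show "unitary \<sigma>" using H s by auto
    show "ideal_level (upper_ideal F H) \<sigma>" using s by (rule upper_ideal_level)
  qed (use s in \<open>unfold upper_form_gens_eq, blast+\<close>)
qed

lemma upper_level_minimal:
  assumes L: "form_level F J S" and c: "\<And>\<sigma>. \<sigma> \<in> H \<Longrightarrow> form_level.in_level F J S \<sigma>"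
  shows "upper_ideal F H \<subseteq> J" "upper_form H \<subseteq> S"
proof -
  interpret L: form_level F J S by (rule L)
  show J: "upper_ideal F H \<subseteq> J" by (rule upper_ideal_minimal[OF L.J_inv L.in_levelD(2)[OF c]])
  show "upper_form H \<subseteq> S"
    unfolding upper_form_def
  proof (rule form_span_minimal[OF L.S_subgroup])
    show "act \<alpha> b \<in> S" if "\<alpha> \<in> upper_form_gens F H" for \<alpha> b
      using that unfolding upper_form_gens_eq by (auto intro!: L.S_act L.in_levelD[OF c])
  qed (use J L.S_trc L.S_Delta in blast)+
qed

text \<open>The matrices of a given level are closed under conjugation by elementary matrices; applied to the
  level of the conjugate subgroup and the inverse matrix this shows that the upper level of \<open>H\<close> is contained in that of
  each conjugate.\<close>

lemma upper_level_conj: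
  fixes H :: "('a, 'n::finite) matrix set"
  assumes H: "H \<subseteq> carrier U" and g: "g \<in> EL"
  defines "H' \<equiv> (\<lambda>h. g ** h ** iv g) ` H"
  shows "upper_ideal F H \<subseteq> upper_ideal F H'" "upper_form H \<subseteq> upper_form H'"
proof -
  have ug: "unitary g" using g by (rule EL_unitary)
  have H': "H' \<subseteq> carrier U" using H ug by (auto simp: H'_def unitary_mult)
  interpret L: form_level F "upper_ideal F H'" "upper_form H'" by (rule upper_form_level[OF H'])
  have "L.in_level \<sigma>" if "\<sigma> \<in> H" for \<sigma>
  proof -
    have "L.in_level (iv g ** (g ** \<sigma> ** iv g) ** iv (iv g))"
      by (rule L.in_level_EL_conj[OF upper_in_level[OF H'] EL_iv[OF g]]) (use that in \<open>simp add: H'_def\<close>)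
    moreover have "iv g ** (g ** \<sigma> ** iv g) ** iv (iv g) = \<sigma>"
      using ug H that by (auto simp flip: matrix_mul_assoc)
    ultimately show ?thesis by simp
  qed
  from upper_level_minimal[OF L.form_level_axioms this]
  show "upper_ideal F H \<subseteq> upper_ideal F H'" "upper_form H \<subseteq> upper_form H'" by auto
qed

lemma form_span_mono: "A \<subseteq> A' \<Longrightarrow> Z \<subseteq> Z' \<Longrightarrow> invariant_ideal F A' \<Longrightarrow> form_span A Z K \<subseteq> form_span A' Z' K"
  by (rule form_span_minimal[OF form_span_subgroup]; (intro form_span_trc form_span_Delta[OF inv_ideal_sub] form_span_in[OF inv_ideal_sub])?; blast)

lemma EU_mono:
  assumes "A \<subseteq> A'" "S \<subseteq> S'" shows "EU F (A, S) \<subseteq> (EU F (A', S') :: ('a, 'n::finite) matrix set)"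
proof -
  have "signed F s S \<subseteq> signed F s S'" for s using assms(2) by (auto simp: signed_def)
  then show ?thesis
    unfolding EU_def prod.case using assms(1) by (intro U.mono_generate Un_mono) blast+
qed

lemma normal_EL_iff:
  "N \<lhd> U\<lparr>carrier := EL\<rparr> \<longleftrightarrow> subgroup N (U :: ('a, 'n::finite) matrix monoid) \<and> N \<subseteq> EL \<and> (\<forall>g\<in>EL. \<forall>x\<in>N. g ** x ** iv g \<in> N)"
proof -
  interpret EL: group "U\<lparr>carrier := EL\<rparr> :: ('a, 'n) matrix monoid"
    by (rule subgroup.subgroup_is_group[OF EL_subgroup U.group_axioms])
  have "subgroup N (U\<lparr>carrier := EL\<rparr>) \<longleftrightarrow> subgroup N U \<and> N \<subseteq> EL"
    using U.incl_subgroup[OF EL_subgroup, of N] U.subgroup_incl[OF _ EL_subgroup, of N] subgroup.subset[of N "U\<lparr>carrier := EL\<rparr>"]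
    by auto
  then show ?thesis
    unfolding EL.normal_inv_iff using U.m_inv_consistent[OF EL_subgroup] by auto
qed

lemma EU_rel_minimal: "N \<lhd> U\<lparr>carrier := EL\<rparr> \<Longrightarrow> EU F L \<subseteq> N \<Longrightarrow> EU_rel F L \<subseteq> N"
  unfolding EU_rel_def by (rule hull_minimal)

lemma EU_rel_normal:
  fixes L
  assumes "EU F L \<subseteq> (EL :: ('a, 'n::finite) matrix set)"
  shows "(EU_rel F L :: ('a, 'n) matrix set) \<lhd> U\<lparr>carrier := EL\<rparr>"
proof -
  have EL: "(EL :: ('a, 'n) matrix set) \<lhd> U\<lparr>carrier := EL\<rparr>"
    unfolding normal_EL_iff using EL_subgroup EL_mult EL_iv by blast
  have "subgroup (EU_rel F L) (U :: ('a, 'n) matrix monoid)"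
    unfolding EU_rel_def hull_def
    by (rule U.subgroups_Inter) (use assms EL in \<open>auto simp: normal_EL_iff\<close>)
  moreover have "EU_rel F L \<subseteq> (EL :: ('a, 'n) matrix set)" by (rule EU_rel_minimal[OF EL assms])
  moreover have "\<forall>g\<in>EL. \<forall>x\<in>EU_rel F L. g ** x ** iv g \<in> (EU_rel F L :: ('a, 'n) matrix set)"
    unfolding EU_rel_def hull_def by (auto simp: normal_EL_iff)
  ultimately show ?thesis unfolding normal_EL_iff by blast
qed

lemma normalizer_iff:
  "X \<subseteq> carrier U \<Longrightarrow> g \<in> normalizer U X \<longleftrightarrow> unitary g \<and> (\<lambda>h. g ** h ** iv g) ` X = X"
  by (auto simp: normalizer_def stabilizer_def l_coset_def r_coset_def)

text \<open>The elements of \<open>H\<close> are of the level in question, so \<open>in_level_conj\<close> and \<open>in_level_commutator\<close> apply to them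
  and to their inverses.\<close>

lemma upper_CU_rel:
  fixes H :: "('a, 'n::finite) matrix set"
  assumes H: "subgroup H U"
  shows "H \<subseteq> CU_rel F (upper_level F H)"
proof
  fix \<sigma> assume s: "\<sigma> \<in> H"
  have Hc: "H \<subseteq> carrier U" using H by (rule subgroup.subset)
  interpret L: form_level F "upper_ideal F H" "upper_form H" by (rule upper_form_level[OF Hc])
  let ?UR = "U_rel F (upper_ideal F H, upper_form H) :: ('a, 'n) matrix set"
  have us: "unitary \<sigma>" using Hc s by auto
  have conj: "\<tau> ** \<rho> ** iv \<tau> \<in> ?UR" if "\<tau> \<in> H" "\<rho> \<in> ?UR" for \<tau> \<rho>
    using that by (intro L.in_level_conj upper_in_level Hc)
  have URc: "?UR \<subseteq> carrier U" using L.U_rel_subgroup by (rule subgroup.subset)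
  have "(\<lambda>h. \<sigma> ** h ** iv \<sigma>) ` ?UR = ?UR"
  proof
    show "(\<lambda>h. \<sigma> ** h ** iv \<sigma>) ` ?UR \<subseteq> ?UR" using conj[OF s] by blast
    show "?UR \<subseteq> (\<lambda>h. \<sigma> ** h ** iv \<sigma>) ` ?UR"
    proof
      fix \<rho> assume r: "\<rho> \<in> ?UR"
      have "iv \<sigma> ** \<rho> ** \<sigma> \<in> ?UR"
        using conj[OF subgroup.m_inv_closed[OF H s] r] us by simp
      moreover have "\<rho> = \<sigma> ** (iv \<sigma> ** \<rho> ** \<sigma>) ** iv \<sigma>" using us by (simp flip: matrix_mul_assoc)
      ultimately show "\<rho> \<in> (\<lambda>h. \<sigma> ** h ** iv \<sigma>) ` ?UR" by (rule rev_image_eqI)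
    qed
  qed
  then have "\<sigma> \<in> NU_rel F (upper_level F H)"
    using us by (simp add: NU_rel_def upper_level_pair normalizer_iff[OF URc])
  moreover have "generate U {group_commutator U \<sigma> \<tau> | \<tau>. \<tau> \<in> EL} \<subseteq> ?UR"
    by (rule U.generate_subgroup_incl[OF _ L.U_rel_subgroup])
      (auto simp: group_commutator_def intro: L.in_level_commutator upper_in_level[OF Hc s])
  ultimately show "\<sigma> \<in> CU_rel F (upper_level F H)" by (simp add: CU_rel_def upper_level_pair)
qed

end

context relative_level
begin

section \<open>Normal closures\<close>

lemma prod_known: assumes H: "normalised H" shows "ideal_mult (upper_ideal F H) (pw 10) \<subseteq> known H"
proof
  fix x assume "x \<in> ideal_mult (upper_ideal F H) (pw 10)"
  then show "x \<in> known H"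
  proof (induction rule: ideal_mult_induct)
    case (mult c a b)
    then show ?case by (intro ideal_mult_left[OF known_sub[OF H]] upper_known[OF H, of _ _ 10]) simp_all
  qed (intro ideal.subspace_add ideal.subspace_0 known_sub[OF H]; assumption)+
qed

text \<open>After the action of an element of \<open>I\<^sup>1\<^sup>0\<close> the terms of \<open>\<Omega>\<^sup>J\<^sub>m\<^sub>i\<^sub>n\<close> have coefficients in \<open>J I\<^sup>1\<^sup>0\<close>, which are
  known; the generators are \<open>column_ext_in\<close> and \<open>mixed_ext_in\<close>.\<close>

lemma upper_form_ext_in:
  assumes H: "normalised H" and a: "\<alpha> \<in> upper_form H" and b: "b \<in> pw 10"
  shows "act \<alpha> b \<in> ext_in H"
proof -
  let ?T = "{\<alpha>. act \<alpha> b \<in> ext_in H}"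
  note G = ext_in_subgroup[OF H]
  have "subgroup ?T HG"
    using subgroup.one_closed[OF G] subgroup.m_closed[OF G] subgroup.m_inv_closed[OF G]
    by (intro heis.subgroupI) (auto simp: heis_act_mult heis_act_inv simp del: heis_mult heis_inv intro!: exI[of _ 0])
  then have "upper_form H \<subseteq> ?T"
    unfolding upper_form_def
  proof (rule form_span_minimal)
    show "trc z \<in> ?T" if "z \<in> upper_ideal F H" for z
    proof -
      have "cj b * (z * b) \<in> known H" by (rule ideal_mult_left[OF known_sub[OF H] upper_known(1)[OF H that b]]) simp
      then have "trc (cj b * b * z) \<in> ext_in H" by (intro ext_in_trc[OF H]) (simp add: mult_ac)
      then show ?thesis unfolding act_trc[symmetric] by simp
    qed
    show "act \<beta> a \<in> ?T" if "\<beta> \<in> D" "a \<in> upper_ideal F H" for \<beta> a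
      using ext_in_Delta[OF H upper_known(1)[OF H that(2) b] that(1)] by (simp add: heis_act_act)
    show "act \<zeta> r \<in> ?T" if "\<zeta> \<in> upper_form_gens F H" for \<zeta> r
      using that ideal_mult_left[OF pw_sub b, of r] unfolding upper_form_gens_eq
      by (auto simp: heis_act_act intro!: column_ext_in[OF H] mixed_ext_in[OF H])
  qed
  then show ?thesis using a by blast
qed

lemma EU_prod_sub:
  assumes H: "normalised H"
  shows "EU F (form_ideal_prod F (upper_level F H) (pw 10)) \<subseteq> H"
proof -
  let ?A = "ideal_mult (upper_ideal F H) (pw 10)" and ?S = "form_span (ideal_mult (upper_ideal F H) (pw 10)) (upper_form H) (pw 10)"
  note A = prod_known[OF H]
  have Ai: "invariant_ideal F ?A" by (intro ideal_mult_inv upper_ideal_inv pw_inv)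
  interpret L: form_level F "upper_ideal F H" "upper_form H"
    by (rule upper_form_level[OF subgroup.subset[OF H_sub[OF H]]])
  have Sm: "R_submodule F ?S" by (rule form_span_submodule[OF Ai ideal_mult_right[OF pw_sub]])
  have SD: "?S \<subseteq> D" by (rule form_span_D[OF L.S_D])
  have SG: "?S \<subseteq> ext_in H"
    by (rule form_span_minimal[OF ext_in_subgroup[OF H] ext_in_trc[OF H] ext_in_Delta[OF H] upper_form_ext_in[OF H]]) (use A in auto)
  show ?thesis
    unfolding upper_level_pair form_ideal_prod_eq EU_gens[OF Ai Sm SD]
    by (rule U.generate_subgroup_incl[OF _ H_sub[OF H]])
      (use A known_short_in[OF H] SG in \<open>auto simp: short_in_def ext_in_def[OF H]\<close>)
qed

text \<open>The elementary subgroup of level \<open>U(H) * I\<^sup>1\<^sup>0\<close> is contained in every conjugate of \<open>H\<close> by an elementary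
  matrix \<open>g\<close>, since the upper level of the conjugate is at least as large.  Hence it is contained in the intersection \<open>N\<close>
  of these conjugates, which is normalised by the elementary group.\<close>

lemma EU_rel_prod_sub:
  assumes H: "normalised H"
  shows "EU_rel F (form_ideal_prod F (upper_level F H) (pw 10)) \<subseteq> H"
proof -
  define L where "L = form_ideal_prod F (upper_level F H) (pw 10)"
  define N :: "('a, 'n) matrix set" where "N = {x \<in> EL. \<forall>g\<in>EL. g ** x ** iv g \<in> H}"
  have "N \<lhd> U\<lparr>carrier := EL\<rparr>"
    unfolding normal_EL_iff
  proof (intro conjI ballI)
    show "subgroup N U"
    proof (rule U.subgroupI)
      show "N \<subseteq> carrier U" using EL_unitary by (auto simp: N_def)
      have "mat 1 \<in> N"
        using subgroup.one_closed[OF EL_subgroup] H_one[OF H] by (simp add: N_def EL_unitary)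
      then show "N \<noteq> {}" by blast
      show "iv x \<in> N" if "x \<in> N" for x
      proof -
        have "g ** iv x ** iv g \<in> H" if "g \<in> EL" for g
        proof -
          have "iv (g ** x ** iv g) \<in> H" using \<open>x \<in> N\<close> that by (intro H_iv[OF H]) (simp add: N_def)
          then show ?thesis
            using EL_unitary[OF that] EL_unitary[of x] \<open>x \<in> N\<close> by (simp add: N_def iv_prod unitary_mult flip: matrix_mul_assoc)
        qed
        then show ?thesis using that by (simp add: N_def EL_iv)
      qed
      show "x \<otimes>\<^bsub>U\<^esub> y \<in> N" if "x \<in> N" "y \<in> N" for x y
      proof -
        have "g ** (x ** y) ** iv g \<in> H" if "g \<in> EL" for g
        proof -
          have "(g ** x ** iv g) ** (g ** y ** iv g) \<in> H"
            using \<open>x \<in> N\<close> \<open>y \<in> N\<close> that by (intro H_mult[OF H, of "g ** x ** iv g"]) (simp_all add: N_def)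
          then show ?thesis using EL_unitary[OF that] by (simp flip: matrix_mul_assoc)
        qed
        then show ?thesis using that by (simp add: N_def EL_mult)
      qed
    qed
    show "N \<subseteq> EL" by (auto simp: N_def)
    show "g ** x ** iv g \<in> N" if "g \<in> EL" "x \<in> N" for g x
    proof -
      have "g' ** (g ** x ** iv g) ** iv g' \<in> H" if "g' \<in> EL" for g'
      proof -
        have "(g' ** g) ** x ** iv (g' ** g) \<in> H" using that \<open>g \<in> EL\<close> \<open>x \<in> N\<close> by (simp add: N_def EL_mult)
        then show ?thesis
          using EL_unitary[OF that] EL_unitary[OF \<open>g \<in> EL\<close>] by (simp add: iv_prod flip: matrix_mul_assoc)
      qed
      then show ?thesis using that by (simp add: N_def EL_mult EL_iv)
    qed
  qed
  moreover have "EU F L \<subseteq> N"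
  proof
    fix x :: "('a, 'n) matrix" assume x: "x \<in> EU F L"
    have Hc: "H \<subseteq> carrier U" by (rule subgroup.subset[OF H_sub[OF H]])
    interpret L: form_level F "upper_ideal F H" "upper_form H" by (rule upper_form_level[OF Hc])
    have "x \<in> EL"
      using x EU_mono[OF subset_UNIV form_span_D[OF L.S_D]] unfolding L_def upper_level_pair form_ideal_prod_eq by blast
    moreover have "g ** x ** iv g \<in> H" if g: "g \<in> EL" for g
    proof -
      define H' where "H' = cnjg (iv g) H"
      have H': "normalised H'" unfolding H'_def by (rule normalised_cnjg[OF H EL_iv[OF g]])
      have "upper_ideal F H \<subseteq> upper_ideal F H'" "upper_form H \<subseteq> upper_form H'"
        using upper_level_conj[OF Hc EL_iv[OF g]] by (simp_all add: H'_def cnjg_def)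
      then have "EU F L \<subseteq> EU F (form_ideal_prod F (upper_level F H') (pw 10))"
        unfolding L_def upper_level_pair form_ideal_prod_eq
        by (intro EU_mono form_span_mono ideal_mult_inv upper_ideal_inv pw_inv)
          (auto simp: ideal_mult_def intro!: ideal.span_mono)
      then have "x \<in> H'" using EU_prod_sub[OF H'] x by blast
      then obtain h where "h \<in> H" "x = iv g ** h ** g" using EL_unitary[OF g] by (auto simp: H'_def cnjg_def)
      then show ?thesis using EL_unitary[OF g] by (simp flip: matrix_mul_assoc)
    qed
    ultimately show "x \<in> N" by (simp add: N_def)
  qed
  ultimately have "EU_rel F L \<subseteq> N" by (rule EU_rel_minimal)
  also have "N \<subseteq> H"
  proof
    fix x assume "x \<in> N"
    moreover have "(mat 1 :: ('a, 'n) matrix) \<in> EL" "iv (mat 1) = (mat 1 :: ('a, 'n) matrix)"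
      using subgroup.one_closed[OF EL_subgroup] U.inv_one by simp_all
    ultimately show "x \<in> H" by (force simp: N_def)
  qed
  finally show ?thesis by (simp add: L_def)
qed

end

theorem theorem48:
  fixes F :: "'a::comm_ring_1 form_ring"
    and I :: "'a set" and \<Omega> :: "('a \<times> 'a) set"
    and H :: "('a, 'n::finite) matrix set"
  assumes "CARD('n) \<ge> 4"
    and "hermitian_form_ring F"
    and "odd_form_ideal F (I, \<Omega>)"
    and "subgroup H (unitary_group F)"
    and "EU_rel F (I, \<Omega>) \<subseteq> normalizer (unitary_group F) H"
  shows "EU_rel F (form_ideal_prod F (upper_level F H) (ideal_power I 10)) \<subseteq> H
    \<and> H \<subseteq> CU_rel F (upper_level F H)"
proof
  interpret hermitian_forms F by unfold_locales (rule assms(2))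
  show "H \<subseteq> CU_rel F (upper_level F H)" by (rule upper_CU_rel[OF assms(4)])
  let ?E = "EU_rel F (I, \<Omega>) :: ('a, 'n) matrix set"
  have I: "invariant_ideal F I" and \<Omega>: "R_submodule F \<Omega>" "Omega_min F I \<subseteq> \<Omega>" "\<Omega> \<subseteq> D"
    using assms(3) by (auto simp: odd_form_ideal_def Omega_max_def)
  have gens: "?E \<lhd> U\<lparr>carrier := EL\<rparr>" by (rule EU_rel_normal[OF EU_mono[OF subset_UNIV \<Omega>(3)]])
  have EU: "EU F (I, \<Omega>) \<subseteq> ?E" unfolding EU_rel_def by (rule hull_subset)
  have sht: "sht i j x \<in> ?E" if "rt i j" "x \<in> I" for i j x
    by (rule subsetD[OF EU]) (unfold EU_gens[OF I \<Omega>(1,3)], rule generate.incl, use that in blast)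
  have ext: "ext i \<alpha> \<in> ?E" if "i \<noteq> Zero" "\<alpha> \<in> Omega_min F I" for i \<alpha>
    by (rule subsetD[OF EU]) (unfold EU_gens[OF I \<Omega>(1,3)], rule generate.incl, use that \<Omega>(2) in blast)
  interpret relative_level F I ?E
  proof (intro relative_level.intro relative_level_axioms.intro)
    show "hermitian_forms F" by unfold_locales
    show "subgroup ?E U" "\<And>g e. g \<in> EL \<Longrightarrow> e \<in> ?E \<Longrightarrow> g ** e ** iv g \<in> ?E"
      using gens by (simp_all add: normal_EL_iff)
  qed (use assms(1) I in \<open>auto intro!: sht ext intro: Omega_min_trc Omega_min_Delta[OF inv_ideal_sub]\<close>)
  have "e ** h ** iv e \<in> H" if "e \<in> ?E" "h \<in> H" for e h
    using subsetD[OF assms(5) that(1)] that(2) normalizer_iff[OF subgroup.subset[OF assms(4)], of e] by blast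
  then have "normalised H" using assms(4) by (simp add: normalised_def)
  then show "EU_rel F (form_ideal_prod F (upper_level F H) (pw 10)) \<subseteq> H" by (rule EU_rel_prod_sub)
qed

end
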